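(* Let $(M^n,g)$ be a connected Riemannian $\mathrm{Spin}^c$ manifold of dimension $n\ge 4$ carrying a complex generalized Killing spinor $\psi$ with Killing function $K=a+\mathrm{i}b$, $a,b\in C^\infty(M,\mathbb{R})$, i.e. $\psi$ is a spinor field, not identically zero, with $\nabla_X\psi=K\,X\cdot\psi$ for all vector fields $X$ on $M$. Then $a$ or $b$ vanishes identically on $M$. In other words, either $\psi$ is a real generalized Killing spinor with Killing function $a$ (that is, $b\equiv 0$; and then $a$ is constant, i.e. $\psi$ is a real Killing spinor), or $\psi$ is an imaginary generalized Killing spinor with Killing function $\mathrm{i}b$ (that is, $a\equiv 0$), where $b$ may be constant or a non-constant function.
   Context: A Riemannian $\mathrm{Spin}^c$ manifold is an oriented Riemannian manifold $(M^n,g)$ without boundary, $n\ge 2$, equipped with a $\mathrm{Spin}^c$ structure with auxiliary Hermitian line bundle $L$ and a (metric) connection $1$-form $A$ on the associated $\mathbb{S}^1$-principal bundle. $\Sigma M$ denotes the associated complex spinor bundle (of rank $2^{[n/2]}$), with Clifford multiplication "$\cdot$" (convention $X\cdot X=-g(X,X)$), the natural Hermitian product $\langle\cdot,\cdot\rangle$ (for which Clifford multiplication by tangent vectors is skew-Hermitian), and the $\mathrm{Spin}^c$ covariant derivative $\nabla$ induced by the Levi-Civita connection and $A$, locally $$\nabla_X\psi = X(\psi)+\tfrac14\sum_{j} e_j\cdot\nabla^M_Xe_j\cdot\psi+\tfrac{\mathrm{i}}{2}A(s_*X)\psi,$$ with $(e_j)$ a local oriented orthonormal frame, $s$ a local section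 of the $\mathbb{S}^1$-bundle and $\nabla^M$ the Levi-Civita connection. Spinor fields are smooth sections of $\Sigma M$. *)

theory Defs
  imports "HOL-Analysis.Analysis"
begin

section \<open>Smooth manifolds\<close>

fun Ck_on :: "nat \<Rightarrow> ('a::real_normed_vector \<Rightarrow> 'b::real_normed_vector) \<Rightarrow> 'a set \<Rightarrow> bool" where
  "Ck_on 0 f S \<longleftrightarrow> continuous_on S f"
| "Ck_on (Suc k) f S \<longleftrightarrow>
    (\<exists>f'. (\<forall>x\<in>S. (f has_derivative f' x) (at x)) \<and> (\<forall>v. Ck_on k (\<lambda>x. f' x v) S))"

text \<open>Only meant for open subsets of finite-dimensional spaces.\<close>

definition Csmooth_on :: "('a::real_normed_vector \<Rightarrow> 'b::real_normed_vector) \<Rightarrow> 'a set \<Rightarrow> bool" where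
  "Csmooth_on f S \<longleftrightarrow> (\<forall>k. Ck_on k f S)"

text \<open>A chart is a domain together with a coordinate map; only the restriction of the
  map to the domain matters.\<close>

type_synonym ('m, 'n) chart = "'m set \<times> ('m \<Rightarrow> real^'n)"

definition chart_inv :: "('m, 'n::finite) chart \<Rightarrow> real^'n \<Rightarrow> 'm" where
  "chart_inv c = inv_into (fst c) (snd c)"

definition transition :: "('m, 'n::finite) chart \<Rightarrow> ('m, 'n) chart \<Rightarrow> real^'n \<Rightarrow> real^'n" where
  "transition c c' = snd c' \<circ> chart_inv c"

definition smooth_atlas :: "('m::topological_space, 'n::finite) chart set \<Rightarrow> bool" where
  "smooth_atlas \<A> \<longleftrightarrow>
     (\<Union>c\<in>\<A>. fst c) = UNIV \<and>
     (\<forall>c\<in>\<A>. open (fst c) \<and> open (snd c ` fst c) \<and>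
        homeomorphism (fst c) (snd c ` fst c) (snd c) (chart_inv c)) \<and>
     (\<forall>c\<in>\<A>. \<forall>c'\<in>\<A>. Csmooth_on (transition c c') (snd c ` (fst c \<inter> fst c')))"

text \<open>The orientation of an oriented manifold is the one for which all charts of the
  atlas are positive.\<close>

definition oriented_atlas :: "('m::topological_space, 'n::finite) chart set \<Rightarrow> bool" where
  "oriented_atlas \<A> \<longleftrightarrow> smooth_atlas \<A> \<and>
     (\<forall>c\<in>\<A>. \<forall>c'\<in>\<A>. \<forall>p\<in>fst c \<inter> fst c'.
        det (matrix (frechet_derivative (transition c c') (at (snd c p)))) > 0)"

definition smooth_fun ::
  "('m, 'n::finite) chart set \<Rightarrow> 'm set \<Rightarrow> ('m \<Rightarrow> 'b::real_normed_vector) \<Rightarrow> bool" where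
  "smooth_fun \<A> W f \<longleftrightarrow> (\<forall>c\<in>\<A>. Csmooth_on (f \<circ> chart_inv c) (snd c ` (fst c \<inter> W)))"

text \<open>A tangent vector at a point is the family of its components in all the charts around that
  point, subject to the usual transformation law.  It is normalised to be 0 on every other
  argument, so that equality of tangent vectors is equality of functions; the vector space
  operations are pointwise.\<close>

type_synonym ('m, 'n) tvec = "('m, 'n) chart \<Rightarrow> real^'n"

definition tangent_space :: "('m, 'n::finite) chart set \<Rightarrow> 'm \<Rightarrow> ('m, 'n) tvec set" where
  "tangent_space \<A> p = {v.
     (\<forall>c\<in>\<A>. \<forall>c'\<in>\<A>. p \<in> fst c \<inter> fst c' \<longrightarrow>
        v c' = frechet_derivative (transition c c') (at (snd c p)) (v c)) \<and>
     (\<forall>c. c \<notin> \<A> \<or> p \<notin> fst c \<longrightarrow> v c = 0)}"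

definition tzero :: "('m, 'n::finite) tvec" where
  "tzero = (\<lambda>c. 0)"

definition tadd :: "('m, 'n::finite) tvec \<Rightarrow> ('m, 'n) tvec \<Rightarrow> ('m, 'n) tvec" where
  "tadd v w = (\<lambda>c. v c + w c)"

definition tscale :: "real \<Rightarrow> ('m, 'n::finite) tvec \<Rightarrow> ('m, 'n) tvec" where
  "tscale r v = (\<lambda>c. r *\<^sub>R v c)"

text \<open>The derivative of a function at a point in direction of a tangent vector.  By the chain
  rule the choice of the chart is irrelevant.\<close>

definition dir_deriv ::
  "('m, 'n::finite) chart set \<Rightarrow> ('m \<Rightarrow> 'b::real_normed_vector) \<Rightarrow> 'm \<Rightarrow> ('m, 'n) tvec \<Rightarrow> 'b" where
  "dir_deriv \<A> f p v =
     (let c = (SOME c. c \<in> \<A> \<and> p \<in> fst c)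
      in frechet_derivative (f \<circ> chart_inv c) (at (snd c p)) (v c))"

definition smooth_vfield ::
  "('m, 'n::finite) chart set \<Rightarrow> 'm set \<Rightarrow> ('m \<Rightarrow> ('m, 'n) tvec) \<Rightarrow> bool" where
  "smooth_vfield \<A> W X \<longleftrightarrow>
     (\<forall>p\<in>W. X p \<in> tangent_space \<A> p) \<and>
     (\<forall>c\<in>\<A>. Csmooth_on (\<lambda>x. X (chart_inv c x) c) (snd c ` (fst c \<inter> W)))"


section \<open>Riemannian metrics and the Levi-Civita connection\<close>

definition riemannian_metric ::
  "('m::topological_space, 'n::finite) chart set \<Rightarrow>
   ('m \<Rightarrow> ('m, 'n) tvec \<Rightarrow> ('m, 'n) tvec \<Rightarrow> real) \<Rightarrow> bool" where
  "riemannian_metric \<A> g \<longleftrightarrow>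
     (\<forall>p. \<forall>u\<in>tangent_space \<A> p. \<forall>v\<in>tangent_space \<A> p. \<forall>w\<in>tangent_space \<A> p. \<forall>r.
        g p (tadd u v) w = g p u w + g p v w \<and>
        g p (tscale r u) w = r * g p u w \<and>
        g p u w = g p w u) \<and>
     (\<forall>p. \<forall>v\<in>tangent_space \<A> p. v \<noteq> tzero \<longrightarrow> g p v v > 0) \<and>
     (\<forall>W X Y. open W \<and> smooth_vfield \<A> W X \<and> smooth_vfield \<A> W Y \<longrightarrow>
        smooth_fun \<A> W (\<lambda>p. g p (X p) (Y p)))"

text \<open>An affine connection: the argument order is point, direction, vector field.  The vector field
  only needs to be smooth on some open neighbourhood of the point, and only its
  restriction to that neighbourhood matters.\<close>

definition affine_connection ::
  "('m::topological_space, 'n::finite) chart set \<Rightarrow>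
   ('m \<Rightarrow> ('m, 'n) tvec \<Rightarrow> ('m \<Rightarrow> ('m, 'n) tvec) \<Rightarrow> ('m, 'n) tvec) \<Rightarrow> bool" where
  "affine_connection \<A> D \<longleftrightarrow>
     (\<forall>W Y. open W \<and> smooth_vfield \<A> W Y \<longrightarrow>
        (\<forall>p\<in>W. \<forall>v\<in>tangent_space \<A> p. \<forall>w\<in>tangent_space \<A> p. \<forall>r.
           D p v Y \<in> tangent_space \<A> p \<and>
           D p (tadd v w) Y = tadd (D p v Y) (D p w Y) \<and>
           D p (tscale r v) Y = tscale r (D p v Y)) \<and>
        (\<forall>Z. smooth_vfield \<A> W Z \<longrightarrow>
           (\<forall>p\<in>W. \<forall>v\<in>tangent_space \<A> p.
              D p v (\<lambda>q. tadd (Y q) (Z q)) = tadd (D p v Y) (D p v Z))) \<and>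
        (\<forall>f::'m \<Rightarrow> real. smooth_fun \<A> W f \<longrightarrow>
           (\<forall>p\<in>W. \<forall>v\<in>tangent_space \<A> p.
              D p v (\<lambda>q. tscale (f q) (Y q)) =
                tadd (tscale (dir_deriv \<A> f p v) (Y p)) (tscale (f p) (D p v Y)))) \<and>
        (\<forall>Z. (\<forall>q\<in>W. Z q = Y q) \<longrightarrow>
           (\<forall>p\<in>W. \<forall>v\<in>tangent_space \<A> p. D p v Z = D p v Y)) \<and>
        (\<forall>X. smooth_vfield \<A> W X \<longrightarrow> smooth_vfield \<A> W (\<lambda>p. D p (X p) Y)))"

definition metric_connection ::
  "('m::topological_space, 'n::finite) chart set \<Rightarrow>
   ('m \<Rightarrow> ('m, 'n) tvec \<Rightarrow> ('m, 'n) tvec \<Rightarrow> real) \<Rightarrow>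
   ('m \<Rightarrow> ('m, 'n) tvec \<Rightarrow> ('m \<Rightarrow> ('m, 'n) tvec) \<Rightarrow> ('m, 'n) tvec) \<Rightarrow> bool" where
  "metric_connection \<A> g D \<longleftrightarrow>
     (\<forall>W Y Z. open W \<and> smooth_vfield \<A> W Y \<and> smooth_vfield \<A> W Z \<longrightarrow>
        (\<forall>p\<in>W. \<forall>v\<in>tangent_space \<A> p.
           dir_deriv \<A> (\<lambda>q. g q (Y q) (Z q)) p v = g p (D p v Y) (Z p) + g p (Y p) (D p v Z)))"

text \<open>Both sides of \<open>D\<^sub>X Y - D\<^sub>Y X = [X, Y]\<close> are tested on
  smooth functions, where \<open>[X, Y] f = X (Y f) - Y (X f)\<close>.\<close>

definition torsion_free ::
  "('m::topological_space, 'n::finite) chart set \<Rightarrow>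
   ('m \<Rightarrow> ('m, 'n) tvec \<Rightarrow> ('m \<Rightarrow> ('m, 'n) tvec) \<Rightarrow> ('m, 'n) tvec) \<Rightarrow> bool" where
  "torsion_free \<A> D \<longleftrightarrow>
     (\<forall>W X Y. \<forall>f::'m \<Rightarrow> real.
        open W \<and> smooth_vfield \<A> W X \<and> smooth_vfield \<A> W Y \<and> smooth_fun \<A> W f \<longrightarrow>
        (\<forall>p\<in>W.
           dir_deriv \<A> f p (D p (X p) Y) - dir_deriv \<A> f p (D p (Y p) X) =
           dir_deriv \<A> (\<lambda>q. dir_deriv \<A> f q (Y q)) p (X p) -
           dir_deriv \<A> (\<lambda>q. dir_deriv \<A> f q (X q)) p (Y p)))"

definition levi_civita ::
  "('m::topological_space, 'n::finite) chart set \<Rightarrow>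
   ('m \<Rightarrow> ('m, 'n) tvec \<Rightarrow> ('m, 'n) tvec \<Rightarrow> real) \<Rightarrow>
   ('m \<Rightarrow> ('m, 'n) tvec \<Rightarrow> ('m \<Rightarrow> ('m, 'n) tvec) \<Rightarrow> ('m, 'n) tvec) \<Rightarrow> bool" where
  "levi_civita \<A> g D \<longleftrightarrow> affine_connection \<A> D \<and> metric_connection \<A> g D \<and> torsion_free \<A> D"

definition oriented_orthonormal_frame ::
  "('m, 'n::finite) chart set \<Rightarrow> ('m \<Rightarrow> ('m, 'n) tvec \<Rightarrow> ('m, 'n) tvec \<Rightarrow> real) \<Rightarrow>
   'm \<Rightarrow> ('n \<Rightarrow> ('m, 'n) tvec) \<Rightarrow> bool" where
  "oriented_orthonormal_frame \<A> g p e \<longleftrightarrow>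
     (\<forall>j. e j \<in> tangent_space \<A> p) \<and>
     (\<forall>j k. g p (e j) (e k) = (if j = k then 1 else 0)) \<and>
     (\<forall>c\<in>\<A>. p \<in> fst c \<longrightarrow> det (\<chi> i j. e j c $ i) > 0)"

text \<open>The right action of SO(n) on frames.\<close>

definition frame_act ::
  "('n::finite \<Rightarrow> ('m, 'n) tvec) \<Rightarrow> real^'n^'n \<Rightarrow> 'n \<Rightarrow> ('m, 'n) tvec" where
  "frame_act e R = (\<lambda>j c. \<Sum>i\<in>UNIV. (R $ i $ j) *\<^sub>R e i c)"


section \<open>Clifford algebra and the group Spin\<open>\<^sup>c\<close>(n)\<close>

text \<open>A unitary representation of the Clifford algebra of \<open>\<real>\<^sup>n\<close>, given by the images of the
  standard basis.  If the spinor module has dimension \<open>2^(n div 2)\<close>, it is irreducible; for odd n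
  the complex volume element may act as either of the two possible signs.\<close>

definition clifford_rep :: "('n::finite \<Rightarrow> complex^'s^'s) \<Rightarrow> bool" where
  "clifford_rep \<gamma> \<longleftrightarrow>
     (\<forall>i j. \<gamma> i ** \<gamma> j + \<gamma> j ** \<gamma> i = (if i = j then - mat 2 else 0)) \<and>
     (\<forall>i a b. cnj (\<gamma> i $ b $ a) = - (\<gamma> i $ a $ b))"

definition cliff :: "('n::finite \<Rightarrow> complex^'s^'s) \<Rightarrow> real^'n \<Rightarrow> complex^'s^'s" where
  "cliff \<gamma> x = (\<Sum>i\<in>UNIV. (x $ i) *\<^sub>R \<gamma> i)"

text \<open>Spin(n) and Spin\<open>\<^sup>c\<close>(n) are realised inside the endomorphisms of the spinor module.  This loses
  nothing, since the spinor representation of Spin\<open>\<^sup>c\<close>(n) is faithful for \<open>n \<ge> 2\<close>.\<close>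

inductive_set spin_group :: "('n::finite \<Rightarrow> complex^'s^'s) \<Rightarrow> (complex^'s^'s) set"
  for \<gamma> :: "'n \<Rightarrow> complex^'s^'s" where
  one: "mat 1 \<in> spin_group \<gamma>"
| step: "u \<in> spin_group \<gamma> \<Longrightarrow> norm x = 1 \<Longrightarrow> norm y = 1 \<Longrightarrow>
    u ** cliff \<gamma> x ** cliff \<gamma> y \<in> spin_group \<gamma>"

definition spinc_group :: "('n::finite \<Rightarrow> complex^'s^'s) \<Rightarrow> (complex^'s^'s) set" where
  "spinc_group \<gamma> = {mat z ** u | z u. cmod z = 1 \<and> u \<in> spin_group \<gamma>}"

definition circle_group :: "complex set" where
  "circle_group = {z. cmod z = 1}"

text \<open>The two components of the double covering \<open>\<xi> : Spin\<^sup>c(n) \<rightarrow> SO(n) \<times> S\<^sup>1\<close>,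
  \<open>[u, z] \<mapsto> (Ad u, z\<^sup>2)\<close>.\<close>

definition spinc_rot :: "('n::finite \<Rightarrow> complex^'s^'s) \<Rightarrow> complex^'s^'s \<Rightarrow> real^'n^'n" where
  "spinc_rot \<gamma> a = (THE R. \<forall>x. a ** cliff \<gamma> x = cliff \<gamma> (R *v x) ** a)"

definition spinc_det :: "('n::finite \<Rightarrow> complex^'s^'s) \<Rightarrow> complex^'s^'s \<Rightarrow> complex" where
  "spinc_det \<gamma> a =
     (THE w. \<exists>z u. cmod z = 1 \<and> u \<in> spin_group \<gamma> \<and> a = mat z ** u \<and> w = z\<^sup>2)"


section \<open>Principal bundles\<close>

text \<open>The total space of a principal bundle is a type; its smooth structure is given by a bundle
  atlas, i.e. a family of local sections (with their open domains) that cover the base and are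
  related by smooth group-valued functions.\<close>

record ('m, 'p, 'g) pbundle =
  proj :: "'p \<Rightarrow> 'm"
  ract :: "'p \<Rightarrow> 'g \<Rightarrow> 'p"
  bsections :: "('m set \<times> ('m \<Rightarrow> 'p)) set"

text \<open>\<open>fibre_diff G B u u'\<close> is the group element \<open>a\<close> with \<open>u' = u a\<close>.\<close>

definition fibre_diff :: "'g set \<Rightarrow> ('m, 'p, 'g) pbundle \<Rightarrow> 'p \<Rightarrow> 'p \<Rightarrow> 'g" where
  "fibre_diff G B u u' = (THE a. a \<in> G \<and> u' = ract B u a)"

text \<open>The structure group is a matrix group (or the circle), so that smoothness of group-valued functions
  is smoothness into the ambient vector space.\<close>

definition principal_bundle ::
  "('m::topological_space, 'n::finite) chart set \<Rightarrow> 'g set \<Rightarrow> ('g \<Rightarrow> 'g \<Rightarrow> 'g) \<Rightarrow> 'g \<Rightarrow>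
   ('m, 'p, 'g::real_normed_vector) pbundle \<Rightarrow> bool" where
  "principal_bundle \<A> G mul e B \<longleftrightarrow>
     (\<forall>u. ract B u e = u) \<and>
     (\<forall>u. \<forall>a\<in>G. \<forall>b\<in>G. ract B (ract B u a) b = ract B u (mul a b)) \<and>
     (\<forall>u. \<forall>a\<in>G. proj B (ract B u a) = proj B u) \<and>
     (\<forall>u u'. proj B u = proj B u' \<longrightarrow> (\<exists>!a. a \<in> G \<and> u' = ract B u a)) \<and>
     (\<Union>(U, s)\<in>bsections B. U) = UNIV \<and>
     (\<forall>(U, s)\<in>bsections B. open U \<and> (\<forall>p\<in>U. proj B (s p) = p)) \<and>
     (\<forall>(U, s)\<in>bsections B. \<forall>(V, t)\<in>bsections B.
        smooth_fun \<A> (U \<inter> V) (\<lambda>p. fibre_diff G B (s p) (t p)))"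

definition local_section ::
  "('m::topological_space, 'n::finite) chart set \<Rightarrow> 'g set \<Rightarrow>
   ('m, 'p, 'g::real_normed_vector) pbundle \<Rightarrow> 'm set \<Rightarrow> ('m \<Rightarrow> 'p) \<Rightarrow> bool" where
  "local_section \<A> G B U s \<longleftrightarrow> open U \<and> (\<forall>p\<in>U. proj B (s p) = p) \<and>
     (\<forall>(V, t)\<in>bsections B. smooth_fun \<A> (U \<inter> V) (\<lambda>p. fibre_diff G B (t p) (s p)))"


section \<open>Connections on circle bundles\<close>

text \<open>\<open>-\<i> h\<^sup>-\<^sup>1 dh(v)\<close> for a function \<open>h\<close> with values in the unit circle (where this is real).\<close>

definition angle_deriv ::
  "('m, 'n::finite) chart set \<Rightarrow> ('m \<Rightarrow> complex) \<Rightarrow> 'm \<Rightarrow> ('m, 'n) tvec \<Rightarrow> real" where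
  "angle_deriv \<A> h p v = Re (- \<i> * inverse (h p) * dir_deriv \<A> h p v)"

text \<open>A tangent vector to the total space of a circle bundle consists of its projection to the base
  and, for each bundle section \<open>s\<close> around the base point, its vertical component in the
  trivialisation given by \<open>s\<close>: the velocity at \<open>t = 0\<close> of a curve \<open>s (c t) exp (\<i> \<phi>(t))\<close> has
  vertical component \<open>\<phi>'(0)\<close>.  Rewriting the curve in terms of another section \<open>s'\<close> with
  \<open>s = s' h\<close> adds \<open>-\<i> h\<^sup>-\<^sup>1 dh\<close>.\<close>

type_synonym ('m, 'n, 'q) cvec = "('m, 'n) tvec \<times> ('m set \<times> ('m \<Rightarrow> 'q) \<Rightarrow> real)"

definition circle_tangent_space ::
  "('m, 'n::finite) chart set \<Rightarrow> ('m, 'q, complex) pbundle \<Rightarrow> 'q \<Rightarrow> ('m, 'n, 'q) cvec set" where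
  "circle_tangent_space \<A> Q q = {(v, y).
     v \<in> tangent_space \<A> (proj Q q) \<and>
     (\<forall>\<sigma>\<in>bsections Q. \<forall>\<sigma>'\<in>bsections Q. proj Q q \<in> fst \<sigma> \<inter> fst \<sigma>' \<longrightarrow>
        y \<sigma>' = y \<sigma> +
          angle_deriv \<A> (\<lambda>p. fibre_diff circle_group Q (snd \<sigma>' p) (snd \<sigma> p)) (proj Q q) v) \<and>
     (\<forall>\<sigma>. \<sigma> \<notin> bsections Q \<or> proj Q q \<notin> fst \<sigma> \<longrightarrow> y \<sigma> = 0)}"

text \<open>The differential of a local section.\<close>

definition section_push ::
  "('m, 'n::finite) chart set \<Rightarrow> ('m, 'q, complex) pbundle \<Rightarrow> ('m \<Rightarrow> 'q) \<Rightarrow> 'm \<Rightarrow>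
   ('m, 'n) tvec \<Rightarrow> ('m, 'n, 'q) cvec" where
  "section_push \<A> Q s p v =
     (v, \<lambda>\<sigma>. if \<sigma> \<in> bsections Q \<and> p \<in> fst \<sigma>
             then angle_deriv \<A> (\<lambda>p'. fibre_diff circle_group Q (snd \<sigma> p') (s p')) p v
             else 0)"

text \<open>The velocity of \<open>q exp (\<i> t)\<close>.\<close>

definition fundamental_vec ::
  "('m, 'q, complex) pbundle \<Rightarrow> 'q \<Rightarrow> ('m, 'n::finite, 'q) cvec" where
  "fundamental_vec Q q =
     (tzero, \<lambda>\<sigma>. if \<sigma> \<in> bsections Q \<and> proj Q q \<in> fst \<sigma> then 1 else 0)"

text \<open>Connection forms are real-valued: the Lie algebra \<open>\<i>\<real>\<close> of the circle is identified with
  \<open>\<real>\<close>.  In the description above, right translations act as the identity on components,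
  which is why the tangent vector \<open>w\<close> is the same on both sides of the invariance condition.\<close>

definition connection_form ::
  "('m::topological_space, 'n::finite) chart set \<Rightarrow> ('m, 'q, complex) pbundle \<Rightarrow>
   ('q \<Rightarrow> ('m, 'n, 'q) cvec \<Rightarrow> real) \<Rightarrow> bool" where
  "connection_form \<A> Q A \<longleftrightarrow>
     (\<forall>q. \<forall>(v, y)\<in>circle_tangent_space \<A> Q q. \<forall>(v', y')\<in>circle_tangent_space \<A> Q q. \<forall>r.
        A q (tadd v v', \<lambda>\<sigma>. y \<sigma> + y' \<sigma>) = A q (v, y) + A q (v', y') \<and>
        A q (tscale r v, \<lambda>\<sigma>. r * y \<sigma>) = r * A q (v, y)) \<and>
     (\<forall>q. \<forall>z\<in>circle_group. \<forall>w\<in>circle_tangent_space \<A> Q q. A (ract Q q z) w = A q w) \<and>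
     (\<forall>q. A q (fundamental_vec Q q) = 1) \<and>
     (\<forall>(U, s)\<in>bsections Q. \<forall>W X. open W \<and> smooth_vfield \<A> W X \<longrightarrow>
        smooth_fun \<A> (U \<inter> W) (\<lambda>p. A (s p) (section_push \<A> Q s p (X p))))"


section \<open>Spin\<open>\<^sup>c\<close> manifolds\<close>

text \<open>\<open>covering\<close> is the bundle map from the Spin\<open>\<^sup>c\<close> bundle to the fibre product of the bundle of
  oriented orthonormal frames and the circle bundle.\<close>

record ('m, 'n, 's, 'p, 'q) spinc_data =
  atlas :: "('m, 'n) chart set"
  metric :: "'m \<Rightarrow> ('m, 'n) tvec \<Rightarrow> ('m, 'n) tvec \<Rightarrow> real"
  lc_conn :: "'m \<Rightarrow> ('m, 'n) tvec \<Rightarrow> ('m \<Rightarrow> ('m, 'n) tvec) \<Rightarrow> ('m, 'n) tvec"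
  gam :: "'n \<Rightarrow> complex^'s^'s"
  spinc_bundle :: "('m, 'p, complex^'s^'s) pbundle"
  circle_bundle :: "('m, 'q, complex) pbundle"
  covering :: "'p \<Rightarrow> ('n \<Rightarrow> ('m, 'n) tvec) \<times> 'q"
  conn_form :: "'q \<Rightarrow> ('m, 'n, 'q) cvec \<Rightarrow> real"

text \<open>Equivariance along \<open>\<xi>\<close> forces \<open>covering\<close> to be a two-fold covering of the fibre product, because
  \<open>\<xi>\<close> is one and both sides are principal.\<close>

definition spinc_structure :: "('m::topological_space, 'n::finite, 's::finite, 'p, 'q) spinc_data \<Rightarrow> bool" where
  "spinc_structure S \<longleftrightarrow>
     principal_bundle (atlas S) (spinc_group (gam S)) (**) (mat 1) (spinc_bundle S) \<and>
     principal_bundle (atlas S) circle_group (*) 1 (circle_bundle S) \<and>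
     (\<forall>u. oriented_orthonormal_frame (atlas S) (metric S) (proj (spinc_bundle S) u) (fst (covering S u)) \<and>
          proj (circle_bundle S) (snd (covering S u)) = proj (spinc_bundle S) u) \<and>
     (\<forall>u. \<forall>a\<in>spinc_group (gam S).
        covering S (ract (spinc_bundle S) u a) =
          (frame_act (fst (covering S u)) (spinc_rot (gam S) a),
           ract (circle_bundle S) (snd (covering S u)) (spinc_det (gam S) a))) \<and>
     (\<forall>(U, s)\<in>bsections (spinc_bundle S).
        (\<forall>j. smooth_vfield (atlas S) U (\<lambda>p. fst (covering S (s p)) j)) \<and>
        local_section (atlas S) circle_group (circle_bundle S) U (\<lambda>p. snd (covering S (s p))))"

definition spinc_manifold ::
  "('m::{t2_space,second_countable_topology}, 'n::finite, 's::finite, 'p, 'q) spinc_data \<Rightarrow> bool" where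
  "spinc_manifold S \<longleftrightarrow>
     CARD('n) \<ge> 2 \<and>
     oriented_atlas (atlas S) \<and>
     riemannian_metric (atlas S) (metric S) \<and>
     levi_civita (atlas S) (metric S) (lc_conn S) \<and>
     CARD('s) = 2 ^ (CARD('n) div 2) \<and>
     clifford_rep (gam S) \<and>
     spinc_structure S \<and>
     connection_form (atlas S) (circle_bundle S) (conn_form S)"


section \<open>Spinors\<close>

text \<open>The spinor bundle is the associated bundle of the Spin\<open>\<^sup>c\<close> bundle: its elements
  are the classes of pairs \<open>(u, \<sigma>)\<close> modulo \<open>(u a, a\<^sup>-\<^sup>1 \<sigma>) \<sim> (u, \<sigma>)\<close>.\<close>

type_synonym ('p, 's) spinor = "('p \<times> (complex^'s)) set"

definition spinor_class ::
  "('m, 'n::finite, 's::finite, 'p, 'q) spinc_data \<Rightarrow> 'p \<Rightarrow> complex^'s \<Rightarrow> ('p, 's) spinor" where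
  "spinor_class S u \<sigma> =
     {(ract (spinc_bundle S) u a, \<tau>) | a \<tau>. a \<in> spinc_group (gam S) \<and> a *v \<tau> = \<sigma>}"

definition spinor_fibre ::
  "('m, 'n::finite, 's::finite, 'p, 'q) spinc_data \<Rightarrow> 'm \<Rightarrow> ('p, 's) spinor set" where
  "spinor_fibre S p = {spinor_class S u \<sigma> | u \<sigma>. proj (spinc_bundle S) u = p}"

definition spinor_zero :: "('m, 'n::finite, 's::finite, 'p, 'q) spinc_data \<Rightarrow> 'm \<Rightarrow> ('p, 's) spinor" where
  "spinor_zero S p = {(u, 0) | u. proj (spinc_bundle S) u = p}"

definition spinor_scale :: "complex \<Rightarrow> ('p, 's::finite) spinor \<Rightarrow> ('p, 's) spinor" where
  "spinor_scale k \<Psi> = (\<lambda>(u, \<sigma>). (u, k *s \<sigma>)) ` \<Psi>"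

definition clifford_mult ::
  "('m, 'n::finite, 's::finite, 'p, 'q) spinc_data \<Rightarrow> ('m, 'n) tvec \<Rightarrow> ('p, 's) spinor \<Rightarrow>
   ('p, 's) spinor" where
  "clifford_mult S v \<Psi> =
     (\<lambda>(u, \<sigma>). (u, cliff (gam S)
        (\<chi> j. metric S (proj (spinc_bundle S) u) v (fst (covering S u) j)) *v \<sigma>)) ` \<Psi>"

text \<open>The representative of a spinor with respect to an element of the Spin\<open>\<^sup>c\<close> bundle.\<close>

definition spinor_rep :: "'p \<Rightarrow> ('p, 's::finite) spinor \<Rightarrow> complex^'s" where
  "spinor_rep u \<Psi> = (THE \<sigma>. (u, \<sigma>) \<in> \<Psi>)"

definition spinor_field ::
  "('m, 'n::finite, 's::finite, 'p, 'q) spinc_data \<Rightarrow> ('m \<Rightarrow> ('p, 's) spinor) \<Rightarrow> bool" where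
  "spinor_field S \<psi> \<longleftrightarrow>
     (\<forall>p. \<psi> p \<in> spinor_fibre S p) \<and>
     (\<forall>(U, s)\<in>bsections (spinc_bundle S). smooth_fun (atlas S) U (\<lambda>p. spinor_rep (s p) (\<psi> p)))"

text \<open>The representative, with respect to a local section \<open>u\<close> of the Spin\<open>\<^sup>c\<close> bundle, of the covariant
  derivative of \<open>\<psi>\<close> in direction \<open>v\<close>.  Here \<open>e\<close> and \<open>s\<close> are the induced local
  frame and the induced local section of the circle bundle.\<close>

definition local_spinc_deriv ::
  "('m, 'n::finite, 's::finite, 'p, 'q) spinc_data \<Rightarrow> ('m \<Rightarrow> 'p) \<Rightarrow> ('m \<Rightarrow> ('p, 's) spinor) \<Rightarrow>
   'm \<Rightarrow> ('m, 'n) tvec \<Rightarrow> complex^'s" where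
  "local_spinc_deriv S u \<psi> p v =
     (let e = (\<lambda>j q. fst (covering S (u q)) j);
          s = (\<lambda>q. snd (covering S (u q)));
          \<sigma> = (\<lambda>q. spinor_rep (u q) (\<psi> q))
      in dir_deriv (atlas S) \<sigma> p v
         + (1/4) *\<^sub>R (\<Sum>j\<in>UNIV. gam S j *v
             (cliff (gam S) (\<chi> k. metric S p (lc_conn S p v (e j)) (e k p)) *v \<sigma> p))
         + (\<i> / 2 * of_real (conn_form S (s p) (section_push (atlas S) (circle_bundle S) s p v))) *s \<sigma> p)"

text \<open>\<open>\<Phi>\<close> is the value at \<open>p\<close> of the covariant derivative of \<open>\<psi>\<close> in direction \<open>v\<close>.\<close>

definition has_spinc_deriv ::
  "('m::topological_space, 'n::finite, 's::finite, 'p, 'q) spinc_data \<Rightarrow> ('m \<Rightarrow> ('p, 's) spinor) \<Rightarrow>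
   'm \<Rightarrow> ('m, 'n) tvec \<Rightarrow> ('p, 's) spinor \<Rightarrow> bool" where
  "has_spinc_deriv S \<psi> p v \<Phi> \<longleftrightarrow>
     (\<forall>U u. local_section (atlas S) (spinc_group (gam S)) (spinc_bundle S) U u \<and> p \<in> U \<longrightarrow>
        \<Phi> = spinor_class S (u p) (local_spinc_deriv S u \<psi> p v))"

definition generalized_killing_spinor ::
  "('m::topological_space, 'n::finite, 's::finite, 'p, 'q) spinc_data \<Rightarrow> ('m \<Rightarrow> complex) \<Rightarrow>
   ('m \<Rightarrow> ('p, 's) spinor) \<Rightarrow> bool" where
  "generalized_killing_spinor S K \<psi> \<longleftrightarrow>
     spinor_field S \<psi> \<and>
     (\<exists>p. \<psi> p \<noteq> spinor_zero S p) \<and>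
     smooth_fun (atlas S) UNIV K \<and>
     (\<forall>p. \<forall>v\<in>tangent_space (atlas S) p.
        has_spinc_deriv S \<psi> p v (spinor_scale (K p) (clifford_mult S v (\<psi> p))))"

definition real_generalized_killing_spinor ::
  "('m::topological_space, 'n::finite, 's::finite, 'p, 'q) spinc_data \<Rightarrow> ('m \<Rightarrow> real) \<Rightarrow>
   ('m \<Rightarrow> ('p, 's) spinor) \<Rightarrow> bool" where
  "real_generalized_killing_spinor S a \<psi> \<longleftrightarrow>
     generalized_killing_spinor S (\<lambda>p. of_real (a p)) \<psi>"

definition imaginary_generalized_killing_spinor ::
  "('m::topological_space, 'n::finite, 's::finite, 'p, 'q) spinc_data \<Rightarrow> ('m \<Rightarrow> real) \<Rightarrow>
   ('m \<Rightarrow> ('p, 's) spinor) \<Rightarrow> bool" where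
  "imaginary_generalized_killing_spinor S b \<psi> \<longleftrightarrow>
     generalized_killing_spinor S (\<lambda>p. \<i> * of_real (b p)) \<psi>"

definition real_killing_spinor ::
  "('m::topological_space, 'n::finite, 's::finite, 'p, 'q) spinc_data \<Rightarrow> real \<Rightarrow>
   ('m \<Rightarrow> ('p, 's) spinor) \<Rightarrow> bool" where
  "real_killing_spinor S c \<psi> \<longleftrightarrow> real_generalized_killing_spinor S (\<lambda>_. c) \<psi>"

end

theory Submission
  imports Defs
begin

text \<open>
  Choose a local frame \<open>e\<^sub>i\<close> and a Spin\<open>\<^sup>c\<close> section, and consider \<open>f = |\<psi>|\<^sup>2\<close> and the forms \<open>\<eta>\<close>, \<open>\<omega>\<close>, \<open>\<tau>\<close>
  of degree 1, 2, 3 given by the imaginary resp. real parts of \<open>\<langle>X \<cdot> \<psi>, \<psi>\<rangle>\<close>, \<open>\<langle>X \<cdot> Y \<cdot> \<psi>, \<psi>\<rangle>\<close> and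
  \<open>\<langle>X \<cdot> Y \<cdot> Z \<cdot> \<psi>, \<psi>\<rangle>\<close>.  Pairing the curvature identity
  \<open>R(X, Y) \<psi> = dK(X) Y \<cdot> \<psi> - dK(Y) X \<cdot> \<psi> + K\<^sup>2 (Y \<cdot> X - X \<cdot> Y) \<cdot> \<psi>\<close> with \<open>\<psi>\<close> gives
  \<open>4 a b \<omega> = db \<and> \<eta>\<close>.  Where \<open>a b \<noteq> 0\<close> and \<open>n \<ge> 4\<close>, the covariant derivative of this equation
  forces \<open>\<omega> = 0\<close>; differentiating again gives \<open>\<eta> = 0\<close> and then \<open>b f = 0\<close>, which is impossible because
  \<open>\<psi>\<close> has no zeros on a connected manifold.  Hence \<open>a b = 0\<close>.  Where \<open>a \<noteq> 0\<close>, so that \<open>b\<close> vanishes locally,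
  the Clifford trace of the curvature identity involves only the Ricci tensor and the curvature of the auxiliary
  connection, and pairing it with suitable spinors gives \<open>da = 0\<close>.  So \<open>{a = c}\<close> is open and closed for every
  \<open>c \<noteq> 0\<close>.
\<close>

section \<open>Calculus of smooth functions on open sets\<close>

text \<open>Geometry enters only through components in an orthonormal frame read in a chart, where
  the Levi-Civita connection is a skew array \<open>w\<close> tied to the frame by vanishing
  torsion. The Bianchi identity and the curvature identity then both come from commuting second
  derivatives, of the frame and of the spinor respectively, and no curvature operator on a bundle
  has to be built. Spinors are kept as a real inner product space with a skew complex structure,
  since each pairing uses only the real or only the imaginary part. Zeros of the spinor have to be
  excluded before any curvature is computed: the curvature identity differentiates the connection
  form, and solving the Killing equation for that form requires division by f. As f is not constant
  where b is nonzero, the argument for zeros rests on the bound |df| \<le> 2 |b| f along the frame.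
  The bound n \<ge> 4 acts in two places: three covectors leave a nonzero orthogonal vector, and the
  factor n - 3 can be cancelled.\<close>

lemma Ck_on_cong:
  assumes "open S" "\<And>x. x \<in> S \<Longrightarrow> f x = g x"
  shows "Ck_on k f S \<longleftrightarrow> Ck_on k g S"
proof -
  have "Ck_on k g S" if "Ck_on k f S" "\<And>x. x \<in> S \<Longrightarrow> f x = g x" for f g :: "'a \<Rightarrow> 'b"
  proof (cases k)
    case 0
    then show ?thesis using that continuous_on_cong[of S S f g] by simp
  next
    case (Suc k')
    then show ?thesis using that \<open>open S\<close>
      by simp (meson has_derivative_transform_within_open)
  qed
  then show ?thesis using assms by metis
qed

lemma Ck_on_subset: "Ck_on k f S \<Longrightarrow> T \<subseteq> S \<Longrightarrow> Ck_on k f T"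
proof (induction k arbitrary: f)
  case 0
  then show ?case using continuous_on_subset by auto
next
  case (Suc k)
  then show ?case by (simp add: subset_iff) metis
qed

lemma Ck_on_bounded_linear:
  assumes T: "bounded_linear T"
  shows "Ck_on k f S \<Longrightarrow> Ck_on k (\<lambda>x. T (f x)) S"
proof (induction k arbitrary: f)
  case 0
  then show ?case using bounded_linear.continuous_on[OF T] by auto
next
  case (Suc k)
  then obtain f' where f': "\<And>x. x \<in> S \<Longrightarrow> (f has_derivative f' x) (at x)" "\<And>v. Ck_on k (\<lambda>x. f' x v) S"
    by auto
  have "(\<forall>x\<in>S. ((\<lambda>x. T (f x)) has_derivative (\<lambda>v. T (f' x v))) (at x))"
    using bounded_linear.has_derivative[OF T] f'(1) by blast
  moreover have "\<forall>v. Ck_on k (\<lambda>x. T (f' x v)) S" using Suc.IH f'(2) by blast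
  ultimately show ?case unfolding Ck_on.simps by (intro exI[of _ "\<lambda>x v. T (f' x v)"]) auto
qed

lemma Csmooth_on_subset: "Csmooth_on f S \<Longrightarrow> T \<subseteq> S \<Longrightarrow> Csmooth_on f T"
  unfolding Csmooth_on_def using Ck_on_subset by blast

lemma Csmooth_on_bounded_linear: "bounded_linear T \<Longrightarrow> Csmooth_on f S \<Longrightarrow> Csmooth_on (\<lambda>x. T (f x)) S"
  unfolding Csmooth_on_def using Ck_on_bounded_linear by blast

lemma Csmooth_on_continuous: "Csmooth_on f S \<Longrightarrow> continuous_on S f"
  unfolding Csmooth_on_def using Ck_on.simps(1) by blast

lemma Csmooth_on_has_derivative:
  assumes "Csmooth_on f S" "x \<in> S"
  shows "(f has_derivative frechet_derivative f (at x)) (at x)"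
proof -
  have "Ck_on (Suc 0) f S" using assms(1) unfolding Csmooth_on_def by blast
  then have "f differentiable at x" using assms(2) unfolding Ck_on.simps differentiable_def by blast
  then show ?thesis by (simp add: frechet_derivative_works)
qed

lemma Csmooth_on_frechet_derivative:
  assumes "open S" "Csmooth_on f S"
  shows "Csmooth_on (\<lambda>x. frechet_derivative f (at x) v) S"
  unfolding Csmooth_on_def
proof
  fix k
  have "Ck_on (Suc k) f S" using assms(2) unfolding Csmooth_on_def by blast
  then obtain f' where f': "\<And>x. x \<in> S \<Longrightarrow> (f has_derivative f' x) (at x)" "\<And>v. Ck_on k (\<lambda>x. f' x v) S"
    by auto
  have "f' x v = frechet_derivative f (at x) v" if "x \<in> S" for x
    using frechet_derivative_at[OF f'(1)[OF that]] by simp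
  then show "Ck_on k (\<lambda>x. frechet_derivative f (at x) v) S"
    using f'(2)[of v] Ck_on_cong[OF assms(1), of "\<lambda>x. f' x v" "\<lambda>x. frechet_derivative f (at x) v" k] by simp
qed

section \<open>Symmetry of second derivatives and brackets of vector fields\<close>

lemma has_derivative_line:
  assumes "(f has_derivative D) (at (y + s *\<^sub>R u))"
  shows "((\<lambda>s. f (y + s *\<^sub>R u)) has_real_derivative D u) (at s)"
proof -
  have "((\<lambda>s. y + s *\<^sub>R u) has_derivative (\<lambda>h. h *\<^sub>R u)) (at s)"
    by (auto intro!: derivative_eq_intros)
  from has_derivative_compose[OF this assms]
  have "((\<lambda>s. f (y + s *\<^sub>R u)) has_derivative (\<lambda>h. D (h *\<^sub>R u))) (at s)" .
  moreover have "D (h *\<^sub>R u) = D u * h" for h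
    using linear_scale[OF has_derivative_linear[OF assms]] by simp
  ultimately show ?thesis by (simp add: has_field_derivative_def)
qed

text \<open>The mean value theorem is applied once in direction \<open>u\<close>, to the difference
  of two parallel segments, and once in direction \<open>v\<close>, to the resulting first
  derivative. The second difference on the left does not see the order of the directions, which is
  what makes it a link between the two mixed derivatives.\<close>

lemma second_difference_mvt:
  fixes f :: "'a::real_normed_vector \<Rightarrow> real"
  assumes sm: "open S" "Csmooth_on f S" and t: "t > 0"
    and S: "\<And>s r. 0 \<le> s \<Longrightarrow> s \<le> t \<Longrightarrow> 0 \<le> r \<Longrightarrow> r \<le> t \<Longrightarrow> x + s *\<^sub>R u + r *\<^sub>R v \<in> S"
  shows "\<exists>s r. 0 < s \<and> s < t \<and> 0 < r \<and> r < t \<and>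
    f (x + t *\<^sub>R u + t *\<^sub>R v) - f (x + t *\<^sub>R u) - (f (x + t *\<^sub>R v) - f x)
    = t * (t * frechet_derivative (\<lambda>y. frechet_derivative f (at y) u) (at (x + s *\<^sub>R u + r *\<^sub>R v)) v)"
proof -
  define f1 where "f1 y = frechet_derivative f (at y) u" for y
  define g where "g s = f (x + t *\<^sub>R v + s *\<^sub>R u) - f (x + s *\<^sub>R u)" for s
  have g: "(g has_real_derivative f1 (x + t *\<^sub>R v + s *\<^sub>R u) - f1 (x + s *\<^sub>R u)) (at s)"
    if "0 \<le> s" "s \<le> t" for s
    unfolding g_def f1_def
    using S[of s t] S[of s 0] that t
    by (intro DERIV_diff has_derivative_line Csmooth_on_has_derivative[OF sm(2)]) (simp_all add: algebra_simps)
  obtain s where s: "0 < s" "s < t" "g t - g 0 = t * (f1 (x + t *\<^sub>R v + s *\<^sub>R u) - f1 (x + s *\<^sub>R u))"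
    using MVT2[of 0 t g, OF t g] by auto
  define h where "h r = f1 (x + s *\<^sub>R u + r *\<^sub>R v)" for r
  have h: "(h has_real_derivative frechet_derivative f1 (at (x + s *\<^sub>R u + r *\<^sub>R v)) v) (at r)"
    if "0 \<le> r" "r \<le> t" for r
  proof -
    have "Csmooth_on f1 S" unfolding f1_def by (rule Csmooth_on_frechet_derivative[OF sm])
    then show ?thesis unfolding h_def
      using S[of s r] that s by (intro has_derivative_line Csmooth_on_has_derivative) auto
  qed
  obtain r where r: "0 < r" "r < t" "h t - h 0 = t * frechet_derivative f1 (at (x + s *\<^sub>R u + r *\<^sub>R v)) v"
    using MVT2[of 0 t h, OF t h] by auto
  have "f (x + t *\<^sub>R u + t *\<^sub>R v) - f (x + t *\<^sub>R u) - (f (x + t *\<^sub>R v) - f x) = g t - g 0"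
    by (simp add: g_def add_ac)
  also have "\<dots> = t * (h t - h 0)" unfolding s(3) by (simp add: h_def add_ac)
  finally have "f (x + t *\<^sub>R u + t *\<^sub>R v) - f (x + t *\<^sub>R u) - (f (x + t *\<^sub>R v) - f x)
    = t * (t * frechet_derivative f1 (at (x + s *\<^sub>R u + r *\<^sub>R v)) v)" unfolding r(3) .
  then show ?thesis using s r unfolding f1_def by blast
qed

lemma symmetric_second_derivative_real:
  fixes f :: "'a::real_normed_vector \<Rightarrow> real"
  assumes sm: "open S" "Csmooth_on f S" and x: "x \<in> S"
  shows "frechet_derivative (\<lambda>y. frechet_derivative f (at y) u) (at x) v
       = frechet_derivative (\<lambda>y. frechet_derivative f (at y) v) (at x) u" (is "?L x = ?R x")
proof (rule ccontr)
  assume ne: "?L x \<noteq> ?R x"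
  define e where "e = \<bar>?L x - ?R x\<bar> / 2"
  have e: "e > 0" using ne by (simp add: e_def)
  have c: "continuous (at x) ?L" "continuous (at x) ?R"
    using Csmooth_on_continuous[OF Csmooth_on_frechet_derivative[OF sm(1) Csmooth_on_frechet_derivative[OF sm]]]
      x sm(1) continuous_on_eq_continuous_at by blast+
  obtain d1 where d1: "d1 > 0" "\<And>y. dist y x < d1 \<Longrightarrow> dist (?L y) (?L x) < e"
    using c(1) e unfolding continuous_at_eps_delta by blast
  obtain d2 where d2: "d2 > 0" "\<And>y. dist y x < d2 \<Longrightarrow> dist (?R y) (?R x) < e"
    using c(2) e unfolding continuous_at_eps_delta by blast
  obtain d3 where d3: "d3 > 0" "ball x d3 \<subseteq> S" using sm(1) x open_contains_ball by blast
  define d where "d = min d1 (min d2 d3)"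
  have d: "d > 0" using d1 d2 d3 by (simp add: d_def)
  \<comment> \<open>The summand 1 keeps the denominator positive for zero vectors; the factor 2
    keeps the whole parallelogram strictly inside the ball of radius \<open>d\<close>.\<close>
  define t where "t = d / (2 * (norm u + norm v + 1))"
  have nn: "norm u + norm v + 1 > 0" by (simp add: add_nonneg_pos)
  have t: "t > 0" using d nn by (simp add: t_def)
  have near: "dist (x + s *\<^sub>R w + r *\<^sub>R z) x < d"
    if "0 \<le> s" "s \<le> t" "0 \<le> r" "r \<le> t" "w = u \<and> z = v \<or> w = v \<and> z = u" for s r w z
  proof -
    have "dist (x + s *\<^sub>R w + r *\<^sub>R z) x = norm (s *\<^sub>R w + r *\<^sub>R z)" by (simp add: dist_norm)
    also have "\<dots> \<le> s * norm w + r * norm z" using that norm_triangle_ineq[of "s *\<^sub>R w" "r *\<^sub>R z"] by simp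
    also have "\<dots> \<le> t * norm w + t * norm z" using that by (intro add_mono mult_right_mono) auto
    also have "\<dots> \<le> t * (norm u + norm v + 1)" using that t by (auto simp: algebra_simps)
    also have "\<dots> = d / 2" using nn unfolding t_def by (metis divide_divide_eq_left mult.commute nonzero_mult_div_cancel_left order_less_irrefl times_divide_eq_right)
    finally show ?thesis using d by simp
  qed
  have inS: "x + s *\<^sub>R w + r *\<^sub>R z \<in> S"
    if "0 \<le> s" "s \<le> t" "0 \<le> r" "r \<le> t" "w = u \<and> z = v \<or> w = v \<and> z = u" for s r w z
    using near[OF that] d3(2) by (auto simp: d_def dist_commute subset_iff)
  obtain s r where 1: "0 < s" "s < t" "0 < r" "r < t"
    "f (x + t *\<^sub>R u + t *\<^sub>R v) - f (x + t *\<^sub>R u) - (f (x + t *\<^sub>R v) - f x) = t * (t * ?L (x + s *\<^sub>R u + r *\<^sub>R v))"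
    using second_difference_mvt[OF sm t, of x u v] inS by auto
  obtain s' r' where 2: "0 < s'" "s' < t" "0 < r'" "r' < t"
    "f (x + t *\<^sub>R v + t *\<^sub>R u) - f (x + t *\<^sub>R v) - (f (x + t *\<^sub>R u) - f x) = t * (t * ?R (x + s' *\<^sub>R v + r' *\<^sub>R u))"
    using second_difference_mvt[OF sm t, of x v u] inS by auto
  \<comment> \<open>Exchanging \<open>u\<close> and \<open>v\<close> leaves the second difference
    unchanged. Cancelling \<open>t * t\<close> equates the two mixed derivatives at two points close
    to \<open>x\<close>, although each is within \<open>e\<close> of its value at \<open>x\<close>
    and these values differ by \<open>2 * e\<close>.\<close>
  have "f (x + t *\<^sub>R v + t *\<^sub>R u) = f (x + t *\<^sub>R u + t *\<^sub>R v)" by (simp add: add_ac)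
  then have "t * (t * ?L (x + s *\<^sub>R u + r *\<^sub>R v)) = t * (t * ?R (x + s' *\<^sub>R v + r' *\<^sub>R u))"
    using 1(5) 2(5) by linarith
  then have "?L (x + s *\<^sub>R u + r *\<^sub>R v) = ?R (x + s' *\<^sub>R v + r' *\<^sub>R u)" using t by simp
  moreover have "dist (?L (x + s *\<^sub>R u + r *\<^sub>R v)) (?L x) < e"
    using near[of s r u v] 1 by (intro d1(2)) (simp add: d_def)
  moreover have "dist (?R (x + s' *\<^sub>R v + r' *\<^sub>R u)) (?R x) < e"
    using near[of s' r' v u] 2 by (intro d2(2)) (simp add: d_def)
  ultimately show False unfolding dist_real_def e_def by (simp add: abs_if split: if_splits)
qed

lemma symmetric_second_derivative:
  fixes f :: "'a::real_normed_vector \<Rightarrow> 'b::real_inner"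
  assumes sm: "open S" "Csmooth_on f S" and x: "x \<in> S"
  shows "frechet_derivative (\<lambda>y. frechet_derivative f (at y) u) (at x) v
       = frechet_derivative (\<lambda>y. frechet_derivative f (at y) v) (at x) u" (is "?L u v = ?R")
proof -
  have "inner (?L u v) b = inner (?L v u) b" for b
  proof -
    have bl: "bounded_linear (\<lambda>z. inner z b)" by (rule bounded_linear_inner_left)
    have smb: "Csmooth_on (\<lambda>y. inner (f y) b) S" by (rule Csmooth_on_bounded_linear[OF bl sm(2)])
    have 1: "frechet_derivative (\<lambda>y. inner (f y) b) (at y) w = inner (frechet_derivative f (at y) w) b"
      if "y \<in> S" for y w
      using frechet_derivative_at[OF bounded_linear.has_derivative[OF bl Csmooth_on_has_derivative[OF sm(2) that]]]
      by (simp add: fun_eq_iff)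
    have 2: "frechet_derivative (\<lambda>y. frechet_derivative (\<lambda>y. inner (f y) b) (at y) w) (at x) z = inner (?L w z) b" for w z
    proof -
      have "((\<lambda>y. inner (frechet_derivative f (at y) w) b) has_derivative (\<lambda>z. inner (?L w z) b)) (at x)"
        by (rule bounded_linear.has_derivative[OF bl Csmooth_on_has_derivative[OF Csmooth_on_frechet_derivative[OF sm] x]])
      then have "((\<lambda>y. frechet_derivative (\<lambda>y. inner (f y) b) (at y) w) has_derivative (\<lambda>z. inner (?L w z) b)) (at x)"
        by (rule has_derivative_transform_within_open[OF _ sm(1) x]) (simp add: 1)
      from frechet_derivative_at[OF this] show ?thesis by (metis)
    qed
    show ?thesis using symmetric_second_derivative_real[OF sm(1) smb x, of u v] unfolding 2 .
  qed
  then show ?thesis by (metis vector_eq_rdot)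
qed

text \<open>Here the direction moves with the base point, whereas smoothness controls derivatives in
  fixed directions only. Expansion in the coordinate basis leaves finitely many products for the
  product rule; the second summand comes from the moving direction.\<close>

lemma has_derivative_along_field:
  fixes f :: "real^'n::finite \<Rightarrow> 'b::real_inner"
  assumes sm: "open S" "Csmooth_on f S" and x: "x \<in> S" and X: "(X has_derivative X') (at x)"
  shows "((\<lambda>y. frechet_derivative f (at y) (X y)) has_derivative
     (\<lambda>v. frechet_derivative (\<lambda>y. frechet_derivative f (at y) (X x)) (at x) v
        + frechet_derivative f (at x) (X' v))) (at x)"
proof -
  define D where "D m y = frechet_derivative f (at y) (axis m 1)" for m y
  define D' where "D' m = frechet_derivative (D m) (at x)" for m
  have D': "(D m has_derivative D' m) (at x)" for m
    unfolding D'_def D_def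
    by (rule Csmooth_on_has_derivative[OF Csmooth_on_frechet_derivative[OF sm] x])
  have ex: "frechet_derivative f (at y) w = (\<Sum>m\<in>UNIV. (w $ m) *\<^sub>R D m y)" if "y \<in> S" for y w
  proof -
    have l: "linear (frechet_derivative f (at y))"
      by (rule has_derivative_linear[OF Csmooth_on_has_derivative[OF sm(2) that]])
    have "frechet_derivative f (at y) w = frechet_derivative f (at y) (\<Sum>m\<in>UNIV. (w $ m) *\<^sub>R axis m 1)"
      using basis_expansion[of w] by (simp add: scalar_mult_eq_scaleR)
    also have "\<dots> = (\<Sum>m\<in>UNIV. (w $ m) *\<^sub>R D m y)"
      by (simp add: linear_sum[OF l] linear_scale[OF l] D_def)
    finally show ?thesis .
  qed
  have Xm: "((\<lambda>y. X y $ m) has_derivative (\<lambda>v. X' v $ m)) (at x)" for m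
    using bounded_linear.has_derivative[OF bounded_linear_vec_nth X] .
  have "((\<lambda>y. \<Sum>m\<in>UNIV. (X y $ m) *\<^sub>R D m y) has_derivative
      (\<lambda>v. \<Sum>m\<in>UNIV. (X x $ m) *\<^sub>R D' m v + (X' v $ m) *\<^sub>R D m x)) (at x)"
    by (intro has_derivative_sum has_derivative_scaleR Xm D')
  then have 1: "((\<lambda>y. frechet_derivative f (at y) (X y)) has_derivative
      (\<lambda>v. \<Sum>m\<in>UNIV. (X x $ m) *\<^sub>R D' m v + (X' v $ m) *\<^sub>R D m x)) (at x)"
    by (rule has_derivative_transform_within_open[OF _ sm(1) x]) (simp add: ex)
  have "((\<lambda>y. \<Sum>m\<in>UNIV. (X x $ m) *\<^sub>R D m y) has_derivative (\<lambda>v. \<Sum>m\<in>UNIV. (X x $ m) *\<^sub>R D' m v)) (at x)"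
    by (intro has_derivative_sum has_derivative_scaleR_right D')
  then have "((\<lambda>y. frechet_derivative f (at y) (X x)) has_derivative (\<lambda>v. \<Sum>m\<in>UNIV. (X x $ m) *\<^sub>R D' m v)) (at x)"
    by (rule has_derivative_transform_within_open[OF _ sm(1) x]) (simp add: ex)
  from frechet_derivative_at[OF this]
  have "frechet_derivative (\<lambda>y. frechet_derivative f (at y) (X x)) (at x) v = (\<Sum>m\<in>UNIV. (X x $ m) *\<^sub>R D' m v)" for v
    by (metis)
  then show ?thesis using 1 x by (simp add: ex sum.distrib)
qed

text \<open>The second-order parts cancel by symmetry, and what remains is the derivative along the
  Lie bracket, whose coordinate form is \<open>Y' (X x) - X' (Y x)\<close>.\<close>

lemma commutator_along_fields:
  fixes f :: "real^'n::finite \<Rightarrow> 'b::real_inner"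
  assumes sm: "open S" "Csmooth_on f S" and x: "x \<in> S"
    and X: "(X has_derivative X') (at x)" and Y: "(Y has_derivative Y') (at x)"
    and fX: "((\<lambda>y. frechet_derivative f (at y) (X y)) has_derivative DX) (at x)"
    and fY: "((\<lambda>y. frechet_derivative f (at y) (Y y)) has_derivative DY) (at x)"
  shows "DY (X x) - DX (Y x) = frechet_derivative f (at x) (Y' (X x) - X' (Y x))"
proof -
  have l: "linear (frechet_derivative f (at x))"
    by (rule has_derivative_linear[OF Csmooth_on_has_derivative[OF sm(2) x]])
  show ?thesis
    using has_derivative_unique[OF fX has_derivative_along_field[OF sm x X]]
      has_derivative_unique[OF fY has_derivative_along_field[OF sm x Y]]
      symmetric_second_derivative[OF sm x, of "X x" "Y x"]
    by (simp add: linear_diff[OF l])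
qed

section \<open>Clifford modules over the reals\<close>

text \<open>The real inner product stands for the real part of the Hermitian product, and
  \<open>J\<close> for multiplication by the imaginary unit. In this form every generator and
  \<open>J\<close> are skew, so factors move across a pairing at the cost of a sign.\<close>

locale clifford_module =
  fixes \<gamma> :: "'n::finite \<Rightarrow> 'v::real_inner \<Rightarrow> 'v" and J :: "'v \<Rightarrow> 'v"
  assumes bl_gam: "bounded_linear (\<gamma> i)"
    and bl_J: "bounded_linear J"
    and gam_skew: "inner (\<gamma> i x) y = - inner x (\<gamma> i y)"
    and gam_gam: "\<gamma> i (\<gamma> j x) + \<gamma> j (\<gamma> i x) = (if i = j then - 2 *\<^sub>R x else 0)"
    and J_skew: "inner (J x) y = - inner x (J y)"
    and J_J: "J (J x) = - x"
    and J_gam: "J (\<gamma> i x) = \<gamma> i (J x)"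
begin

lemmas linear_gam = bounded_linear.linear[OF bl_gam]
lemmas linear_J = bounded_linear.linear[OF bl_J]

lemmas gam_lin = linear_add[OF linear_gam] linear_diff[OF linear_gam] linear_neg[OF linear_gam]
  linear_0[OF linear_gam] linear_scale[OF linear_gam] linear_sum[OF linear_gam]
lemmas J_lin = linear_add[OF linear_J] linear_diff[OF linear_J] linear_neg[OF linear_J]
  linear_0[OF linear_J] linear_scale[OF linear_J] linear_sum[OF linear_J]

definition cl :: "real^'n \<Rightarrow> 'v \<Rightarrow> 'v" where
  "cl X v = (\<Sum>i\<in>UNIV. (X $ i) *\<^sub>R \<gamma> i v)"

lemma cl_axis: "cl (axis i 1) v = \<gamma> i v"
  by (simp add: cl_def axis_def if_distrib[of "\<lambda>r. r *\<^sub>R _"] cong: if_cong)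

lemma cl_add: "cl (X + Y) v = cl X v + cl Y v"
  and cl_scaleR: "cl (r *\<^sub>R X) v = r *\<^sub>R cl X v"
  by (simp_all add: cl_def scaleR_add_left sum.distrib scaleR_sum_right)

lemma linear_cl: "linear (cl X)"
  unfolding cl_def by (intro linear_compose_sum ballI linear_compose_scale_right linear_gam)

lemmas cl_lin = linear_add[OF linear_cl] linear_diff[OF linear_cl] linear_neg[OF linear_cl]
  linear_0[OF linear_cl] linear_scale[OF linear_cl] linear_sum[OF linear_cl]

lemma cl_skew: "inner (cl X u) v = - inner u (cl X v)"
  by (simp add: cl_def inner_sum_left inner_sum_right gam_skew sum_negf)

lemma cl_cl: "cl X (cl Y v) + cl Y (cl X v) = - (2 * inner X Y) *\<^sub>R v"
proof -
  have "cl X (cl Y v) + cl Y (cl X v)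
      = (\<Sum>i\<in>UNIV. \<Sum>j\<in>UNIV. (X $ i * Y $ j) *\<^sub>R (\<gamma> i (\<gamma> j v) + \<gamma> j (\<gamma> i v)))"
    unfolding cl_def gam_lin scaleR_sum_right
    apply (subst (2) sum.swap)
    by (simp add: sum.distrib scaleR_add_right mult.commute)
  also have "\<dots> = (\<Sum>i\<in>UNIV. \<Sum>j\<in>UNIV. if i = j then (- 2 * (X $ i * Y $ j)) *\<^sub>R v else 0)"
    by (intro sum.cong refl) (simp add: gam_gam)
  also have "\<dots> = - (2 * inner X Y) *\<^sub>R v"
    by (simp add: inner_vec_def sum_distrib_left scaleR_sum_left sum_negf)
  finally show ?thesis .
qed

lemma cl_swap: "cl X (cl Y v) = - cl Y (cl X v) - (2 * inner X Y) *\<^sub>R v"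
  using cl_cl[of X Y v] by (simp add: algebra_simps eq_neg_iff_add_eq_0)

lemma cl_square: "cl X (cl X v) = - (inner X X) *\<^sub>R v"
proof -
  have "2 *\<^sub>R (cl X (cl X v) + (inner X X) *\<^sub>R v) = 0"
    using cl_cl[of X X v] by (simp add: scaleR_2[symmetric] scaleR_add_right)
  then show ?thesis by (simp add: eq_neg_iff_add_eq_0)
qed

lemma cl_J: "J (cl X v) = cl X (J v)"
  by (simp add: cl_def J_lin J_gam)

lemma norm_J: "norm (J v) = norm v"
  by (simp add: norm_eq_sqrt_inner J_skew J_J)

lemma inner_J_self: "inner (J v) v = 0"
  using J_skew[of v v] by (simp add: inner_commute)

lemma inner_self_J: "inner v (J v) = 0"
  using inner_J_self[of v] by (simp add: inner_commute)

lemma inner_cl_self: "inner (cl X v) v = 0"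
  using cl_skew[of X v v] by (simp add: inner_commute)

text \<open>Since \<open>J\<close> plays the role of \<open>\<i>\<close> and the inner product that of the real part of the Hermitian
  product, these are \<open>Im \<langle>e\<^sub>i \<psi>, \<psi>\<rangle>\<close>, \<open>Im \<langle>e\<^sub>i e\<^sub>j \<psi>, \<psi>\<rangle>\<close> and \<open>Re \<langle>e\<^sub>i e\<^sub>j e\<^sub>k \<psi>, \<psi>\<rangle>\<close>.\<close>

definition eta :: "'v \<Rightarrow> 'n \<Rightarrow> real" where "eta v i = inner (\<gamma> i v) (J v)"
definition omega :: "'v \<Rightarrow> 'n \<Rightarrow> 'n \<Rightarrow> real" where "omega v i j = inner (\<gamma> i (\<gamma> j v)) (J v)"
definition tau :: "'v \<Rightarrow> 'n \<Rightarrow> 'n \<Rightarrow> 'n \<Rightarrow> real" where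
  "tau v i j k = inner (\<gamma> i (\<gamma> j (\<gamma> k v))) v"

text \<open>Moving both skew factors across the pairing reverses their order, so the value is
  symmetric in \<open>i\<close> and \<open>j\<close> and equals half of the paired
  anticommutator.\<close>

lemma inner_gam_gam: "inner (\<gamma> i (\<gamma> j v)) v = (if i = j then - inner v v else 0)"
proof -
  have "inner (\<gamma> i (\<gamma> j v) + \<gamma> j (\<gamma> i v)) v = (if i = j then - 2 * inner v v else 0)"
    by (simp add: gam_gam)
  moreover have "inner (\<gamma> j (\<gamma> i v)) v = inner (\<gamma> i (\<gamma> j v)) v"
    using gam_skew[of j "\<gamma> i v" v] gam_skew[of i "\<gamma> j v" v] by (simp add: inner_commute)
  ultimately show ?thesis by (simp add: inner_add_left split: if_splits)
qed

text \<open>The anticommutator is a real multiple of \<open>v\<close>, which is orthogonal to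
  \<open>J v\<close>.\<close>

lemma omega_antisym: "omega v i j = - omega v j i"
proof -
  have "omega v i j + omega v j i = (if i = j then - 2 else 0) * inner v (J v)"
    by (simp add: omega_def inner_add_left[symmetric] gam_gam)
  then show ?thesis by (simp add: inner_self_J)
qed

lemma inner_cl_cl: "inner (cl X (cl Y v)) v = - (inner X Y * inner v v)"
proof -
  have "inner (cl X (cl Y v) + cl Y (cl X v)) v = - 2 * inner X Y * inner v v"
    by (simp add: cl_cl)
  moreover have "inner (cl Y (cl X v)) v = inner (cl X (cl Y v)) v"
    using cl_skew[of Y "cl X v" v] cl_skew[of X "cl Y v" v] by (simp add: inner_commute)
  ultimately show ?thesis by (simp add: inner_add_left)
qed

lemma gam_cl: "\<gamma> i (cl X v) = - cl X (\<gamma> i v) - (2 * X $ i) *\<^sub>R v"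
  using cl_swap[of "axis i 1" X v] by (simp add: cl_axis inner_axis' inner_axis)

lemma gam_gam_self: "\<gamma> i (\<gamma> i v) = - v"
  using cl_square[of "axis i 1" v] by (simp add: cl_axis inner_axis_axis)

lemma norm_gam: "norm (\<gamma> i v) = norm v"
  by (simp add: norm_eq_sqrt_inner gam_skew gam_gam_self)

section \<open>Contractions and commutators in the Clifford module\<close>

lemma sum_gam_gam: "(\<Sum>i\<in>UNIV. \<gamma> i (\<gamma> i v)) = - (real CARD('n)) *\<^sub>R v"
  by (simp add: gam_gam_self scaleR_sum_left sum_negf sum_constant_scaleR)

lemma gam_swap: "\<gamma> i (\<gamma> j v) = - \<gamma> j (\<gamma> i v) - (if i = j then 2 else 0) *\<^sub>R v"
  using gam_gam[of i j v] by (auto simp: algebra_simps eq_neg_iff_add_eq_0 split: if_splits)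

text \<open>Passing \<open>X\<close> to the front changes the sign of the full contraction, which is
  minus the dimension; the correction -2 collects the anticommutators.\<close>

lemma sum_gam_cl_gam: "(\<Sum>i\<in>UNIV. \<gamma> i (cl X (\<gamma> i v))) = (real CARD('n) - 2) *\<^sub>R cl X v"
proof -
  have "(\<Sum>i\<in>UNIV. \<gamma> i (cl X (\<gamma> i v)))
      = (\<Sum>i\<in>UNIV. - cl X (\<gamma> i (\<gamma> i v)) - (2 * X $ i) *\<^sub>R \<gamma> i v)"
    by (simp add: gam_cl)
  also have "\<dots> = - cl X (\<Sum>i\<in>UNIV. \<gamma> i (\<gamma> i v)) - 2 *\<^sub>R cl X v"
    by (simp add: sum_subtractf sum_negf cl_lin cl_def[of X v] scaleR_sum_right)
  also have "\<dots> = (real CARD('n) - 2) *\<^sub>R cl X v"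
    unfolding sum_gam_gam by (simp add: cl_lin algebra_simps)
  finally show ?thesis .
qed

text \<open>Infinitesimal form of the covering of the rotation group: a bivector acts on the
  generators by commutators, as the skew matrix \<open>w\<close>. The factor 4 is the one that the
  1/4 in the spin connection compensates.\<close>

lemma spin_commutator:
  fixes w :: "'n \<Rightarrow> 'n \<Rightarrow> real"
  assumes skew: "\<And>k l. w k l = - w l k"
  shows "(\<Sum>k\<in>UNIV. \<Sum>l\<in>UNIV. w k l *\<^sub>R \<gamma> k (\<gamma> l (\<gamma> m v)))
      - \<gamma> m (\<Sum>k\<in>UNIV. \<Sum>l\<in>UNIV. w k l *\<^sub>R \<gamma> k (\<gamma> l v)) = 4 *\<^sub>R (\<Sum>l\<in>UNIV. w m l *\<^sub>R \<gamma> l v)"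
proof -
  have *: "\<gamma> k (\<gamma> l (\<gamma> m v)) - \<gamma> m (\<gamma> k (\<gamma> l v))
     = (if k = m then 2 *\<^sub>R \<gamma> l v else 0) - (if l = m then 2 *\<^sub>R \<gamma> k v else 0)" for k l
    by (subst gam_swap[of l m], subst gam_swap[of m k])
       (auto simp: gam_lin algebra_simps)
  have "(\<Sum>k\<in>UNIV. \<Sum>l\<in>UNIV. w k l *\<^sub>R \<gamma> k (\<gamma> l (\<gamma> m v)))
      - \<gamma> m (\<Sum>k\<in>UNIV. \<Sum>l\<in>UNIV. w k l *\<^sub>R \<gamma> k (\<gamma> l v))
     = (\<Sum>k\<in>UNIV. \<Sum>l\<in>UNIV. w k l *\<^sub>R (\<gamma> k (\<gamma> l (\<gamma> m v)) - \<gamma> m (\<gamma> k (\<gamma> l v))))"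
    by (simp add: gam_lin sum_subtractf scaleR_diff_right)
  also have "\<dots> = (\<Sum>k\<in>UNIV. \<Sum>l\<in>UNIV. if k = m then (2 * w k l) *\<^sub>R \<gamma> l v else 0)
      - (\<Sum>k\<in>UNIV. \<Sum>l\<in>UNIV. if l = m then (2 * w k l) *\<^sub>R \<gamma> k v else 0)"
    unfolding * sum_subtractf[symmetric] by (intro sum.cong refl) (auto simp: algebra_simps)
  also have "(\<Sum>k\<in>UNIV. \<Sum>l\<in>UNIV. if k = m then (2 * w k l) *\<^sub>R \<gamma> l v else 0)
      = (\<Sum>l\<in>UNIV. (2 * w m l) *\<^sub>R \<gamma> l v)"
    by (subst sum.swap) simp
  also have "(\<Sum>k\<in>UNIV. \<Sum>l\<in>UNIV. if l = m then (2 * w k l) *\<^sub>R \<gamma> k v else 0)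
      = - (\<Sum>k\<in>UNIV. (2 * w m k) *\<^sub>R \<gamma> k v)"
  proof -
    have "(\<Sum>k\<in>UNIV. \<Sum>l\<in>UNIV. if l = m then (2 * w k l) *\<^sub>R \<gamma> k v else 0)
        = (\<Sum>k\<in>UNIV. (2 * w k m) *\<^sub>R \<gamma> k v)"
      by simp
    also have "\<dots> = (\<Sum>k\<in>UNIV. - ((2 * w m k) *\<^sub>R \<gamma> k v))"
      by (intro sum.cong refl) (simp add: skew[of _ m])
    finally show ?thesis by (simp add: sum_negf)
  qed
  finally show ?thesis by (simp add: scaleR_sum_right sum.distrib[symmetric] scaleR_add_left[symmetric])
qed

text \<open>Commuting with \<open>B\<close> is a derivation, so \<open>spin_commutator\<close> is
  applied to each factor of the bivector \<open>B'\<close>. By skewness of \<open>w\<close> the new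
  coefficients are those of the matrix commutator of \<open>w'\<close> and \<open>w\<close>, which
  produces the quadratic part of the curvature.\<close>

lemma spin_spin_commutator:
  fixes w w' :: "'n \<Rightarrow> 'n \<Rightarrow> real"
  defines "B \<equiv> \<lambda>v. \<Sum>k\<in>UNIV. \<Sum>l\<in>UNIV. w k l *\<^sub>R \<gamma> k (\<gamma> l v)"
    and "B' \<equiv> \<lambda>v. \<Sum>k\<in>UNIV. \<Sum>l\<in>UNIV. w' k l *\<^sub>R \<gamma> k (\<gamma> l v)"
  assumes skew: "\<And>k l. w k l = - w l k"
  shows "B (B' v) - B' (B v) =
    4 *\<^sub>R (\<Sum>k\<in>UNIV. \<Sum>l\<in>UNIV. (\<Sum>m\<in>UNIV. w' k m * w m l + w' m l * w m k) *\<^sub>R \<gamma> k (\<gamma> l v))"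
proof -
  have lin: "linear B" unfolding B_def
    by (intro linear_compose_sum ballI linear_compose_scale_right)
       (use linear_compose[OF linear_gam linear_gam] in \<open>simp add: o_def\<close>)
  have c: "B (\<gamma> m v) = \<gamma> m (B v) + 4 *\<^sub>R (\<Sum>l\<in>UNIV. w m l *\<^sub>R \<gamma> l v)" for m v
    using spin_commutator[of w m v, OF skew] unfolding B_def by (simp add: algebra_simps)
  have "B (\<gamma> k (\<gamma> l v)) - \<gamma> k (\<gamma> l (B v))
      = 4 *\<^sub>R (\<Sum>m\<in>UNIV. w l m *\<^sub>R \<gamma> k (\<gamma> m v)) + 4 *\<^sub>R (\<Sum>m\<in>UNIV. w k m *\<^sub>R \<gamma> m (\<gamma> l v))" for k l
    by (simp add: c gam_lin)
  note d = this
  have "B (B' v) - B' (B v)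
      = (\<Sum>k\<in>UNIV. \<Sum>l\<in>UNIV. w' k l *\<^sub>R (B (\<gamma> k (\<gamma> l v)) - \<gamma> k (\<gamma> l (B v))))"
    unfolding B'_def by (simp add: linear_sum[OF lin] linear_scale[OF lin] sum_subtractf scaleR_diff_right)
  also have "\<dots> = 4 *\<^sub>R ((\<Sum>k\<in>UNIV. \<Sum>l\<in>UNIV. \<Sum>m\<in>UNIV. (w' k l * w l m) *\<^sub>R \<gamma> k (\<gamma> m v))
       + (\<Sum>k\<in>UNIV. \<Sum>l\<in>UNIV. \<Sum>m\<in>UNIV. (w' k l * w k m) *\<^sub>R \<gamma> m (\<gamma> l v)))"
    unfolding d by (simp add: scaleR_add_right sum.distrib scaleR_sum_right mult.left_commute)
  also have "(\<Sum>k\<in>UNIV. \<Sum>l\<in>UNIV. \<Sum>m\<in>UNIV. (w' k l * w l m) *\<^sub>R \<gamma> k (\<gamma> m v))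
      = (\<Sum>k\<in>UNIV. \<Sum>m\<in>UNIV. \<Sum>l\<in>UNIV. (w' k l * w l m) *\<^sub>R \<gamma> k (\<gamma> m v))"
    by (intro sum.cong refl sum.swap)
  also have "(\<Sum>k\<in>UNIV. \<Sum>l\<in>UNIV. \<Sum>m\<in>UNIV. (w' k l * w k m) *\<^sub>R \<gamma> m (\<gamma> l v))
      = (\<Sum>m\<in>UNIV. \<Sum>l\<in>UNIV. \<Sum>k\<in>UNIV. (w' k l * w k m) *\<^sub>R \<gamma> m (\<gamma> l v))"
    by (subst sum.swap, subst (2) sum.swap, subst sum.swap) (rule refl)
  finally show ?thesis
    by (simp add: sum.distrib[symmetric] scaleR_sum_left scaleR_add_left)
qed

end

text \<open>The classical octahedron argument: a suitably signed combination of the four cyclic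
  identities leaves, after the two antisymmetries, twice the claimed difference.\<close>

lemma bianchi_pair_symmetry:
  fixes \<rho> :: "'n \<Rightarrow> 'n \<Rightarrow> 'n \<Rightarrow> 'n \<Rightarrow> real"
  assumes "\<And>i j k l. \<rho> i j k l = - \<rho> j i k l" "\<And>i j k l. \<rho> i j k l = - \<rho> i j l k"
    and "\<And>i j k l. \<rho> i j k l + \<rho> j k i l + \<rho> k i j l = 0"
  shows "\<rho> i j k l = \<rho> k l i j"
  using assms(3)[of i j k l] assms(3)[of j k l i] assms(3)[of k l i j] assms(3)[of l i j k]
    assms(1)[of i j] assms(1)[of j k] assms(1)[of k l] assms(1)[of l i] assms(1)[of i k] assms(1)[of j l]
    assms(2)[of i j] assms(2)[of j k] assms(2)[of k l] assms(2)[of l i] assms(2)[of i k] assms(2)[of j l]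
    assms(1)[of k i] assms(1)[of l j] assms(2)[of k i] assms(2)[of l j]
  by (smt (verit))

context clifford_module begin

text \<open>On three distinct indices the Clifford product is invariant under cyclic permutations,
  so the Bianchi identity kills that part. What survives are the terms with a repeated index, and
  they assemble to the Ricci contraction.\<close>

lemma ricci_contraction:
  fixes \<rho> :: "'n \<Rightarrow> 'n \<Rightarrow> 'n \<Rightarrow> 'n \<Rightarrow> real"
  assumes s1: "\<And>i j k l. \<rho> i j k l = - \<rho> j i k l" and s2: "\<And>i j k l. \<rho> i j k l = - \<rho> i j l k"
    and bi: "\<And>i j k l. \<rho> i j k l + \<rho> j k i l + \<rho> k i j l = 0"
  shows "(\<Sum>i\<in>UNIV. \<Sum>k\<in>UNIV. \<Sum>l\<in>UNIV. \<rho> i j k l *\<^sub>R \<gamma> i (\<gamma> k (\<gamma> l v)))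
    = - 2 *\<^sub>R (\<Sum>l\<in>UNIV. (\<Sum>i\<in>UNIV. \<rho> i j i l) *\<^sub>R \<gamma> l v)"
proof -
  have pair: "\<rho> i j k l = \<rho> k l i j" for i j k l
    by (rule bianchi_pair_symmetry[OF s1 s2 bi])
  define P where "P = (\<Sum>i\<in>UNIV. \<Sum>k\<in>UNIV. \<Sum>l\<in>UNIV. \<rho> i j k l *\<^sub>R \<gamma> i (\<gamma> k (\<gamma> l v)))"
  define Q where "Q = (\<Sum>l\<in>UNIV. (\<Sum>i\<in>UNIV. \<rho> i j i l) *\<^sub>R \<gamma> l v)"
  \<comment> \<open>The hypothesis \<open>bi\<close> cycles the first three indices, while the
    contraction needs the cycle of \<open>i\<close>, \<open>k\<close>, \<open>l\<close> with
    \<open>j\<close> fixed; pair symmetry converts one into the other.\<close>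
  have cyc: "\<rho> i j k l + \<rho> k j l i + \<rho> l j i k = 0" for i k l
    using bi[of k l i j] pair[of i j k l] pair[of k j l i] pair[of l j i k]
      s1[of i j k l] s1[of k j l i] s1[of l j i k] pair[of k l i j] pair[of l i k j] pair[of i k l j] s2 by (smt (verit))
  have r1: "(\<Sum>i\<in>UNIV. \<Sum>k\<in>UNIV. \<Sum>l\<in>UNIV. \<rho> k j l i *\<^sub>R \<gamma> i (\<gamma> k (\<gamma> l v)))
     = (\<Sum>i\<in>UNIV. \<Sum>k\<in>UNIV. \<Sum>l\<in>UNIV. \<rho> i j k l *\<^sub>R \<gamma> l (\<gamma> i (\<gamma> k v)))"
    by (rule trans[OF sum.swap]) (intro sum.cong[OF refl] sum.swap)
  have r2: "(\<Sum>i\<in>UNIV. \<Sum>k\<in>UNIV. \<Sum>l\<in>UNIV. \<rho> l j i k *\<^sub>R \<gamma> i (\<gamma> k (\<gamma> l v)))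
     = (\<Sum>i\<in>UNIV. \<Sum>k\<in>UNIV. \<Sum>l\<in>UNIV. \<rho> i j k l *\<^sub>R \<gamma> k (\<gamma> l (\<gamma> i v)))"
  proof -
    have "(\<Sum>i\<in>UNIV. \<Sum>k\<in>UNIV. \<Sum>l\<in>UNIV. \<rho> l j i k *\<^sub>R \<gamma> i (\<gamma> k (\<gamma> l v)))
      = (\<Sum>i\<in>UNIV. \<Sum>l\<in>UNIV. \<Sum>k\<in>UNIV. \<rho> l j i k *\<^sub>R \<gamma> i (\<gamma> k (\<gamma> l v)))"
      by (intro sum.cong[OF refl] sum.swap)
    also have "\<dots> = (\<Sum>l\<in>UNIV. \<Sum>i\<in>UNIV. \<Sum>k\<in>UNIV. \<rho> l j i k *\<^sub>R \<gamma> i (\<gamma> k (\<gamma> l v)))"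
      by (rule sum.swap)
    finally show ?thesis .
  qed
  have cyc0: "P + (\<Sum>i\<in>UNIV. \<Sum>k\<in>UNIV. \<Sum>l\<in>UNIV. \<rho> i j k l *\<^sub>R \<gamma> l (\<gamma> i (\<gamma> k v)))
      + (\<Sum>i\<in>UNIV. \<Sum>k\<in>UNIV. \<Sum>l\<in>UNIV. \<rho> i j k l *\<^sub>R \<gamma> k (\<gamma> l (\<gamma> i v))) = 0"
    unfolding r1[symmetric] r2[symmetric] P_def
    by (simp add: sum.distrib[symmetric] scaleR_add_left[symmetric] cyc)
  have kk: "\<rho> i j k k = 0" for i k using s2[of i j k k] by simp
  have e1: "\<rho> i j k l *\<^sub>R \<gamma> l (\<gamma> i (\<gamma> k v)) = \<rho> i j k l *\<^sub>R \<gamma> i (\<gamma> k (\<gamma> l v))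
      - (if l = i then (2 * \<rho> i j k l) *\<^sub>R \<gamma> k v else 0)" for i k l
  proof (cases "k = l")
    case False
    then show ?thesis
      by (subst gam_swap[of l i], subst gam_swap[of l k]) (auto simp: gam_lin algebra_simps)
  qed (simp add: kk)
  have e2: "\<rho> i j k l *\<^sub>R \<gamma> k (\<gamma> l (\<gamma> i v)) = \<rho> i j k l *\<^sub>R \<gamma> i (\<gamma> k (\<gamma> l v))
      - (if l = i then (2 * \<rho> i j k l) *\<^sub>R \<gamma> k v else 0) + (if k = i then (2 * \<rho> i j k l) *\<^sub>R \<gamma> l v else 0)" for i k l
    by (subst gam_swap[of l i], subst gam_lin, subst gam_lin, subst gam_swap[of k i])
       (auto simp: gam_lin algebra_simps)
  have q1: "(\<Sum>i\<in>UNIV. \<Sum>k\<in>UNIV. \<Sum>l\<in>UNIV. if l = i then (2 * \<rho> i j k l) *\<^sub>R \<gamma> k v else 0) = - 2 *\<^sub>R Q"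
  proof -
    have "(\<Sum>i\<in>UNIV. \<Sum>k\<in>UNIV. \<Sum>l\<in>UNIV. if l = i then (2 * \<rho> i j k l) *\<^sub>R \<gamma> k v else 0)
       = (\<Sum>i\<in>UNIV. \<Sum>k\<in>UNIV. (2 * \<rho> i j k i) *\<^sub>R \<gamma> k v)" by simp
    also have "\<dots> = (\<Sum>k\<in>UNIV. \<Sum>i\<in>UNIV. (- 2 * \<rho> i j i k) *\<^sub>R \<gamma> k v)"
      by (subst sum.swap) (intro sum.cong refl, subst s2, simp)
    finally show ?thesis unfolding Q_def by (simp add: scaleR_sum_left scaleR_sum_right sum_negf)
  qed
  have q2: "(\<Sum>i\<in>UNIV. \<Sum>k\<in>UNIV. \<Sum>l\<in>UNIV. if k = i then (2 * \<rho> i j k l) *\<^sub>R \<gamma> l v else 0) = 2 *\<^sub>R Q"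
  proof -
    have "(\<Sum>i\<in>UNIV. \<Sum>k\<in>UNIV. \<Sum>l\<in>UNIV. if k = i then (2 * \<rho> i j k l) *\<^sub>R \<gamma> l v else 0)
       = (\<Sum>i\<in>UNIV. \<Sum>l\<in>UNIV. \<Sum>k\<in>UNIV. if k = i then (2 * \<rho> i j k l) *\<^sub>R \<gamma> l v else 0)"
      by (intro sum.cong[OF refl] sum.swap)
    also have "\<dots> = (\<Sum>i\<in>UNIV. \<Sum>l\<in>UNIV. (2 * \<rho> i j i l) *\<^sub>R \<gamma> l v)" by simp
    also have "\<dots> = (\<Sum>l\<in>UNIV. \<Sum>i\<in>UNIV. (2 * \<rho> i j i l) *\<^sub>R \<gamma> l v)" by (rule sum.swap)
    finally show ?thesis unfolding Q_def by (simp add: scaleR_sum_left scaleR_sum_right)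
  qed
  \<comment> \<open>Each cyclic order of the three generators is brought back to the order in
    \<open>P\<close>. The two rotated orders cost 2 Q and 4 Q, so the vanishing cyclic sum reads 3 P
    + 6 Q = 0.\<close>
  have "P + (P + 2 *\<^sub>R Q) + (P + 2 *\<^sub>R Q + 2 *\<^sub>R Q) = 0"
    using cyc0 unfolding e1 e2 sum_subtractf sum.distrib q1 q2 P_def[symmetric] by simp
  moreover have "P + (P + 2 *\<^sub>R Q) + (P + 2 *\<^sub>R Q + 2 *\<^sub>R Q)
      = (1 + 1 + 1) *\<^sub>R P + (2 + 2 + 2) *\<^sub>R Q"
    by (simp only: scaleR_add_left scaleR_one ac_simps)
  ultimately have "3 *\<^sub>R (P + 2 *\<^sub>R Q) = 0"
    by (simp add: scaleR_add_right)
  then show ?thesis unfolding P_def[symmetric] Q_def[symmetric] by (simp add: eq_neg_iff_add_eq_0)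
qed

end

text \<open>The pointwise core of the case \<open>a b \<noteq> 0\<close>: \<open>deriv\<close> is the covariant derivative of
  \<open>decomp\<close>.  Its cyclic sum expresses \<open>\<tau>\<close> by \<open>\<alpha> \<and> \<omega>\<close>, so a vector orthogonal to \<open>\<alpha>\<close>, \<open>\<beta>\<close> and \<open>\<eta>\<close>
  annihilates \<open>\<omega>\<close> and \<open>\<tau>\<close>; inserting it twice shows that \<open>\<beta>\<close> is a multiple of \<open>\<eta>\<close>.\<close>

lemma decomposable_form_vanishes:
  fixes \<alpha> \<beta> \<eta> :: "real^'n::finite" and \<omega> h :: "'n \<Rightarrow> 'n \<Rightarrow> real" and \<tau> :: "'n \<Rightarrow> 'n \<Rightarrow> 'n \<Rightarrow> real"
    and a b f :: real
  assumes dim: "CARD('n) \<ge> 4" and nz: "a \<noteq> 0" "b \<noteq> 0" "f \<noteq> 0"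
    and om: "\<And>i j. \<omega> i j = - \<omega> j i" and h: "\<And>i j. h i j = h j i"
    and tau: "\<And>i j k. \<tau> i j k = \<tau> j k i"
    and decomp: "\<And>i j. 4 * a * b * \<omega> i j = \<beta> $ i * \<eta> $ j - \<beta> $ j * \<eta> $ i"
    and deriv: "\<And>k i j. 4 * (b * \<alpha> $ k + a * \<beta> $ k) * \<omega> i j + 8 * a * b^2 * \<tau> k i j
        + 8 * a^2 * b * ((if i = k then \<eta> $ j else 0) - (if j = k then \<eta> $ i else 0))
      = h k i * \<eta> $ j - h k j * \<eta> $ i
        + \<beta> $ i * ((if k = j then - 2 * b * f else 0) + 2 * a * \<omega> j k)
        - \<beta> $ j * ((if k = i then - 2 * b * f else 0) + 2 * a * \<omega> i k)"
  shows "\<omega> i j = 0"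
proof -
  have "dim {\<alpha>, \<beta>, \<eta>} < DIM(real^'n)"
  proof -
    have "dim {\<alpha>, \<beta>, \<eta>} \<le> card {\<alpha>, \<beta>, \<eta>}" by (intro dim_le_card') auto
    also have "\<dots> \<le> 3" by (simp add: card_insert_if)
    finally show ?thesis using dim by simp
  qed
  then obtain X0 where X0: "X0 \<noteq> 0" "\<And>y. y \<in> span {\<alpha>, \<beta>, \<eta>} \<Longrightarrow> orthogonal X0 y"
    using orthogonal_to_subspace_exists by blast
  \<comment> \<open>Unit length makes a delta contracted twice with \<open>X\<close> return its
    coefficient, as used in \<open>dd\<close>.\<close>
  define X where "X = X0 /\<^sub>R norm X0"
  have X: "inner X \<alpha> = 0" "inner X \<beta> = 0" "inner X \<eta> = 0" "inner X X = 1"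
    using X0(2)[of \<alpha>] X0(2)[of \<beta>] X0(2)[of \<eta>] X0(1)
    by (auto simp: X_def span_base orthogonal_def dot_square_norm power2_eq_square)
  note Xs = X[unfolded inner_vec_def inner_real_def]
  have X_om: "(\<Sum>k\<in>UNIV. X $ k * \<omega> k j) = 0" for j
  proof -
    have "4 * a * b * (\<Sum>k\<in>UNIV. X $ k * \<omega> k j) = (\<Sum>k\<in>UNIV. X $ k * (4 * a * b * \<omega> k j))"
      by (simp add: sum_distrib_left algebra_simps)
    also have "\<dots> = (\<Sum>k\<in>UNIV. X $ k * \<beta> $ k) * \<eta> $ j - \<beta> $ j * (\<Sum>k\<in>UNIV. X $ k * \<eta> $ k)"
      unfolding decomp by (simp add: algebra_simps sum_distrib_left sum_distrib_right sum_subtractf)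
    finally show ?thesis using Xs nz by simp
  qed
  have X_om': "(\<Sum>k\<in>UNIV. X $ k * \<omega> j k) = 0" for j
    using X_om[of j] by (subst om) (simp add: sum_negf)
  have cyc: "24 * a * b^2 * \<tau> k i j = - 4 * b * (\<alpha> $ k * \<omega> i j + \<alpha> $ i * \<omega> j k + \<alpha> $ j * \<omega> k i)" for k i j
  proof -
    \<comment> \<open>Conditionals become polynomial atoms, so that the three cyclic instances of
      \<open>deriv\<close> can be combined by pure algebra.\<close>
    define \<delta> where "\<delta> x y = (if x = y then 1 else 0 :: real)" for x y :: 'n
    have iff: "(if x = y then r else 0) = \<delta> x y * r" for x y r
      by (auto simp: \<delta>_def)
    have sym: "\<delta> k i = \<delta> i k" "\<delta> k j = \<delta> j k" "\<delta> j i = \<delta> i j"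
      by (auto simp: \<delta>_def)
    have d1: "4 * (b * \<alpha> $ k + a * \<beta> $ k) * \<omega> i j + 8 * a * b^2 * \<tau> k i j + 8 * a^2 * b * (\<delta> i k * \<eta> $ j - \<delta> j k * \<eta> $ i)
      = h k i * \<eta> $ j - h k j * \<eta> $ i + \<beta> $ i * (\<delta> j k * (- 2 * b * f) + 2 * a * \<omega> j k) - \<beta> $ j * (\<delta> i k * (- 2 * b * f) - 2 * a * \<omega> k i)"
      using deriv[of k i j] unfolding iff om[of i k] sym by simp
    have d2: "4 * (b * \<alpha> $ i + a * \<beta> $ i) * \<omega> j k + 8 * a * b^2 * \<tau> i j k + 8 * a^2 * b * (\<delta> i j * \<eta> $ k - \<delta> i k * \<eta> $ j)
      = h i j * \<eta> $ k - h k i * \<eta> $ j + \<beta> $ j * (\<delta> i k * (- 2 * b * f) + 2 * a * \<omega> k i) - \<beta> $ k * (\<delta> i j * (- 2 * b * f) - 2 * a * \<omega> i j)"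
      using deriv[of i j k] unfolding iff om[of j i] sym h[of i k] by simp
    have d3: "4 * (b * \<alpha> $ j + a * \<beta> $ j) * \<omega> k i + 8 * a * b^2 * \<tau> j k i + 8 * a^2 * b * (\<delta> j k * \<eta> $ i - \<delta> i j * \<eta> $ k)
      = h k j * \<eta> $ i - h i j * \<eta> $ k + \<beta> $ k * (\<delta> i j * (- 2 * b * f) + 2 * a * \<omega> i j) - \<beta> $ i * (\<delta> j k * (- 2 * b * f) - 2 * a * \<omega> j k)"
      using deriv[of j k i] unfolding iff om[of k j] sym h[of j] by simp
    \<comment> \<open>In the cyclic sum the Hessian cancels by symmetry of \<open>h\<close>, the
      delta terms cancel in pairs, and the same expression 4 a \<beta> \<and> \<omega> appears on
      both sides.\<close>
    have "8 * a * b^2 * (\<tau> k i j + \<tau> i j k + \<tau> j k i)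
      = - 4 * b * (\<alpha> $ k * \<omega> i j + \<alpha> $ i * \<omega> j k + \<alpha> $ j * \<omega> k i)"
      using d1 d2 d3 by algebra
    then show ?thesis using tau[of k i j] tau[of j k i] by algebra
  qed
  have X_tau: "(\<Sum>k\<in>UNIV. X $ k * \<tau> k i j) = 0" for i j
  proof -
    have "24 * a * b^2 * (\<Sum>k\<in>UNIV. X $ k * \<tau> k i j) = (\<Sum>k\<in>UNIV. X $ k * (24 * a * b^2 * \<tau> k i j))"
      by (simp add: sum_distrib_left algebra_simps)
    also have "\<dots> = - 4 * b * ((\<Sum>k\<in>UNIV. X $ k * \<alpha> $ k) * \<omega> i j + \<alpha> $ i * (\<Sum>k\<in>UNIV. X $ k * \<omega> j k)
       + \<alpha> $ j * (\<Sum>k\<in>UNIV. X $ k * \<omega> k i))"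
      unfolding cyc
      by (simp only: sum_distrib_left sum_distrib_right sum.distrib[symmetric])
         (intro sum.cong refl, simp add: algebra_simps)
    finally show ?thesis using X_om X_om' Xs nz by simp
  qed
  \<comment> \<open>The value of \<open>H\<close> stays unknown, but it occurs only as a factor of
    \<eta>, so proportionality of \<beta> and \<eta> can still be concluded.\<close>
  define H where "H = (\<Sum>k\<in>UNIV. \<Sum>i\<in>UNIV. X $ k * X $ i * h k i)"
  have par: "8 * a^2 * b * \<eta> $ j = H * \<eta> $ j + 2 * b * f * \<beta> $ j" for j
  proof -
    define L where "L k i = 4 * (b * \<alpha> $ k + a * \<beta> $ k) * \<omega> i j + 8 * a * b^2 * \<tau> k i j
        + 8 * a^2 * b * ((if i = k then \<eta> $ j else 0) - (if j = k then \<eta> $ i else 0))" for k i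
    have dd: "(\<Sum>k\<in>UNIV. \<Sum>i\<in>UNIV. X $ k * X $ i * (if i = k then r else 0)) = r" for r
      using Xs(4) by (simp add: if_distrib sum_distrib_right[symmetric] cong: if_cong)
    have S1: "(\<Sum>k\<in>UNIV. \<Sum>i\<in>UNIV. (X $ k * (b * \<alpha> $ k + a * \<beta> $ k)) * (X $ i * \<omega> i j)) = 0"
      unfolding sum_product[symmetric] X_om by simp
    have S2: "(\<Sum>k\<in>UNIV. \<Sum>i\<in>UNIV. X $ k * X $ i * \<tau> k i j) = 0"
      using X_tau[of _ j] by (subst sum.swap) (simp add: mult.assoc mult.left_commute sum_distrib_left[symmetric])
    have S4: "(\<Sum>k\<in>UNIV. \<Sum>i\<in>UNIV. (X $ k * (if j = k then 1 else 0)) * (X $ i * \<eta> $ i)) = 0"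
      unfolding sum_product[symmetric] Xs by simp
    have "(\<Sum>k\<in>UNIV. \<Sum>i\<in>UNIV. X $ k * X $ i * L k i)
       = 4 * (\<Sum>k\<in>UNIV. \<Sum>i\<in>UNIV. (X $ k * (b * \<alpha> $ k + a * \<beta> $ k)) * (X $ i * \<omega> i j))
        + 8 * a * b^2 * (\<Sum>k\<in>UNIV. \<Sum>i\<in>UNIV. X $ k * X $ i * \<tau> k i j)
        + 8 * a^2 * b * ((\<Sum>k\<in>UNIV. \<Sum>i\<in>UNIV. X $ k * X $ i * (if i = k then \<eta> $ j else 0))
           - (\<Sum>k\<in>UNIV. \<Sum>i\<in>UNIV. (X $ k * (if j = k then 1 else 0)) * (X $ i * \<eta> $ i)))"
      unfolding L_def
      by (simp only: sum_distrib_left sum.distrib[symmetric] sum_subtractf[symmetric])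
         (intro sum.cong refl, simp add: algebra_simps)
    also have "\<dots> = 8 * a^2 * b * \<eta> $ j"
      unfolding S1 S2 S4 dd by simp
    finally have left: "(\<Sum>k\<in>UNIV. \<Sum>i\<in>UNIV. X $ k * X $ i * L k i) = 8 * a^2 * b * \<eta> $ j" .
    define R where "R k i = h k i * \<eta> $ j - h k j * \<eta> $ i
        + \<beta> $ i * ((if k = j then - 2 * b * f else 0) + 2 * a * \<omega> j k)
        - \<beta> $ j * ((if k = i then - 2 * b * f else 0) + 2 * a * \<omega> i k)" for k i
    have T1: "(\<Sum>k\<in>UNIV. \<Sum>i\<in>UNIV. (X $ k * h k j) * (X $ i * \<eta> $ i)) = 0"
      unfolding sum_product[symmetric] Xs by simp
    have T2: "(\<Sum>k\<in>UNIV. \<Sum>i\<in>UNIV. (X $ k * ((if k = j then - 2 * b * f else 0) + 2 * a * \<omega> j k)) * (X $ i * \<beta> $ i)) = 0"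
      unfolding sum_product[symmetric] Xs by simp
    have T3: "(\<Sum>k\<in>UNIV. \<Sum>i\<in>UNIV. X $ k * (X $ i * \<omega> i k)) = 0"
      unfolding sum_distrib_left[symmetric] X_om by simp
    have "(\<Sum>k\<in>UNIV. \<Sum>i\<in>UNIV. X $ k * X $ i * R k i)
      = H * \<eta> $ j - (\<Sum>k\<in>UNIV. \<Sum>i\<in>UNIV. (X $ k * h k j) * (X $ i * \<eta> $ i))
        + (\<Sum>k\<in>UNIV. \<Sum>i\<in>UNIV. (X $ k * ((if k = j then - 2 * b * f else 0) + 2 * a * \<omega> j k)) * (X $ i * \<beta> $ i))
        - \<beta> $ j * ((\<Sum>k\<in>UNIV. \<Sum>i\<in>UNIV. X $ k * X $ i * (if i = k then - 2 * b * f else 0))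
           + 2 * a * (\<Sum>k\<in>UNIV. \<Sum>i\<in>UNIV. X $ k * (X $ i * \<omega> i k)))"
      unfolding R_def H_def
      by (simp only: sum_distrib_left sum_distrib_right sum.distrib[symmetric] sum_subtractf[symmetric])
         (intro sum.cong refl, simp add: algebra_simps)
    also have "\<dots> = H * \<eta> $ j + 2 * b * f * \<beta> $ j"
      unfolding T1 T2 T3 dd by simp
    finally have "(\<Sum>k\<in>UNIV. \<Sum>i\<in>UNIV. X $ k * X $ i * R k i) = H * \<eta> $ j + 2 * b * f * \<beta> $ j" .
    moreover have "L k i = R k i" for k i unfolding L_def R_def by (rule deriv)
    ultimately show ?thesis using left by simp
  qed
  define c where "c = (8 * a^2 * b - H) / (2 * b * f)"
  have "\<beta> $ j = c * \<eta> $ j" for j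
    using par[of j] nz by (simp add: c_def field_simps)
  then show ?thesis using decomp[of i j] nz by simp
qed

section \<open>The Clifford-traced curvature equation\<close>

context clifford_module begin

lemma inner_cl_cl_J_antisym: "inner (cl X (cl Y v)) (J v) = - inner (cl Y (cl X v)) (J v)"
  by (subst cl_swap) (simp add: inner_diff_left inner_self_J)

lemma inner_cl3_swap12: "inner (cl X (cl Y (cl Z v))) v = - inner (cl Y (cl X (cl Z v))) v"
  by (subst cl_swap) (simp add: inner_diff_left inner_cl_self)

lemma inner_cl3_swap23: "inner (cl X (cl Y (cl Z v))) v = - inner (cl X (cl Z (cl Y v))) v"
  by (subst cl_swap[of Y Z]) (simp add: cl_lin inner_diff_left inner_cl_self)

text \<open>Symmetric coefficients see only the anticommutator, which is diagonal and
  scalar.\<close>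

lemma sum_symmetric_gam_gam:
  assumes "\<And>k l. r k l = r l k"
  shows "(\<Sum>k\<in>UNIV. \<Sum>l\<in>UNIV. r k l *\<^sub>R \<gamma> k (\<gamma> l v)) = - (\<Sum>k\<in>UNIV. r k k) *\<^sub>R v"
proof -
  define S where "S = (\<Sum>k\<in>UNIV. \<Sum>l\<in>UNIV. r k l *\<^sub>R \<gamma> k (\<gamma> l v))"
  have "S = (\<Sum>k\<in>UNIV. \<Sum>l\<in>UNIV. r k l *\<^sub>R \<gamma> l (\<gamma> k v))"
    unfolding S_def by (subst sum.swap) (simp add: assms)
  then have "S + S = (\<Sum>k\<in>UNIV. \<Sum>l\<in>UNIV. r k l *\<^sub>R (\<gamma> k (\<gamma> l v) + \<gamma> l (\<gamma> k v)))"
    by (simp add: S_def sum.distrib scaleR_add_right)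
  also have "\<dots> = - 2 *\<^sub>R (\<Sum>k\<in>UNIV. r k k) *\<^sub>R v"
    by (simp add: gam_gam if_distrib scaleR_sum_left sum_negf scaleR_sum_right mult.commute cong: if_cong)
  finally have "2 *\<^sub>R (S + (\<Sum>k\<in>UNIV. r k k) *\<^sub>R v) = 0"
    by (simp add: scaleR_2 scaleR_add_right)
  then show ?thesis by (simp add: S_def eq_neg_iff_add_eq_0)
qed

text \<open>Pairing the equation in direction \<open>X\<close> with \<open>\<psi>\<close> shows \<open>\<alpha> \<bottom> \<eta>\<close>.  Pairing it with \<open>Y \<cdot> \<psi>\<close>, and its
  Clifford trace with \<open>X \<cdot> Y \<cdot> \<psi>\<close>, gives two multiples of \<open>\<tau>(\<alpha>, X, Y)\<close> for the same expression in \<open>\<omega>\<close> and \<open>\<phi>\<close>,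
  whence \<open>(n - 3) \<tau>(\<alpha>, X, Y) = 0\<close>.  Finally take \<open>X \<bottom> \<alpha>, \<eta>\<close> and pair with \<open>\<alpha> \<cdot> X \<cdot> \<psi>\<close>.\<close>

lemma ricci_spinor_equation_imp_zero:
  fixes \<alpha> :: "real^'n" and r \<phi> :: "'n \<Rightarrow> 'n \<Rightarrow> real"
  assumes dim: "CARD('n) \<ge> 4" and nz: "\<psi> \<noteq> 0"
    and r: "\<And>k l. r k l = r l k" and \<phi>: "\<And>k l. \<phi> k l = - \<phi> l k"
    and eq: "\<And>j. (\<Sum>l\<in>UNIV. r j l *\<^sub>R \<gamma> l \<psi>) + J (\<Sum>i\<in>UNIV. \<phi> i j *\<^sub>R \<gamma> i \<psi>)
        = cl \<alpha> (\<gamma> j \<psi>) + (real CARD('n) * \<alpha> $ j) *\<^sub>R \<psi>"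
  shows "\<alpha> = 0"
proof -
  define n where "n = real CARD('n)"
  have n: "n \<ge> 4" using dim by (simp add: n_def)
  define R where "R X = (\<chi> l. \<Sum>j\<in>UNIV. X $ j * r j l)" for X :: "real^'n"
  define F where "F X = (\<chi> i. \<Sum>j\<in>UNIV. X $ j * \<phi> i j)" for X :: "real^'n"
  define f where "f = inner \<psi> \<psi>"
  have f: "f > 0" using nz by (simp add: f_def)
  define om where "om X Y = inner (cl X (cl Y \<psi>)) (J \<psi>)" for X Y
  define ta where "ta X Y Z = inner (cl X (cl Y (cl Z \<psi>))) \<psi>" for X Y Z
  define e where "e = (\<chi> i. inner (\<gamma> i \<psi>) (J \<psi>))"
  have e: "inner (cl X \<psi>) (J \<psi>) = inner e X" for X
    by (simp add: cl_def e_def inner_vec_def inner_sum_left mult.commute)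
  have R_sym: "inner (R X) Y = inner (R Y) X" for X Y
    unfolding R_def inner_vec_def inner_real_def
    by (simp add: sum_distrib_right) (subst sum.swap, simp add: r mult_ac)
  have F_skew: "inner (F X) X = 0" for X
  proof -
    define S where "S = (\<Sum>i\<in>UNIV. \<Sum>j\<in>UNIV. X $ i * X $ j * \<phi> i j)"
    have "inner (F X) X = S"
      by (simp add: S_def F_def inner_vec_def sum_distrib_left mult_ac)
    moreover have "S = (\<Sum>i\<in>UNIV. \<Sum>j\<in>UNIV. - (X $ i * X $ j * \<phi> i j))"
      unfolding S_def by (subst sum.swap) (intro sum.cong refl, subst \<phi>, simp)
    then have "S = - S" unfolding S_def by (simp only: sum_negf)
    ultimately show ?thesis by simp
  qed
  have eqX: "cl (R X) \<psi> + J (cl (F X) \<psi>) = cl \<alpha> (cl X \<psi>) + (n * inner \<alpha> X) *\<^sub>R \<psi>" for X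
  proof -
    have "cl (R X) \<psi> = (\<Sum>j\<in>UNIV. X $ j *\<^sub>R (\<Sum>l\<in>UNIV. r j l *\<^sub>R \<gamma> l \<psi>))"
      unfolding cl_def R_def by (simp add: scaleR_sum_left scaleR_sum_right) (rule sum.swap)
    moreover have "J (cl (F X) \<psi>) = (\<Sum>j\<in>UNIV. X $ j *\<^sub>R J (\<Sum>i\<in>UNIV. \<phi> i j *\<^sub>R \<gamma> i \<psi>))"
      unfolding cl_def F_def by (simp add: scaleR_sum_left scaleR_sum_right J_lin) (rule sum.swap)
    ultimately have "cl (R X) \<psi> + J (cl (F X) \<psi>)
        = (\<Sum>j\<in>UNIV. X $ j *\<^sub>R (cl \<alpha> (\<gamma> j \<psi>) + (n * \<alpha> $ j) *\<^sub>R \<psi>))"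
      by (simp add: eq[symmetric] sum.distrib[symmetric] scaleR_add_right n_def)
    also have "\<dots> = cl \<alpha> (cl X \<psi>) + (n * inner \<alpha> X) *\<^sub>R \<psi>"
      by (simp add: scaleR_add_right sum.distrib cl_def[of X] cl_lin inner_vec_def
          scaleR_sum_left sum_distrib_left mult_ac)
    finally show ?thesis .
  qed
  have step1: "(n - 1) * inner \<alpha> X * f = - inner e (F X)" for X
  proof -
    have "inner (cl (R X) \<psi> + J (cl (F X) \<psi>)) \<psi> = - inner e (F X)"
      by (simp add: inner_add_left inner_cl_self J_skew e)
    then show ?thesis
      unfolding eqX by (simp add: inner_add_left inner_cl_cl f_def algebra_simps)
  qed
  have "inner \<alpha> e = 0"
    using step1[of e] F_skew[of e] n f by (simp add: inner_commute)
  have A: "inner (R X) Y * f + om Y (F X) = - ta Y \<alpha> X" for X Y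
  proof -
    have "inner (J (cl (F X) \<psi>)) (cl Y \<psi>) = om Y (F X)"
      using cl_skew[of Y "J (cl (F X) \<psi>)" \<psi>] by (simp add: om_def cl_J[symmetric] J_skew)
    moreover have "inner (cl (R X) \<psi>) (cl Y \<psi>) = inner (R X) Y * f"
      using cl_skew[of Y "cl (R X) \<psi>" \<psi>] inner_cl_cl[of Y "R X" \<psi>] by (simp add: f_def inner_commute)
    moreover have "inner (cl \<alpha> (cl X \<psi>)) (cl Y \<psi>) = - ta Y \<alpha> X"
      using cl_skew[of Y "cl \<alpha> (cl X \<psi>)" \<psi>] by (simp add: ta_def)
    moreover have "inner (cl (R X) \<psi> + J (cl (F X) \<psi>)) (cl Y \<psi>)
       = inner (cl \<alpha> (cl X \<psi>) + (n * inner \<alpha> X) *\<^sub>R \<psi>) (cl Y \<psi>)"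
      by (simp only: eqX)
    ultimately show ?thesis
      using inner_cl_self[of Y \<psi>] inner_commute[of \<psi> "cl Y \<psi>"] by (simp add: inner_add_left)
  qed
  \<comment> \<open>The term with \<open>R\<close> is symmetric in \<open>X\<close> and
    \<open>Y\<close> while \<open>ta\<close> is skew in them, so antisymmetrising \<open>A\<close>
    eliminates the unknown Ricci part.\<close>
  have A': "om Y (F X) - om X (F Y) = - 2 * ta Y \<alpha> X" for X Y
  proof -
    have "ta X \<alpha> Y = - ta Y \<alpha> X"
      using inner_cl3_swap12[of X \<alpha> Y \<psi>] inner_cl3_swap23[of \<alpha> X Y \<psi>] inner_cl3_swap12[of \<alpha> Y X \<psi>]
      by (simp add: ta_def)
    then show ?thesis using A[of X Y] A[of Y X] R_sym[of X Y] by simp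
  qed
  \<comment> \<open>The 2-form \<phi> acting by Clifford multiplication. It arises as the Clifford
    trace of the terms with \<open>F\<close>, and its commutator with a vector is again given by
    \<open>F\<close>.\<close>
  define Phi where "Phi v = (\<Sum>k\<in>UNIV. \<Sum>l\<in>UNIV. \<phi> l k *\<^sub>R \<gamma> k (\<gamma> l v))" for v
  have Phi_skew: "inner (Phi u) v = - inner u (Phi v)" for u v
  proof -
    have "inner (Phi u) v = (\<Sum>k\<in>UNIV. \<Sum>l\<in>UNIV. \<phi> l k * inner u (\<gamma> l (\<gamma> k v)))"
      by (simp add: Phi_def inner_sum_left gam_skew)
    also have "\<dots> = (\<Sum>k\<in>UNIV. \<Sum>l\<in>UNIV. - (\<phi> l k * inner u (\<gamma> k (\<gamma> l v))))"
      by (subst sum.swap) (intro sum.cong refl, subst \<phi>, simp)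
    finally show ?thesis by (simp add: Phi_def inner_sum_right sum_negf)
  qed
  have linear_Phi: "linear Phi" unfolding Phi_def
    by (intro linear_compose_sum ballI linear_compose_scale_right)
       (use linear_compose[OF linear_gam linear_gam] in \<open>simp add: o_def\<close>)
  have Phi_cl: "Phi (cl X v) = cl X (Phi v) + 4 *\<^sub>R cl (F X) v" for X v
  proof -
    have "Phi (\<gamma> m v) = \<gamma> m (Phi v) + 4 *\<^sub>R (\<Sum>l\<in>UNIV. \<phi> l m *\<^sub>R \<gamma> l v)" for m
      using spin_commutator[of "\<lambda>k l. \<phi> l k" m v, OF \<phi>] unfolding Phi_def by (simp add: algebra_simps)
    then have "Phi (cl X v) = (\<Sum>m\<in>UNIV. X $ m *\<^sub>R (\<gamma> m (Phi v) + 4 *\<^sub>R (\<Sum>l\<in>UNIV. \<phi> l m *\<^sub>R \<gamma> l v)))"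
      by (simp add: cl_def linear_sum[OF linear_Phi] linear_scale[OF linear_Phi])
    also have "\<dots> = cl X (Phi v) + 4 *\<^sub>R (\<Sum>m\<in>UNIV. \<Sum>l\<in>UNIV. (X $ m * \<phi> l m) *\<^sub>R \<gamma> l v)"
      by (simp add: cl_def scaleR_add_right sum.distrib scaleR_sum_right mult_ac)
    also have "(\<Sum>m\<in>UNIV. \<Sum>l\<in>UNIV. (X $ m * \<phi> l m) *\<^sub>R \<gamma> l v) = cl (F X) v"
      by (subst sum.swap) (simp add: cl_def F_def scaleR_sum_left)
    finally show ?thesis .
  qed
  have Phi_J: "Phi (J v) = J (Phi v)" for v
    by (simp add: Phi_def J_lin J_gam)
  \<comment> \<open>On the left the symmetric part collapses to a scalar. On the right the
    contraction around \<alpha> contributes n - 2 and the last term n.\<close>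
  have lich: "- (\<Sum>k\<in>UNIV. r k k) *\<^sub>R \<psi> + J (Phi \<psi>) = (2 * n - 2) *\<^sub>R cl \<alpha> \<psi>"
  proof -
    have "(\<Sum>j\<in>UNIV. \<gamma> j ((\<Sum>l\<in>UNIV. r j l *\<^sub>R \<gamma> l \<psi>) + J (\<Sum>i\<in>UNIV. \<phi> i j *\<^sub>R \<gamma> i \<psi>)))
       = (\<Sum>j\<in>UNIV. \<Sum>l\<in>UNIV. r j l *\<^sub>R \<gamma> j (\<gamma> l \<psi>)) + J (Phi \<psi>)"
      by (simp add: gam_lin sum.distrib Phi_def J_lin J_gam)
    moreover have "(\<Sum>j\<in>UNIV. \<gamma> j (cl \<alpha> (\<gamma> j \<psi>) + (n * \<alpha> $ j) *\<^sub>R \<psi>)) = (n - 2) *\<^sub>R cl \<alpha> \<psi> + n *\<^sub>R cl \<alpha> \<psi>"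
      by (simp add: gam_lin sum.distrib sum_gam_cl_gam n_def)
         (simp add: cl_def scaleR_sum_right)
    moreover have "(n - 2) *\<^sub>R cl \<alpha> \<psi> + n *\<^sub>R cl \<alpha> \<psi> = (2 * n - 2) *\<^sub>R cl \<alpha> \<psi>"
      by (simp add: scaleR_add_left[symmetric])
    ultimately show ?thesis
      unfolding eq n_def[symmetric] sum_symmetric_gam_gam[of r, OF r] by metis
  qed
  have ta0: "ta Y \<alpha> X = 0" if "inner X Y = 0" for X Y
  proof -
    \<comment> \<open>Two evaluations of \<open>A\<close>: one moves the skew \<open>Phi\<close>
      across the pairing, the other moves \<open>X\<close> and \<open>Y\<close>, which anticommute
      by orthogonality. Their sum contains only the commutator of \<open>Phi\<close> with the
      product of \<open>X\<close> and \<open>Y\<close>, hence only \<open>F\<close>.\<close>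
    define A where "A = inner (J (Phi \<psi>)) (cl X (cl Y \<psi>))"
    have "A = - inner (J \<psi>) (Phi (cl X (cl Y \<psi>)))"
      by (simp add: A_def J_skew Phi_skew Phi_J)
    moreover have "A = inner (cl X (cl Y (Phi \<psi>))) (J \<psi>)"
    proof -
      have "A = inner (cl Y (cl X (J (Phi \<psi>)))) \<psi>" by (simp add: A_def cl_skew)
      also have "\<dots> = - inner (cl X (cl Y (J (Phi \<psi>)))) \<psi>"
        by (subst cl_swap) (simp add: that inner_commute)
      finally show ?thesis by (simp add: cl_J[symmetric] J_skew)
    qed
    ultimately have "2 * A = - 4 * (om (F X) Y + om X (F Y))"
      by (simp add: Phi_cl inner_add_right inner_add_left om_def inner_commute cl_lin)
    moreover have "A = (2 * n - 2) * ta Y X \<alpha>"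
    proof -
      have "inner (- (\<Sum>k\<in>UNIV. r k k) *\<^sub>R \<psi> + J (Phi \<psi>)) (cl X (cl Y \<psi>)) = A"
        using inner_cl_cl[of X Y \<psi>] that inner_commute[of \<psi> "cl X (cl Y \<psi>)"]
        by (simp add: inner_diff_left A_def)
      then show ?thesis
        unfolding lich by (simp add: ta_def cl_skew)
    qed
    moreover have "ta Y X \<alpha> = - ta Y \<alpha> X" unfolding ta_def by (rule inner_cl3_swap23)
    moreover have "om (F X) Y = - om Y (F X)" unfolding om_def by (rule inner_cl_cl_J_antisym)
    ultimately have "2 * (om Y (F X) - om X (F Y)) = - ((2 * n - 2) * ta Y \<alpha> X)" by simp
    \<comment> \<open>By \<open>A'\<close> the left side is -4 times \<open>ta Y \<alpha> X\<close>,
      to be compared with -(2n - 2) times the same number.\<close>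
    then have "(n - 3) * ta Y \<alpha> X = 0" unfolding A' by (simp add: algebra_simps)
    then show ?thesis using n by simp
  qed
  have "dim {\<alpha>, e} < DIM(real^'n)"
  proof -
    have "dim {\<alpha>, e} \<le> card {\<alpha>, e}" by (intro dim_le_card') auto
    also have "\<dots> \<le> 2" by (simp add: card_insert_if)
    finally show ?thesis using dim by simp
  qed
  then obtain X where "X \<noteq> 0" and X: "\<And>y. y \<in> span {\<alpha>, e} \<Longrightarrow> orthogonal X y"
    using orthogonal_to_subspace_exists by blast
  have Xa: "inner X \<alpha> = 0" "inner \<alpha> X = 0" and Xe: "inner X e = 0" "inner e X = 0"
    using X[of \<alpha>] X[of e] by (auto simp: span_base orthogonal_def inner_commute)
  \<comment> \<open>\<open>ta0\<close> asks for orthogonal arguments. The component of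
    \<open>v\<close> along \<open>X\<close> is harmless, because \<open>X\<close> and \<alpha>
    anticommute and \<open>X\<close> squares to a scalar.\<close>
  have ta_v: "ta X \<alpha> v = 0" for v
  proof -
    define t where "t = inner v X / inner X X"
    have "inner (v - t *\<^sub>R X) X = 0" using \<open>X \<noteq> 0\<close> by (simp add: t_def inner_diff_left)
    from ta0[OF this] have "ta X \<alpha> (v - t *\<^sub>R X) = 0" .
    moreover have "ta X \<alpha> X = 0"
      unfolding ta_def by (subst cl_swap) (simp add: Xa cl_square cl_lin inner_cl_self)
    moreover have "ta X \<alpha> (v - t *\<^sub>R X) = ta X \<alpha> v - t * ta X \<alpha> X"
      using cl_add[of "v - t *\<^sub>R X" "t *\<^sub>R X" \<psi>]
      by (simp add: ta_def cl_lin cl_scaleR inner_add_left)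
    ultimately show ?thesis by simp
  qed
  \<comment> \<open>Both terms on the left of \<open>eqX\<close> turn out to be orthogonal to
    \<open>cl \<alpha> (cl X \<psi>)\<close>. Since \<open>X\<close> is orthogonal to \<alpha>, the
    right side is this very spinor, so it has norm zero.\<close>
  have "inner (cl (R X) \<psi>) (cl \<alpha> (cl X \<psi>)) = 0"
    using ta_v[of "R X"] by (simp add: ta_def cl_skew)
  moreover have "inner (J (cl (F X) \<psi>)) (cl \<alpha> (cl X \<psi>)) = 0"
  proof -
    define w where "w = F X"
    have wX: "inner X w = 0" "inner w X = 0" using F_skew[of X] by (simp_all add: w_def inner_commute)
    \<comment> \<open>Transposing the three vectors and \<open>J\<close> reproduces \<open>Q\<close>
      with the vectors in reverse order; restoring the order by anticommutation yields -Q up to a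
      multiple of \<open>inner e X\<close>, which is zero by the choice of \<open>X\<close>.\<close>
    define Q where "Q = inner (cl X (cl \<alpha> (cl w \<psi>))) (J \<psi>)"
    have "Q = - inner \<psi> (J (cl X (cl \<alpha> (cl w \<psi>))))"
      by (simp add: Q_def J_skew[of "cl X (cl \<alpha> (cl w \<psi>))"] inner_commute[of \<psi>])
    also have "\<dots> = inner (cl w (cl \<alpha> (cl X \<psi>))) (J \<psi>)"
      by (simp add: cl_J cl_skew)
    also have "\<dots> = - Q"
    proof -
      have "cl w (cl \<alpha> (cl X \<psi>)) = - cl w (cl X (cl \<alpha> \<psi>))"
        by (subst cl_swap[of \<alpha>]) (simp add: Xa cl_lin)
      also have "\<dots> = cl X (cl w (cl \<alpha> \<psi>))" by (subst cl_swap[of w]) (simp add: wX)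
      also have "\<dots> = - cl X (cl \<alpha> (cl w \<psi>)) - (2 * inner w \<alpha>) *\<^sub>R cl X \<psi>"
        by (subst cl_swap[of w]) (simp add: cl_lin)
      finally show ?thesis by (simp add: Q_def inner_diff_left e Xe)
    qed
    finally have "Q = 0" by simp
    then show ?thesis unfolding Q_def w_def
      using cl_skew[of X "cl \<alpha> (J (cl (F X) \<psi>))" \<psi>] cl_skew[of \<alpha> "J (cl (F X) \<psi>)" "cl X \<psi>"]
      by (simp add: cl_J[symmetric] J_skew)
  qed
  ultimately have "inner (cl \<alpha> (cl X \<psi>) + (n * inner \<alpha> X) *\<^sub>R \<psi>) (cl \<alpha> (cl X \<psi>)) = 0"
    unfolding eqX[symmetric] by (simp add: inner_add_left)
  then have "cl \<alpha> (cl X \<psi>) = 0" by (simp add: Xa)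
  then have "cl X (cl \<alpha> (cl \<alpha> (cl X \<psi>))) = 0" by (simp add: cl_lin)
  then have "(inner \<alpha> \<alpha> * inner X X) *\<^sub>R \<psi> = 0" by (simp add: cl_square cl_lin)
  then show ?thesis using \<open>X \<noteq> 0\<close> nz by simp
qed


section \<open>Algebra of the connection and of multiplication by K = a + i b\<close>

definition kmul :: "real \<Rightarrow> real \<Rightarrow> 'v \<Rightarrow> 'v" where
  "kmul a b v = a *\<^sub>R v + b *\<^sub>R J v"

lemma kmul_lin: "kmul a b (u + v) = kmul a b u + kmul a b v"
  "kmul a b (u - v) = kmul a b u - kmul a b v"
  "kmul a b (r *\<^sub>R v) = r *\<^sub>R kmul a b v"
  "kmul a b (\<Sum>i\<in>I. f i) = (\<Sum>i\<in>I. kmul a b (f i))"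
  by (simp_all add: kmul_def J_lin algebra_simps scaleR_sum_right sum.distrib)

lemma gam_kmul: "\<gamma> i (kmul a b v) = kmul a b (\<gamma> i v)"
  by (simp add: kmul_def gam_lin J_gam)

text \<open>The zeroth-order part of the covariant derivative along one frame vector. Fed with
  curvature components instead of connection coefficients, the same expression is the curvature
  endomorphism of the spinor bundle.\<close>

definition spin_conn :: "('n \<Rightarrow> 'n \<Rightarrow> real) \<Rightarrow> real \<Rightarrow> 'v \<Rightarrow> 'v" where
  "spin_conn w A v = (1/4) *\<^sub>R (\<Sum>k\<in>UNIV. \<Sum>l\<in>UNIV. w k l *\<^sub>R \<gamma> k (\<gamma> l v)) + (A / 2) *\<^sub>R J v"

lemma linear_spin_conn: "linear (spin_conn w A)"
  unfolding spin_conn_def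
  by (intro linear_compose_add linear_compose_sum ballI linear_compose_scale_right linear_J)
     (use linear_compose[OF linear_gam linear_gam] in \<open>simp add: o_def\<close>)

lemmas spin_conn_lin = linear_add[OF linear_spin_conn] linear_diff[OF linear_spin_conn]
  linear_scale[OF linear_spin_conn] linear_neg[OF linear_spin_conn] linear_sum[OF linear_spin_conn]

lemma spin_conn_J: "spin_conn w A (J v) = J (spin_conn w A v)"
  by (simp add: spin_conn_def J_lin J_gam)

lemma spin_conn_kmul: "spin_conn w A (kmul a b v) = kmul a b (spin_conn w A v)"
  by (simp add: kmul_def spin_conn_lin spin_conn_J)

lemma spin_conn_add_left: "spin_conn (\<lambda>k l. w k l + w' k l) (A + A') v = spin_conn w A v + spin_conn w' A' v"
  and spin_conn_diff_left: "spin_conn (\<lambda>k l. w k l - w' k l) (A - A') v = spin_conn w A v - spin_conn w' A' v"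
  by (simp_all add: spin_conn_def scaleR_add_left scaleR_diff_left sum.distrib sum_subtractf
      add_divide_distrib diff_divide_distrib scaleR_add_right scaleR_diff_right)

lemma spin_conn_sum_left:
  "spin_conn (\<lambda>k l. \<Sum>m\<in>UNIV. c m * w m k l) (\<Sum>m\<in>(UNIV::'n set). c m * A m) v
    = (\<Sum>m\<in>UNIV. c m *\<^sub>R spin_conn (w m) (A m) v)"
proof -
  have "(\<Sum>k\<in>UNIV. \<Sum>l\<in>UNIV. (\<Sum>m\<in>UNIV. c m * w m k l) *\<^sub>R \<gamma> k (\<gamma> l v))
      = (\<Sum>k\<in>UNIV. \<Sum>m\<in>UNIV. \<Sum>l\<in>UNIV. (c m * w m k l) *\<^sub>R \<gamma> k (\<gamma> l v))"
    by (simp add: scaleR_sum_left) (intro sum.cong refl sum.swap)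
  also have "\<dots> = (\<Sum>m\<in>UNIV. c m *\<^sub>R (\<Sum>k\<in>UNIV. \<Sum>l\<in>UNIV. w m k l *\<^sub>R \<gamma> k (\<gamma> l v)))"
    by (subst sum.swap) (simp add: scaleR_sum_right)
  finally show ?thesis
    by (simp add: spin_conn_def scaleR_add_right sum.distrib scaleR_sum_right scaleR_sum_left
        sum_divide_distrib mult.commute)
qed

text \<open>The Leibniz rule for Clifford multiplication; the auxiliary part drops out because
  \<open>J\<close> commutes with the generators.\<close>

lemma spin_conn_gam:
  assumes "\<And>k l. w k l = - w l k"
  shows "spin_conn w A (\<gamma> m v) = \<gamma> m (spin_conn w A v) + (\<Sum>l\<in>UNIV. w m l *\<^sub>R \<gamma> l v)"
proof -
  have "(\<Sum>k\<in>UNIV. \<Sum>l\<in>UNIV. w k l *\<^sub>R \<gamma> k (\<gamma> l (\<gamma> m v)))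
     = \<gamma> m (\<Sum>k\<in>UNIV. \<Sum>l\<in>UNIV. w k l *\<^sub>R \<gamma> k (\<gamma> l v)) + 4 *\<^sub>R (\<Sum>l\<in>UNIV. w m l *\<^sub>R \<gamma> l v)"
    using spin_commutator[of w m v, OF assms] by (simp add: algebra_simps)
  then show ?thesis
    unfolding spin_conn_def by (simp only: scaleR_add_right gam_lin J_gam) simp
qed

text \<open>Transposing a product of two generators exchanges their indices without a sign, so
  skewness of \<open>w\<close> supplies the minus. This is compatibility of the connection with the
  Hermitian product.\<close>

lemma spin_conn_skew:
  assumes w: "\<And>k l. w k l = - w l k"
  shows "inner (spin_conn w A u) v = - inner u (spin_conn w A v)"
proof -
  have "(\<Sum>k\<in>UNIV. \<Sum>l\<in>UNIV. w k l * inner (\<gamma> k (\<gamma> l u)) v)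
      = (\<Sum>k\<in>UNIV. \<Sum>l\<in>UNIV. w k l * inner u (\<gamma> l (\<gamma> k v)))"
    by (simp add: gam_skew)
  also have "\<dots> = (\<Sum>k\<in>UNIV. \<Sum>l\<in>UNIV. - (w k l * inner u (\<gamma> k (\<gamma> l v))))"
    by (subst sum.swap) (intro sum.cong refl, subst w, simp)
  finally show ?thesis
    by (simp add: spin_conn_def inner_add_left inner_add_right inner_sum_left inner_sum_right sum_negf J_skew)
qed

text \<open>The auxiliary parts are multiples of \<open>J\<close> and commute with everything, hence
  the 0 in the second slot.\<close>

lemma spin_conn_commutator:
  assumes skew: "\<And>k l. w k l = - w l k"
  shows "spin_conn w A (spin_conn w' A' v) - spin_conn w' A' (spin_conn w A v)
    = spin_conn (\<lambda>k l. \<Sum>m\<in>UNIV. w' k m * w m l + w' m l * w m k) 0 v"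
proof -
  define B where "B u = (\<Sum>k\<in>UNIV. \<Sum>l\<in>UNIV. w k l *\<^sub>R \<gamma> k (\<gamma> l u))" for u
  define B' where "B' u = (\<Sum>k\<in>UNIV. \<Sum>l\<in>UNIV. w' k l *\<^sub>R \<gamma> k (\<gamma> l u))" for u
  define Z where "Z = (\<Sum>k\<in>UNIV. \<Sum>l\<in>UNIV. (\<Sum>m\<in>UNIV. w' k m * w m l + w' m l * w m k) *\<^sub>R \<gamma> k (\<gamma> l v))"
  have Z: "B (B' v) = B' (B v) + 4 *\<^sub>R Z"
    using spin_spin_commutator[of w w' v, OF skew] unfolding B_def B'_def Z_def by (simp add: algebra_simps)
  have lB: "B (J u) = J (B u)" "B' (J u) = J (B' u)" for u
    by (simp_all add: B_def B'_def J_lin J_gam)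
  have lB2: "B (r *\<^sub>R u + s *\<^sub>R u') = r *\<^sub>R B u + s *\<^sub>R B u'" "B' (r *\<^sub>R u + s *\<^sub>R u') = r *\<^sub>R B' u + s *\<^sub>R B' u'" for r s u u'
    by (simp_all add: B_def B'_def gam_lin scaleR_add_right sum.distrib scaleR_sum_right mult_ac)
  have "spin_conn w A u = (1/4) *\<^sub>R B u + (A/2) *\<^sub>R J u"
    and "spin_conn w' A' u = (1/4) *\<^sub>R B' u + (A'/2) *\<^sub>R J u" for u
    by (simp_all add: spin_conn_def B_def B'_def)
  then have "spin_conn w A (spin_conn w' A' v) - spin_conn w' A' (spin_conn w A v) = (1/4) *\<^sub>R Z"
    by (simp only: lB2 lB J_lin Z) (simp add: scaleR_add_right mult.commute)
  then show ?thesis by (simp add: spin_conn_def Z_def)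
qed

text \<open>The algebra behind the curvature identity, freed from analysis: \<open>sd i\<close>
  stands for the derivative of the spinor along the i-th frame vector, \<open>S i j\<close> for the
  iterated one, and \<open>comm\<close> for the bracket of two frame vectors.\<close>

lemma killing_curvature:
  fixes w :: "'n \<Rightarrow> 'n \<Rightarrow> 'n \<Rightarrow> real" and dw :: "'n \<Rightarrow> 'n \<Rightarrow> 'n \<Rightarrow> 'n \<Rightarrow> real"
  assumes skew: "\<And>i k l. w i k l = - w i l k"
    and sd: "\<And>i. sd i = kmul a b (\<gamma> i s) - spin_conn (w i) (A i) s"
    and S: "\<And>i j. S i j = kmul a b (\<gamma> j (sd i)) + kmul (\<alpha> i) (\<beta> i) (\<gamma> j s)
      - (spin_conn (w j) (A j) (sd i) + spin_conn (dw i j) (dA i j) s)"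
    and comm: "S i j - S j i = (\<Sum>l\<in>UNIV. (w i j l - w j i l) *\<^sub>R sd l)"
  shows "spin_conn (\<lambda>k l. dw i j k l - dw j i k l
        + (\<Sum>m\<in>UNIV. w j k m * w i m l + w j m l * w i m k) - (\<Sum>m\<in>UNIV. (w i j m - w j i m) * w m k l))
      (dA i j - dA j i - (\<Sum>m\<in>UNIV. (w i j m - w j i m) * A m)) s
    = kmul (\<alpha> i) (\<beta> i) (\<gamma> j s) - kmul (\<alpha> j) (\<beta> j) (\<gamma> i s)
      + kmul a b (kmul a b (\<gamma> j (\<gamma> i s) - \<gamma> i (\<gamma> j s)))"
    (is "?L = _")
proof -
  define D where "D i v = spin_conn (w i) (A i) v" for i v
  define dD where "dD i j = spin_conn (dw i j) (dA i j) s" for i j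
  define x where "x i j = (\<Sum>l\<in>UNIV. w i j l *\<^sub>R \<gamma> l s)" for i j
  have L: "?L = dD i j - dD j i + (D i (D j s) - D j (D i s)) - (\<Sum>m\<in>UNIV. (w i j m - w j i m) *\<^sub>R D m s)"
    unfolding D_def dD_def spin_conn_commutator[OF skew] spin_conn_sum_left[symmetric]
      spin_conn_diff_left[symmetric] spin_conn_add_left[symmetric]
    by simp
  have D: "D j (sd i) = kmul a b (\<gamma> i (D j s)) + kmul a b (x j i) - D j (D i s)" for i j
    unfolding D_def sd x_def by (simp add: spin_conn_lin spin_conn_kmul spin_conn_gam[of "w j", OF skew] kmul_lin)
  have g: "kmul a b (\<gamma> j (sd i)) = kmul a b (kmul a b (\<gamma> j (\<gamma> i s))) - kmul a b (\<gamma> j (D i s))" for i j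
    unfolding D_def sd by (simp add: gam_lin gam_kmul kmul_lin)
  have S': "S i j = kmul a b (kmul a b (\<gamma> j (\<gamma> i s))) - kmul a b (\<gamma> j (D i s)) + kmul (\<alpha> i) (\<beta> i) (\<gamma> j s)
     - kmul a b (\<gamma> i (D j s)) - kmul a b (x j i) + D j (D i s) - dD i j" for i j
    unfolding S g D_def[symmetric] D dD_def[symmetric] by simp
  have "(\<Sum>l\<in>UNIV. (w i j l - w j i l) *\<^sub>R sd l)
     = kmul a b (x i j) - kmul a b (x j i) - (\<Sum>l\<in>UNIV. (w i j l - w j i l) *\<^sub>R D l s)"
    unfolding sd D_def x_def
    by (simp add: scaleR_diff_right scaleR_diff_left sum_subtractf kmul_lin)
  then have "S i j - S j i = kmul a b (x i j) - kmul a b (x j i) - (\<Sum>l\<in>UNIV. (w i j l - w j i l) *\<^sub>R D l s)"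
    using comm by simp
  \<comment> \<open>The bracket term is solved for, and substituting it cancels all products of K
    with a connection term: the Leibniz terms \<open>x\<close> are exactly what vanishing torsion
    contributes.\<close>
  then have e: "(\<Sum>l\<in>UNIV. (w i j l - w j i l) *\<^sub>R D l s) = kmul a b (x i j) - kmul a b (x j i) - (S i j - S j i)"
    by (simp add: algebra_simps)
  show ?thesis unfolding L e S' by (simp add: kmul_lin)
qed

text \<open>Covariant derivative of \<eta>, with the connection term kept on the right.
  Multiplication by i turns the imaginary part of the pairing into a real part, so b produces the
  metric and a produces \<omega>.\<close>

lemma eta_transport:
  assumes skew: "\<And>k l. w k l = - w l k" and sd: "sd = kmul a b (\<gamma> k s) - spin_conn w A s"
  shows "inner (\<gamma> j sd) (J s) + inner (\<gamma> j s) (J sd)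
    = (if k = j then - 2 * b * inner s s else 0) + 2 * a * omega s j k + (\<Sum>l\<in>UNIV. w j l * eta s l)"
proof -
  have "inner (\<gamma> j (spin_conn w A s)) (J s) + inner (\<gamma> j s) (J (spin_conn w A s))
     = - (\<Sum>l\<in>UNIV. w j l * eta s l)"
  proof -
    have "inner (\<gamma> j s) (J (spin_conn w A s)) = - inner (spin_conn w A (\<gamma> j s)) (J s)"
      by (simp add: spin_conn_skew[OF skew] spin_conn_J)
    then show ?thesis
      by (simp add: spin_conn_gam[OF skew] inner_add_left inner_sum_left eta_def)
  qed
  moreover have "inner (\<gamma> j (kmul a b (\<gamma> k s))) (J s) + inner (\<gamma> j s) (J (kmul a b (\<gamma> k s)))
     = (if k = j then - 2 * b * inner s s else 0) + 2 * a * omega s j k"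
  proof -
    have "inner (\<gamma> j (J (\<gamma> k s))) (J s) = inner (\<gamma> j (\<gamma> k s)) s"
      by (simp add: J_gam[symmetric] J_skew J_J)
    moreover have "inner (\<gamma> j s) (J (\<gamma> k s)) = omega s j k"
      using omega_antisym[of s j k] by (simp add: omega_def J_gam) (simp add: gam_skew)
    moreover have "inner (\<gamma> j s) (\<gamma> k s) = (if k = j then inner s s else 0)"
      using inner_gam_gam[of k j s] gam_skew[of k "\<gamma> j s" s] by (simp split: if_splits)
    ultimately show ?thesis
      using inner_gam_gam[of j k s]
      by (simp add: kmul_def gam_lin J_lin J_J inner_add_left inner_add_right inner_diff_right omega_def split: if_splits)
  qed
  ultimately show ?thesis unfolding sd by (simp add: gam_lin J_lin inner_diff_left inner_diff_right)
qed

lemma gam3_cyclic: "\<gamma> i (\<gamma> j (\<gamma> k v)) = \<gamma> k (\<gamma> i (\<gamma> j v))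
    + (if i = k then 2 else 0) *\<^sub>R \<gamma> j v - (if j = k then 2 else 0) *\<^sub>R \<gamma> i v"
proof -
  have "\<gamma> i (\<gamma> j (\<gamma> k v)) = - \<gamma> i (\<gamma> k (\<gamma> j v)) - (if j = k then 2 else 0) *\<^sub>R \<gamma> i v"
    by (subst gam_swap[of j k]) (simp add: gam_lin)
  moreover have "\<gamma> i (\<gamma> k (\<gamma> j v)) = - \<gamma> k (\<gamma> i (\<gamma> j v)) - (if i = k then 2 else 0) *\<^sub>R \<gamma> j v"
    by (rule gam_swap)
  ultimately show ?thesis by simp
qed

lemma inner_gam_self: "inner (\<gamma> i v) v = 0"
  using inner_cl_self[of "axis i 1" v] by (simp add: cl_axis)

lemma tau_cyclic: "tau v i j k = tau v k i j"
  unfolding tau_def by (subst gam3_cyclic) (simp add: inner_add_left inner_diff_left inner_gam_self)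

lemma tau_diag: "tau v k k j = 0"
  by (simp add: tau_def gam_gam_self inner_gam_self)

text \<open>The same mechanism one degree higher: b produces \<tau>, while a leaves the commutator
  of a generator with a product of two generators, which is of degree one and hence pairs to
  \<eta>.\<close>

lemma omega_transport:
  assumes skew: "\<And>k l. w k l = - w l k" and sd: "sd = kmul a b (\<gamma> k s) - spin_conn w A s"
  shows "inner (\<gamma> i (\<gamma> j sd)) (J s) + inner (\<gamma> i (\<gamma> j s)) (J sd)
    = 2 * b * tau s k i j + 2 * a * ((if i = k then eta s j else 0) - (if j = k then eta s i else 0))
      + (\<Sum>l\<in>UNIV. w i l * omega s l j + w j l * omega s i l)"
proof -
  have "inner (\<gamma> i (\<gamma> j (spin_conn w A s))) (J s) + inner (\<gamma> i (\<gamma> j s)) (J (spin_conn w A s))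
     = - (\<Sum>l\<in>UNIV. w i l * omega s l j + w j l * omega s i l)"
  proof -
    have "inner (\<gamma> i (\<gamma> j s)) (J (spin_conn w A s)) = - inner (spin_conn w A (\<gamma> i (\<gamma> j s))) (J s)"
      by (simp add: spin_conn_skew[OF skew] spin_conn_J)
    then show ?thesis
      by (simp add: spin_conn_gam[OF skew] gam_lin inner_add_left inner_sum_left omega_def sum.distrib)
  qed
  moreover have "inner (\<gamma> i (\<gamma> j (kmul a b (\<gamma> k s)))) (J s) + inner (\<gamma> i (\<gamma> j s)) (J (kmul a b (\<gamma> k s)))
     = 2 * b * tau s k i j + 2 * a * ((if i = k then eta s j else 0) - (if j = k then eta s i else 0))"
  proof -
    have "inner (\<gamma> i (\<gamma> j (J (\<gamma> k s)))) (J s) = tau s i j k"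
      by (simp add: J_gam[symmetric] J_skew J_J tau_def)
    moreover have "inner (\<gamma> i (\<gamma> j s)) (J (\<gamma> k s)) = - inner (\<gamma> k (\<gamma> i (\<gamma> j s))) (J s)"
      using gam_skew[of k "\<gamma> i (\<gamma> j s)" "J s"] by (simp add: J_gam)
    moreover have "inner (\<gamma> i (\<gamma> j s)) (\<gamma> k s) = - tau s k i j"
      using gam_skew[of k "\<gamma> i (\<gamma> j s)" s] by (simp add: tau_def)
    moreover have "inner (\<gamma> i (\<gamma> j (\<gamma> k s))) (J s) = inner (\<gamma> k (\<gamma> i (\<gamma> j s))) (J s)
       + (if i = k then 2 * eta s j else 0) - (if j = k then 2 * eta s i else 0)"
      by (subst gam3_cyclic) (simp add: inner_add_left inner_diff_left eta_def)
    ultimately show ?thesis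
      using tau_cyclic[of s i j k]
      by (simp add: kmul_def gam_lin J_lin J_J inner_add_left inner_add_right inner_diff_right; simp add: algebra_simps)
  qed
  ultimately show ?thesis unfolding sd by (simp add: gam_lin J_lin inner_diff_left inner_diff_right)
qed

lemma inner_J_gam: "inner (J (\<gamma> i v)) v = - eta v i"
  by (simp add: J_skew eta_def)

lemma inner_J_gam_gam: "inner (J (\<gamma> i (\<gamma> j v))) v = - omega v i j"
  by (simp add: J_skew omega_def)

text \<open>Only the imaginary part 2 a b of K^2 contributes, since the commutator of two generators
  pairs to zero with the spinor itself; the commutator doubles \<omega>. This is the origin of the
  factor 4 a b.\<close>

lemma inner_kmul_gam_commutator:
  "inner (kmul a b (kmul a b (\<gamma> j (\<gamma> i s) - \<gamma> i (\<gamma> j s)))) s = 4 * a * b * omega s i j"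
proof -
  have "kmul a b (kmul a b v) = (a * a - b * b) *\<^sub>R v + (2 * a * b) *\<^sub>R J v" for v
    by (simp add: kmul_def J_lin J_J algebra_simps; simp add: scaleR_add_left[symmetric])
  then show ?thesis
    using inner_gam_gam[of i j s] inner_gam_gam[of j i s] omega_antisym[of s j i]
    by (simp add: inner_add_left inner_diff_left J_lin inner_J_gam_gam split: if_splits)
qed

end

text \<open>Without torsion the structure functions of the frame are \<open>C\<close>, and the first
  Bianchi identity is their Jacobi identity: derivatives match termwise, and all quadratic terms
  have one of the two shapes \<open>G\<close> and \<open>H\<close>.\<close>

lemma bianchi_from_jacobi:
  fixes w :: "'n::finite \<Rightarrow> 'n \<Rightarrow> 'n \<Rightarrow> real" and dw :: "'n \<Rightarrow> 'n \<Rightarrow> 'n \<Rightarrow> 'n \<Rightarrow> real"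
  defines "C \<equiv> \<lambda>i j l. w i j l - w j i l"
  defines "\<rho> \<equiv> \<lambda>i j k l. dw i j k l - dw j i k l
        + (\<Sum>m\<in>UNIV. w j k m * w i m l + w j m l * w i m k) - (\<Sum>m\<in>UNIV. C i j m * w m k l)"
  assumes skew: "\<And>i k l. w i k l = - w i l k"
    and jac: "dw i j k l - dw i k j l + (dw j k i l - dw j i k l) + (dw k i j l - dw k j i l)
      = (\<Sum>m\<in>UNIV. C j k m * C m i l + C k i m * C m j l + C i j m * C m k l)"
  shows "\<rho> i j k l + \<rho> j k i l + \<rho> k i j l = 0"
proof -
  define G where "G i j k = (\<Sum>m\<in>UNIV. w i j m * w k m l)" for i j k
  define H where "H i j k = (\<Sum>m\<in>UNIV. w i j m * w m k l)" for i j k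
  have r: "\<rho> i j k l = dw i j k l - dw j i k l + (G j k i - G i k j) - (H i j k - H j i k)" for i j k
  proof -
    have "(\<Sum>m\<in>UNIV. w j k m * w i m l + w j m l * w i m k) = G j k i - G i k j"
      unfolding G_def sum_subtractf[symmetric] by (intro sum.cong refl) (subst skew[of i _ k], simp)
    moreover have "(\<Sum>m\<in>UNIV. C i j m * w m k l) = H i j k - H j i k"
      unfolding H_def C_def by (simp add: sum_subtractf left_diff_distrib)
    ultimately show ?thesis unfolding \<rho>_def by simp
  qed
  have "(\<Sum>m\<in>UNIV. C i j m * C m k l) = H i j k - H j i k - (G i j k - G j i k)" for i j k
    unfolding H_def G_def C_def by (simp add: sum_subtractf sum.distrib algebra_simps)
  then show ?thesis using jac unfolding r by (simp add: sum.distrib)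
qed

section \<open>Generalized Killing spinors in a local frame\<close>

text \<open>Here \<open>w i k l\<close> stands for \<open>g(\<nabla>\<^bsub>e\<^sub>i\<^esub> e\<^sub>k, e\<^sub>l)\<close>, and \<open>A k\<close> for the value of the auxiliary connection form
  on \<open>e\<^sub>k\<close>.  No regularity of \<open>A\<close> is assumed: where \<open>\<sigma>\<close> does not vanish, it follows from the Killing equation.\<close>

locale local_killing_spinor = clifford_module \<gamma> J
  for \<gamma> :: "'n::finite \<Rightarrow> 'v::real_inner \<Rightarrow> 'v" and J :: "'v \<Rightarrow> 'v" +
  fixes \<Omega> :: "(real^'n) set" and E :: "'n \<Rightarrow> real^'n \<Rightarrow> real^'n"
    and w :: "'n \<Rightarrow> 'n \<Rightarrow> 'n \<Rightarrow> real^'n \<Rightarrow> real" and A :: "'n \<Rightarrow> real^'n \<Rightarrow> real"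
    and \<sigma> :: "real^'n \<Rightarrow> 'v" and a b :: "real^'n \<Rightarrow> real"
  assumes open_domain: "open \<Omega>"
    and smooth_frame: "Csmooth_on (E j) \<Omega>"
    and smooth_w: "Csmooth_on (w i k l) \<Omega>"
    and smooth_spinor: "Csmooth_on \<sigma> \<Omega>"
    and smooth_a: "Csmooth_on a \<Omega>" and smooth_b: "Csmooth_on b \<Omega>"
    and frame_det: "x \<in> \<Omega> \<Longrightarrow> det (\<chi> i j. E j x $ i) \<noteq> 0"
    and w_skew: "x \<in> \<Omega> \<Longrightarrow> w i k l x = - w i l k x"
    and torsion: "x \<in> \<Omega> \<Longrightarrow> frechet_derivative (E j) (at x) (E i x) - frechet_derivative (E i) (at x) (E j x)
        = (\<Sum>l\<in>UNIV. (w i j l x - w j i l x) *\<^sub>R E l x)"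
    and killing: "x \<in> \<Omega> \<Longrightarrow> frechet_derivative \<sigma> (at x) (E k x)
        = kmul (a x) (b x) (\<gamma> k (\<sigma> x)) - spin_conn (\<lambda>j l. w k j l x) (A k x) (\<sigma> x)"
begin

section \<open>Derivatives along the frame\<close>

abbreviation pd :: "'n \<Rightarrow> (real^'n \<Rightarrow> 'w::real_normed_vector) \<Rightarrow> real^'n \<Rightarrow> 'w" where
  "pd i f x \<equiv> frechet_derivative f (at x) (E i x)"

lemma pd_eqI: "(f has_derivative D) (at x) \<Longrightarrow> pd i f x = D (E i x)"
  using frechet_derivative_at by metis

lemma frame_independent:
  assumes "x \<in> \<Omega>" "(\<Sum>l\<in>UNIV. c l *\<^sub>R E l x) = 0"
  shows "c l = 0"
proof -
  define M :: "real^'n^'n" where "M = (\<chi> i j. E j x $ i)"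
  have "M *v (\<chi> l. c l) = (\<Sum>l\<in>UNIV. c l *\<^sub>R E l x)"
    by (simp add: M_def matrix_vector_mult_def vec_eq_iff sum_component mult.commute)
  then have "M *v (\<chi> l. c l) = 0" using assms(2) by simp
  moreover have "invertible M" using frame_det[OF assms(1)] by (simp add: M_def invertible_det_nz)
  ultimately have "(\<chi> l. c l) = 0"
    by (metis invertible_def matrix_vector_mul_assoc matrix_vector_mul_lid matrix_vector_mult_0_right)
  then show ?thesis by (simp add: vec_eq_iff)
qed

lemma frame_spans:
  assumes "x \<in> \<Omega>"
  obtains c where "v = (\<Sum>l\<in>UNIV. c l *\<^sub>R E l x)"
proof -
  define M :: "real^'n^'n" where "M = (\<chi> i j. E j x $ i)"
  have "invertible M" using frame_det[OF assms(1)] by (simp add: M_def invertible_det_nz)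
  then obtain N where "M ** N = mat 1" unfolding invertible_def by blast
  then have "M *v (N *v v) = v" by (simp add: matrix_vector_mul_assoc)
  moreover have "M *v u = (\<Sum>l\<in>UNIV. u $ l *\<^sub>R E l x)" for u
    by (simp add: M_def matrix_vector_mult_def vec_eq_iff sum_component mult.commute)
  ultimately show ?thesis using that[of "\<lambda>l. (N *v v) $ l"] by metis
qed

lemma frechet_frame_sum:
  assumes "Csmooth_on f \<Omega>" "x \<in> \<Omega>"
  shows "frechet_derivative f (at x) (\<Sum>l\<in>UNIV. c l *\<^sub>R E l x) = (\<Sum>l\<in>UNIV. c l *\<^sub>R pd l f x)"
  using has_derivative_linear[OF Csmooth_on_has_derivative[OF assms]]
  by (simp add: linear_sum linear_scale)

lemma pd_has_derivative:
  fixes f :: "real^'n \<Rightarrow> 'w::real_inner"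
  assumes "Csmooth_on f \<Omega>" "x \<in> \<Omega>"
  shows "(pd i f has_derivative frechet_derivative (pd i f) (at x)) (at x)"
  unfolding frechet_derivative_works[symmetric]
  by (rule differentiableI)
     (rule has_derivative_along_field[OF open_domain assms Csmooth_on_has_derivative[OF smooth_frame assms(2)]])

lemma pd_commutator:
  fixes f :: "real^'n \<Rightarrow> 'w::real_inner"
  assumes "Csmooth_on f \<Omega>" "x \<in> \<Omega>"
  shows "pd i (pd j f) x - pd j (pd i f) x = (\<Sum>l\<in>UNIV. (w i j l x - w j i l x) *\<^sub>R pd l f x)"
  using commutator_along_fields[OF open_domain assms Csmooth_on_has_derivative[OF smooth_frame assms(2)]
      Csmooth_on_has_derivative[OF smooth_frame assms(2)]
      pd_has_derivative[OF assms] pd_has_derivative[OF assms]]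
  by (simp add: torsion[OF assms(2)] frechet_frame_sum[OF assms])

text \<open>Jacobi identity for three frame vectors, read in components. It is the derivative of the
  torsion equation along a third frame vector, summed cyclically.\<close>

lemma jacobi:
  assumes x: "x \<in> \<Omega>"
  defines "C \<equiv> \<lambda>i j l. w i j l x - w j i l x"
  defines "dw \<equiv> \<lambda>i j k l. pd i (w j k l) x"
  shows "dw i j k l - dw i k j l + (dw j k i l - dw j i k l) + (dw k i j l - dw k j i l)
      = (\<Sum>m\<in>UNIV. C j k m * C m i l + C k i m * C m j l + C i j m * C m k l)"
proof -
  define G where "G i j = pd i (E j) x" for i j
  have t: "pd i (pd j (E k)) x - pd i (pd k (E j)) x
      = (\<Sum>m\<in>UNIV. (dw i j k m - dw i k j m) *\<^sub>R E m x + C j k m *\<^sub>R G i m)" for i j k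
  proof -
    \<comment> \<open>The same function is differentiated twice: by the product rule in this form,
      and as a difference of first derivatives of the frame in the next.\<close>
    have 1: "((\<lambda>y. \<Sum>m\<in>UNIV. (w j k m y - w k j m y) *\<^sub>R E m y) has_derivative
       (\<lambda>v. \<Sum>m\<in>UNIV. (w j k m x - w k j m x) *\<^sub>R frechet_derivative (E m) (at x) v
         + (frechet_derivative (w j k m) (at x) v - frechet_derivative (w k j m) (at x) v) *\<^sub>R E m x)) (at x)"
      by (intro has_derivative_sum has_derivative_scaleR has_derivative_diff
          Csmooth_on_has_derivative[OF smooth_w x] Csmooth_on_has_derivative[OF smooth_frame x])
    have 2: "((\<lambda>y. \<Sum>m\<in>UNIV. (w j k m y - w k j m y) *\<^sub>R E m y) has_derivative
       (\<lambda>v. frechet_derivative (pd j (E k)) (at x) v - frechet_derivative (pd k (E j)) (at x) v)) (at x)"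
      by (rule has_derivative_transform_within_open[OF
            has_derivative_diff[OF pd_has_derivative[OF smooth_frame x] pd_has_derivative[OF smooth_frame x]] open_domain x])
         (simp add: torsion)
    show ?thesis
      using fun_cong[OF has_derivative_unique[OF 1 2], of "E i x"]
      by (simp add: dw_def C_def G_def add.commute)
  qed
  have c: "pd i (pd j (E k)) x - pd j (pd i (E k)) x = (\<Sum>m\<in>UNIV. C i j m *\<^sub>R G m k)" for i j k
    unfolding C_def G_def by (rule pd_commutator[OF smooth_frame x])
  have g: "G i m - G m i = (\<Sum>l\<in>UNIV. C i m l *\<^sub>R E l x)" for i m
    unfolding G_def C_def by (rule torsion[OF x])
  have CG: "(\<Sum>m\<in>UNIV. C j k m *\<^sub>R G m i) - (\<Sum>m\<in>UNIV. C j k m *\<^sub>R G i m)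
      = (\<Sum>l\<in>UNIV. (\<Sum>m\<in>UNIV. C j k m * C m i l) *\<^sub>R E l x)" for i j k
  proof -
    have "(\<Sum>m\<in>UNIV. C j k m *\<^sub>R G m i) - (\<Sum>m\<in>UNIV. C j k m *\<^sub>R G i m)
        = (\<Sum>m\<in>UNIV. \<Sum>l\<in>UNIV. (C j k m * C m i l) *\<^sub>R E l x)"
      by (simp add: sum_subtractf[symmetric] scaleR_diff_right[symmetric] g scaleR_sum_right)
    also have "\<dots> = (\<Sum>l\<in>UNIV. (\<Sum>m\<in>UNIV. C j k m * C m i l) *\<^sub>R E l x)"
      by (subst sum.swap) (simp add: scaleR_sum_left)
    finally show ?thesis .
  qed
  define P where "P i j k = (\<Sum>m\<in>UNIV. (dw i j k m - dw i k j m) *\<^sub>R E m x)" for i j k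
  define Q where "Q i j k = (\<Sum>l\<in>UNIV. (\<Sum>m\<in>UNIV. C j k m * C m i l) *\<^sub>R E l x)" for i j k
  \<comment> \<open>All second derivatives of the frame cancel in the cyclic sum of
    \<open>P - Q\<close>; independence of the frame then allows comparing coefficients.\<close>
  define D where "D i j k = pd i (pd j (E k)) x" for i j k
  have "P i j k = D i j k - D i k j - (\<Sum>m\<in>UNIV. C j k m *\<^sub>R G i m)" for i j k
    by (simp add: P_def D_def sum.distrib t)
  moreover have "(\<Sum>m\<in>UNIV. C j k m *\<^sub>R G i m) = D j k i - D k j i - Q i j k" for i j k
    unfolding D_def Q_def CG[symmetric] c by simp
  ultimately have "P i j k + P j k i + P k i j - (Q i j k + Q j k i + Q k i j) = 0" by simp
  then have "(\<Sum>l\<in>UNIV. (dw i j k l - dw i k j l + (dw j k i l - dw j i k l) + (dw k i j l - dw k j i l)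
      - (\<Sum>m\<in>UNIV. C j k m * C m i l + C k i m * C m j l + C i j m * C m k l)) *\<^sub>R E l x) = 0"
    unfolding P_def Q_def
    by (simp only: sum.distrib[symmetric] sum_subtractf[symmetric] scaleR_add_left[symmetric] scaleR_diff_left[symmetric])
  from frame_independent[OF x this, of l] show ?thesis by simp
qed

end

section \<open>Curvature of a nonvanishing Killing spinor\<close>

locale nonvanishing_killing_spinor = local_killing_spinor \<gamma> J \<Omega> E w A \<sigma> a b
  for \<gamma> :: "'n::finite \<Rightarrow> 'v::real_inner \<Rightarrow> 'v" and J \<Omega> E w A \<sigma> a b +
  assumes nonvanishing: "x \<in> \<Omega> \<Longrightarrow> \<sigma> x \<noteq> 0"
begin

text \<open>All other terms of the Killing equation are differentiable, and pairing with
  \<open>J (\<sigma> y)\<close> isolates half of \<open>A k y\<close> times the squared norm, which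
  can be divided out.\<close>

lemma A_differentiable:
  assumes x: "x \<in> \<Omega>"
  shows "(A k has_derivative frechet_derivative (A k) (at x)) (at x)"
proof -
  define B where "B y = kmul (a y) (b y) (\<gamma> k (\<sigma> y))
     - (1/4) *\<^sub>R (\<Sum>j\<in>UNIV. \<Sum>l\<in>UNIV. w k j l y *\<^sub>R \<gamma> j (\<gamma> l (\<sigma> y))) - pd k \<sigma> y" for y
  have diff: "f differentiable (at x)" if "Csmooth_on f \<Omega>" for f :: "real^'n \<Rightarrow> 'w::real_normed_vector"
    using Csmooth_on_has_derivative[OF that x] differentiable_def by blast
  have bl: "(\<lambda>y. T (f y)) differentiable (at x)" if "bounded_linear T" "f differentiable (at x)"
    for T :: "'v \<Rightarrow> 'v" and f :: "real^'n \<Rightarrow> 'v"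
    using that bounded_linear.has_derivative unfolding differentiable_def by blast
  have s: "\<sigma> differentiable (at x)" by (rule diff[OF smooth_spinor])
  have "pd k \<sigma> differentiable (at x)"
    using pd_has_derivative[OF smooth_spinor x] differentiable_def by blast
  then have "B differentiable (at x)"
    unfolding B_def kmul_def
    by (intro differentiable_diff differentiable_add differentiable_scaleR differentiable_sum ballI
        bl[OF bl_gam] bl[OF bl_J] s diff[OF smooth_a] diff[OF smooth_b] diff[OF smooth_w] differentiable_const finite_class.finite_UNIV)
  then have "(\<lambda>y. 2 * inner (B y) (J (\<sigma> y)) / inner (\<sigma> y) (\<sigma> y)) differentiable (at x)"
    using nonvanishing[OF x]
    by (intro differentiable_divide differentiable_mult differentiable_inner differentiable_const s bl[OF bl_J]) auto
  then obtain D where D: "((\<lambda>y. 2 * inner (B y) (J (\<sigma> y)) / inner (\<sigma> y) (\<sigma> y)) has_derivative D) (at x)"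
    unfolding differentiable_def by blast
  have "2 * inner (B y) (J (\<sigma> y)) / inner (\<sigma> y) (\<sigma> y) = A k y" if "y \<in> \<Omega>" for y
  proof -
    have "B y = (A k y / 2) *\<^sub>R J (\<sigma> y)"
      unfolding B_def killing[OF that] spin_conn_def by simp
    then show ?thesis
      using nonvanishing[OF that] J_skew[of "\<sigma> y" "J (\<sigma> y)"] by (simp add: J_J)
  qed
  then have "(A k has_derivative D) (at x)"
    by (rule has_derivative_transform_within_open[OF D open_domain x])
  then show ?thesis unfolding frechet_derivative_works[symmetric] by (rule differentiableI)
qed

text \<open>The component g(R(e_i, e_j) e_k, e_l) of the Riemann tensor. One quadratic term is
  rewritten by skewness of \<open>w\<close> so as to agree with \<open>spin_conn_commutator\<close>;
  the last sum is the derivative along the bracket.\<close>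

definition rho :: "real^'n \<Rightarrow> 'n \<Rightarrow> 'n \<Rightarrow> 'n \<Rightarrow> 'n \<Rightarrow> real" where
  "rho x i j k l = pd i (w j k l) x - pd j (w i k l) x
        + (\<Sum>m\<in>UNIV. w j k m x * w i m l x + w j m l x * w i m k x)
        - (\<Sum>m\<in>UNIV. (w i j m x - w j i m x) * w m k l x)"

text \<open>The exterior derivative of the local auxiliary connection form on two frame
  vectors.\<close>

definition curv :: "real^'n \<Rightarrow> 'n \<Rightarrow> 'n \<Rightarrow> real" where
  "curv x i j = pd i (A j) x - pd j (A i) x - (\<Sum>m\<in>UNIV. (w i j m x - w j i m x) * A m x)"

lemma spinor_curvature:
  assumes x: "x \<in> \<Omega>"
  shows "spin_conn (rho x i j) (curv x i j) (\<sigma> x)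
    = kmul (pd i a x) (pd i b x) (\<gamma> j (\<sigma> x)) - kmul (pd j a x) (pd j b x) (\<gamma> i (\<sigma> x))
      + kmul (a x) (b x) (kmul (a x) (b x) (\<gamma> j (\<gamma> i (\<sigma> x)) - \<gamma> i (\<gamma> j (\<sigma> x))))"
  unfolding rho_def[abs_def] curv_def
proof (rule killing_curvature)
  show "w i k l x = - w i l k x" for i k l by (rule w_skew[OF x])
  show "pd i \<sigma> x = kmul (a x) (b x) (\<gamma> i (\<sigma> x)) - spin_conn (\<lambda>k l. w i k l x) (A i x) (\<sigma> x)" for i
    by (rule killing[OF x])
  show "pd i (pd j \<sigma>) x - pd j (pd i \<sigma>) x = (\<Sum>l\<in>UNIV. (w i j l x - w j i l x) *\<^sub>R pd l \<sigma> x)"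
    by (rule pd_commutator[OF smooth_spinor x])
  show "pd i (pd j \<sigma>) x = kmul (a x) (b x) (\<gamma> j (pd i \<sigma> x)) + kmul (pd i a x) (pd i b x) (\<gamma> j (\<sigma> x))
      - (spin_conn (\<lambda>k l. w j k l x) (A j x) (pd i \<sigma> x)
        + spin_conn (\<lambda>k l. pd i (w j k l) x) (pd i (A j) x) (\<sigma> x))" for i j
  proof -
    \<comment> \<open>The right side of the Killing equation in direction j. It agrees with
      \<open>pd j \<sigma>\<close> on all of \<Omega>, so differentiating it gives the iterated
      derivative.\<close>
    define F where "F y = a y *\<^sub>R \<gamma> j (\<sigma> y) + b y *\<^sub>R J (\<gamma> j (\<sigma> y))
       - ((1/4) *\<^sub>R (\<Sum>k\<in>UNIV. \<Sum>l\<in>UNIV. w j k l y *\<^sub>R \<gamma> k (\<gamma> l (\<sigma> y))) + (A j y / 2) *\<^sub>R J (\<sigma> y))" for y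
    have ds: "(\<sigma> has_derivative frechet_derivative \<sigma> (at x)) (at x)"
      by (rule Csmooth_on_has_derivative[OF smooth_spinor x])
    note g = bounded_linear.has_derivative[OF bl_gam] and h = bounded_linear.has_derivative[OF bl_J]
    define s' where "s' = frechet_derivative \<sigma> (at x)"
    have "(F has_derivative (\<lambda>v.
         (a x *\<^sub>R \<gamma> j (s' v) + frechet_derivative a (at x) v *\<^sub>R \<gamma> j (\<sigma> x))
         + (b x *\<^sub>R J (\<gamma> j (s' v)) + frechet_derivative b (at x) v *\<^sub>R J (\<gamma> j (\<sigma> x)))
         - ((1/4) *\<^sub>R (\<Sum>k\<in>UNIV. \<Sum>l\<in>UNIV. w j k l x *\<^sub>R \<gamma> k (\<gamma> l (s' v))
              + frechet_derivative (w j k l) (at x) v *\<^sub>R \<gamma> k (\<gamma> l (\<sigma> x)))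
            + ((A j x / 2) *\<^sub>R J (s' v) + (frechet_derivative (A j) (at x) v / 2) *\<^sub>R J (\<sigma> x))))) (at x)"
      unfolding F_def s'_def
      by (intro has_derivative_diff has_derivative_add has_derivative_scaleR has_derivative_scaleR_right
          has_derivative_sum g h ds Csmooth_on_has_derivative[OF smooth_a x] Csmooth_on_has_derivative[OF smooth_b x]
          Csmooth_on_has_derivative[OF smooth_w x] A_differentiable[OF x]
          bounded_linear.has_derivative[OF bounded_linear_divide])
    then have "(pd j \<sigma> has_derivative (\<lambda>v.
         (a x *\<^sub>R \<gamma> j (s' v) + frechet_derivative a (at x) v *\<^sub>R \<gamma> j (\<sigma> x))
         + (b x *\<^sub>R J (\<gamma> j (s' v)) + frechet_derivative b (at x) v *\<^sub>R J (\<gamma> j (\<sigma> x)))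
         - ((1/4) *\<^sub>R (\<Sum>k\<in>UNIV. \<Sum>l\<in>UNIV. w j k l x *\<^sub>R \<gamma> k (\<gamma> l (s' v))
              + frechet_derivative (w j k l) (at x) v *\<^sub>R \<gamma> k (\<gamma> l (\<sigma> x)))
            + ((A j x / 2) *\<^sub>R J (s' v) + (frechet_derivative (A j) (at x) v / 2) *\<^sub>R J (\<sigma> x))))) (at x)"
      by (rule has_derivative_transform_within_open[OF _ open_domain x])
         (simp add: F_def killing kmul_def spin_conn_def)
    from pd_eqI[OF this, of i] show ?thesis
      by (simp add: s'_def kmul_def spin_conn_def sum.distrib scaleR_add_right)
  qed
qed

lemma rho_skew2: "x \<in> \<Omega> \<Longrightarrow> rho x i j k l = - rho x i j l k"
proof -
  assume x: "x \<in> \<Omega>"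
  have d: "pd i (w j k l) x = - pd i (w j l k) x" for i j k l
  proof -
    have "((\<lambda>y. - w j l k y) has_derivative (\<lambda>v. - frechet_derivative (w j l k) (at x) v)) (at x)"
      by (intro has_derivative_minus Csmooth_on_has_derivative[OF smooth_w x])
    then have "(w j k l has_derivative (\<lambda>v. - frechet_derivative (w j l k) (at x) v)) (at x)"
      by (rule has_derivative_transform_within_open[OF _ open_domain x]) (simp add: w_skew[of _ j k l])
    then show ?thesis by (rule pd_eqI)
  qed
  have "(\<Sum>m\<in>UNIV. w j k m x * w i m l x + w j m l x * w i m k x)
      = - (\<Sum>m\<in>UNIV. w j l m x * w i m k x + w j m k x * w i m l x)"
    unfolding sum_negf[symmetric]
    by (intro sum.cong refl) (subst w_skew[OF x, of j k], subst w_skew[OF x, of j _ l], simp)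
  moreover have "(\<Sum>m\<in>UNIV. (w i j m x - w j i m x) * w m k l x)
      = - (\<Sum>m\<in>UNIV. (w i j m x - w j i m x) * w m l k x)"
    unfolding sum_negf[symmetric] by (intro sum.cong refl) (subst w_skew[OF x, of _ k l], simp)
  ultimately show ?thesis using d[of j k l i] d[of i k l j] unfolding rho_def by simp
qed

lemma rho_skew1: "x \<in> \<Omega> \<Longrightarrow> rho x i j k l = - rho x j i k l"
proof -
  assume x: "x \<in> \<Omega>"
  have "(\<Sum>m\<in>UNIV. w j k m x * w i m l x + w j m l x * w i m k x)
      = - (\<Sum>m\<in>UNIV. w i k m x * w j m l x + w i m l x * w j m k x)"
    unfolding sum_negf[symmetric]
    by (intro sum.cong refl) (subst w_skew[OF x, of j k], subst w_skew[OF x, of i _ k], simp)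
  moreover have "(\<Sum>m\<in>UNIV. (w i j m x - w j i m x) * w m k l x)
      = - (\<Sum>m\<in>UNIV. (w j i m x - w i j m x) * w m k l x)"
    unfolding sum_negf[symmetric] by (intro sum.cong refl) (simp add: algebra_simps)
  ultimately show ?thesis unfolding rho_def by simp
qed

lemma rho_bianchi: "x \<in> \<Omega> \<Longrightarrow> rho x i j k l + rho x j k i l + rho x k i j l = 0"
  unfolding rho_def
  by (rule bianchi_from_jacobi[of "\<lambda>i k l. w i k l x"]) (erule w_skew, erule jacobi)

text \<open>A skew endomorphism pairs to zero with the spinor. On the other side the terms with da
  vanish, those with db give \<eta>, and K^2 gives \<omega>.\<close>

lemma omega_decomposition:
  assumes x: "x \<in> \<Omega>"
  shows "4 * a x * b x * omega (\<sigma> x) i j = pd i b x * eta (\<sigma> x) j - pd j b x * eta (\<sigma> x) i"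
proof -
  let ?s = "\<sigma> x"
  have "inner (spin_conn (rho x i j) (curv x i j) ?s) ?s = 0"
    using spin_conn_skew[of "rho x i j" "curv x i j" ?s ?s, OF rho_skew2[OF x]] by (simp add: inner_commute)
  then show ?thesis
    unfolding spinor_curvature[OF x]
    by (simp only: inner_add_left inner_diff_left inner_kmul_gam_commutator)
       (simp add: kmul_def inner_add_left inner_gam_self inner_J_gam)
qed

end

section \<open>Propagation of zeros\<close>

context local_killing_spinor begin

text \<open>The connection and real multiples of a generator are skew and do not change the norm;
  only b does, and a generator is an isometry.\<close>

lemma norm_sq_derivative_bound:
  assumes x: "x \<in> \<Omega>"
  shows "\<bar>pd k (\<lambda>y. inner (\<sigma> y) (\<sigma> y)) x\<bar> \<le> 2 * \<bar>b x\<bar> * inner (\<sigma> x) (\<sigma> x)"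
proof -
  have ds: "(\<sigma> has_derivative frechet_derivative \<sigma> (at x)) (at x)"
    by (rule Csmooth_on_has_derivative[OF smooth_spinor x])
  have "inner (spin_conn (\<lambda>j l. w k j l x) (A k x) (\<sigma> x)) (\<sigma> x) = 0"
    using spin_conn_skew[of "\<lambda>j l. w k j l x" "A k x" "\<sigma> x" "\<sigma> x", OF w_skew[OF x]] by (simp add: inner_commute)
  then have "inner (pd k \<sigma> x) (\<sigma> x) = b x * inner (J (\<gamma> k (\<sigma> x))) (\<sigma> x)"
    unfolding killing[OF x] by (simp add: kmul_def inner_diff_left inner_add_left inner_gam_self)
  then have "pd k (\<lambda>y. inner (\<sigma> y) (\<sigma> y)) x = 2 * b x * inner (J (\<gamma> k (\<sigma> x))) (\<sigma> x)"
    using pd_eqI[OF has_derivative_inner[OF ds ds], of k] by (simp add: inner_commute)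
  then have "\<bar>pd k (\<lambda>y. inner (\<sigma> y) (\<sigma> y)) x\<bar> = 2 * \<bar>b x\<bar> * \<bar>inner (J (\<gamma> k (\<sigma> x))) (\<sigma> x)\<bar>"
    by (simp add: abs_mult)
  also have "\<dots> \<le> 2 * \<bar>b x\<bar> * (norm (J (\<gamma> k (\<sigma> x))) * norm (\<sigma> x))"
    by (intro mult_left_mono Cauchy_Schwarz_ineq2) auto
  finally show ?thesis by (simp add: norm_J norm_gam dot_square_norm power2_eq_square)
qed

text \<open>Gronwall along segments: \<open>|d |\<sigma>|\<^sup>2| \<le> M |\<sigma>|\<^sup>2\<close> near the given zero.\<close>

lemma zero_set_open:
  assumes x0: "x0 \<in> \<Omega>" and z: "\<sigma> x0 = 0"
  shows "\<exists>r>0. ball x0 r \<subseteq> \<Omega> \<and> (\<forall>y\<in>ball x0 r. \<sigma> y = 0)"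
proof -
  define f where "f y = inner (\<sigma> y) (\<sigma> y)" for y
  have f: "(f has_derivative frechet_derivative f (at x)) (at x)" if "x \<in> \<Omega>" for x
    unfolding frechet_derivative_works[symmetric] f_def
    by (intro differentiable_inner differentiableI[OF Csmooth_on_has_derivative[OF smooth_spinor that]])
  have f0: "f y \<ge> 0" for y by (simp add: f_def)
  \<comment> \<open>The bound holds along the frame at \<open>x\<close>. Fixed coefficients from
    \<open>x0\<close> express the coordinate directions, and replacing \<open>E l x0\<close> by
    \<open>E l x\<close> costs an error controlled by continuity.\<close>
  have "\<exists>c. axis m 1 = (\<Sum>l\<in>UNIV. c l *\<^sub>R E l x0)" for m :: 'n
    using frame_spans[OF x0] by metis
  then obtain c where c: "\<And>m. axis m 1 = (\<Sum>l\<in>UNIV. c m l *\<^sub>R E l x0)" by metis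
  define Cc where "Cc = (\<Sum>m\<in>UNIV. \<Sum>l\<in>UNIV. \<bar>c m l\<bar>)"
  have Cc: "Cc \<ge> 0" unfolding Cc_def by (intro sum_nonneg) auto
  \<comment> \<open>Chosen so that \<open>Cc * e\<close> is at most 1/2 and the error can be
    absorbed into \<open>T\<close>.\<close>
  define e where "e = 1 / (2 * (Cc + 1))"
  have e: "e > 0" using Cc by (simp add: e_def)
  have "\<exists>d>0. \<forall>x. dist x x0 < d \<longrightarrow> norm (E l x0 - E l x) < e" for l
  proof -
    have "continuous (at x0) (E l)"
      using Csmooth_on_continuous[OF smooth_frame] open_domain x0 continuous_on_eq_continuous_at by blast
    then obtain d where "d > 0" "\<And>x. dist x x0 < d \<Longrightarrow> dist (E l x) (E l x0) < e"
      using e unfolding continuous_at_eps_delta by blast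
    then show ?thesis by (auto simp: dist_norm norm_minus_commute)
  qed
  then obtain d where d: "\<And>l. d l > 0" "\<And>l x. dist x x0 < d l \<Longrightarrow> norm (E l x0 - E l x) < e" by metis
  have "continuous (at x0) b"
    using Csmooth_on_continuous[OF smooth_b] open_domain x0 continuous_on_eq_continuous_at by blast
  then obtain db where db: "db > 0" "\<And>x. dist x x0 < db \<Longrightarrow> dist (b x) (b x0) < 1"
    unfolding continuous_at_eps_delta using zero_less_one by blast
  obtain d\<Omega> where d\<Omega>: "d\<Omega> > 0" "ball x0 d\<Omega> \<subseteq> \<Omega>" using open_domain x0 open_contains_ball by blast
  define r where "r = min d\<Omega> (min db (Min (range d)))"
  have r: "r > 0" using d db d\<Omega> by (auto simp: r_def)
  have near: "x \<in> \<Omega>" "\<bar>b x\<bar> \<le> \<bar>b x0\<bar> + 1" "\<And>l. norm (E l x0 - E l x) < e" if "x \<in> ball x0 r" for x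
  proof -
    have dd: "dist x x0 < r" using that by (simp add: dist_commute)
    then show "x \<in> \<Omega>" using d\<Omega>(2) by (auto simp: r_def dist_commute)
    have "dist (b x) (b x0) < 1" using dd by (intro db(2)) (simp add: r_def)
    then show "\<bar>b x\<bar> \<le> \<bar>b x0\<bar> + 1" by (simp add: dist_real_def)
    show "norm (E l x0 - E l x) < e" for l
    proof (rule d(2))
      have "r \<le> d l" unfolding r_def by (intro min.coboundedI2 Min_le) auto
      then show "dist x x0 < d l" using dd by simp
    qed
  qed
  \<comment> \<open>Absorbing half of \<open>T\<close> doubles the constant
    \<open>2 * Cc * (\<bar>b x0\<bar> + 1)\<close>.\<close>
  define M where "M = 4 * Cc * (\<bar>b x0\<bar> + 1)"
  have bound: "\<bar>frechet_derivative f (at x) u\<bar> \<le> norm u * (M * f x)" if xr: "x \<in> ball x0 r" for x u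
  proof -
    note x = near(1)[OF xr]
    define F where "F = frechet_derivative f (at x)"
    have lin: "linear F" unfolding F_def by (rule has_derivative_linear[OF f[OF x]])
    define T where "T = (\<Sum>m\<in>UNIV. \<bar>F (axis m 1)\<bar>)"
    have T0: "T \<ge> 0" unfolding T_def by (intro sum_nonneg) auto
    have FT: "\<bar>F u\<bar> \<le> norm u * T" for u
    proof -
      have "F u = (\<Sum>m\<in>UNIV. u $ m *\<^sub>R F (axis m 1))"
        using basis_expansion[of u] linear_sum[OF lin, of "\<lambda>m. u $ m *\<^sub>R axis m 1" UNIV]
        by (simp add: scalar_mult_eq_scaleR linear_scale[OF lin])
      then have "\<bar>F u\<bar> \<le> (\<Sum>m\<in>UNIV. \<bar>u $ m\<bar> * \<bar>F (axis m 1)\<bar>)"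
        by (metis (no_types, lifting) abs_mult real_scaleR_def sum.cong sum_abs)
      also have "\<dots> \<le> (\<Sum>m\<in>UNIV. norm u * \<bar>F (axis m 1)\<bar>)"
        by (intro sum_mono mult_right_mono component_le_norm_cart) auto
      finally show ?thesis by (simp add: T_def sum_distrib_left)
    qed
    have "\<bar>F (axis m 1)\<bar> \<le> (\<Sum>l\<in>UNIV. \<bar>c m l\<bar> * (2 * (\<bar>b x0\<bar> + 1) * f x + e * T))" for m
    proof -
      have "F (axis m 1) = (\<Sum>l\<in>UNIV. c m l * (F (E l x) + F (E l x0 - E l x)))"
        by (simp add: c linear_sum[OF lin] linear_scale[OF lin] linear_add[OF lin, symmetric])
      also have "\<bar>\<dots>\<bar> \<le> (\<Sum>l\<in>UNIV. \<bar>c m l\<bar> * \<bar>F (E l x) + F (E l x0 - E l x)\<bar>)"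
        by (rule order_trans[OF sum_abs]) (simp add: abs_mult)
      also have "\<dots> \<le> (\<Sum>l\<in>UNIV. \<bar>c m l\<bar> * (2 * (\<bar>b x0\<bar> + 1) * f x + e * T))"
      proof (intro sum_mono mult_left_mono)
        fix l
        have "\<bar>F (E l x)\<bar> \<le> 2 * \<bar>b x\<bar> * f x"
          using norm_sq_derivative_bound[OF x, of l] unfolding F_def f_def[abs_def] by simp
        also have "\<dots> \<le> 2 * (\<bar>b x0\<bar> + 1) * f x"
          using near(2)[OF xr] f0[of x] by (intro mult_right_mono) auto
        finally have "\<bar>F (E l x)\<bar> \<le> 2 * (\<bar>b x0\<bar> + 1) * f x" .
        moreover have "\<bar>F (E l x0 - E l x)\<bar> \<le> e * T"
          by (rule order_trans[OF FT mult_right_mono]) (use near(3)[OF xr, of l] T0 in auto)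
        ultimately show "\<bar>F (E l x) + F (E l x0 - E l x)\<bar> \<le> 2 * (\<bar>b x0\<bar> + 1) * f x + e * T" by linarith
      qed auto
      finally show ?thesis .
    qed
    then have "T \<le> (\<Sum>m\<in>UNIV. \<Sum>l\<in>UNIV. \<bar>c m l\<bar> * (2 * (\<bar>b x0\<bar> + 1) * f x + e * T))"
      unfolding T_def by (rule sum_mono)
    also have "\<dots> = Cc * (2 * (\<bar>b x0\<bar> + 1) * f x) + Cc * e * T"
      unfolding Cc_def by (simp add: sum_distrib_right distrib_left sum.distrib mult.assoc)
    also have "Cc * e * T \<le> (1 / 2) * T"
    proof (rule mult_right_mono[OF _ T0])
      show "Cc * e \<le> 1 / 2" using Cc by (simp add: e_def field_simps)
    qed
    finally have "T \<le> M * f x" by (simp add: M_def algebra_simps)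
    then have "norm u * T \<le> norm u * (M * f x)" by (intro mult_left_mono) auto
    then show ?thesis using FT[of u] unfolding F_def by linarith
  qed
  have "\<sigma> y = 0" if y: "y \<in> ball x0 r" for y
  proof -
    define h where "h t = f (x0 + t *\<^sub>R (y - x0))" for t
    define L where "L = norm (y - x0) * M"
    have seg: "x0 + t *\<^sub>R (y - x0) \<in> ball x0 r" if "0 \<le> t" "t \<le> 1" for t
    proof -
      have "dist x0 (x0 + t *\<^sub>R (y - x0)) = t * norm (y - x0)" using that by (simp add: dist_norm)
      also have "\<dots> \<le> 1 * norm (y - x0)" using that by (intro mult_right_mono) auto
      also have "\<dots> < r" using y by (simp add: dist_norm norm_minus_commute)
      finally show ?thesis by simp
    qed
    define h' where "h' t = frechet_derivative f (at (x0 + t *\<^sub>R (y - x0))) (y - x0)" for t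
    have h: "(h has_real_derivative h' t) (at t)" if "0 \<le> t" "t \<le> 1" for t
      unfolding h_def h'_def by (rule has_derivative_line[OF f[OF near(1)[OF seg[OF that]]]])
    have h'_le: "h' t \<le> L * h t" if "0 \<le> t" "t \<le> 1" for t
      using bound[OF seg[OF that], of "y - x0"] unfolding h'_def h_def L_def by simp
    \<comment> \<open>The integrating factor makes the product nonincreasing, and it starts at 0
      because of the zero at \<open>x0\<close>.\<close>
    have "h 1 * exp (- L * 1) \<le> h 0 * exp (- L * 0)"
    proof (rule DERIV_nonpos_imp_nonincreasing[where f = "\<lambda>t. h t * exp (- L * t)"])
      fix t :: real assume t: "0 \<le> t" "t \<le> 1"
      have "((\<lambda>t. h t * exp (- L * t)) has_real_derivative (h' t - L * h t) * exp (- L * t)) (at t)"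
        by (auto intro!: derivative_eq_intros h[OF t] simp: algebra_simps)
      moreover have "(h' t - L * h t) * exp (- L * t) \<le> 0"
        using h'_le[OF t] by (intro mult_nonpos_nonneg) auto
      ultimately show "\<exists>y. ((\<lambda>t. h t * exp (- L * t)) has_real_derivative y) (at t) \<and> y \<le> 0" by blast
    qed simp
    then have "h 1 \<le> 0" using z by (simp add: h_def f_def mult_le_0_iff)
    then have "f y = 0" using f0[of y] by (simp add: h_def)
    then show ?thesis by (simp add: f_def)
  qed
  then show ?thesis using near(1) r by blast
qed

end

section \<open>Vanishing of a b and constancy of a, locally\<close>

context nonvanishing_killing_spinor begin

lemma has_derivative_eta:
  assumes x: "x \<in> \<Omega>"
  shows "((\<lambda>y. eta (\<sigma> y) j) has_derivative frechet_derivative (\<lambda>y. eta (\<sigma> y) j) (at x)) (at x)" (is ?A)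
    and "pd k (\<lambda>y. eta (\<sigma> y) j) x
      = (if k = j then - 2 * b x * inner (\<sigma> x) (\<sigma> x) else 0) + 2 * a x * omega (\<sigma> x) j k
        + (\<Sum>l\<in>UNIV. w k j l x * eta (\<sigma> x) l)" (is ?B)
proof -
  have ds: "(\<sigma> has_derivative frechet_derivative \<sigma> (at x)) (at x)"
    by (rule Csmooth_on_has_derivative[OF smooth_spinor x])
  note d = has_derivative_inner[OF bounded_linear.has_derivative[OF bl_gam[of j] ds]
      bounded_linear.has_derivative[OF bl_J ds], folded eta_def]
  show ?A unfolding frechet_derivative_works[symmetric] using d by (rule differentiableI)
  show ?B
    using pd_eqI[OF d, of k] eta_transport[of "\<lambda>j l. w k j l x" "pd k \<sigma> x", OF w_skew[OF x] killing[OF x], of j]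
    by (simp add: add.commute)
qed

lemma has_derivative_omega:
  assumes x: "x \<in> \<Omega>"
  shows "((\<lambda>y. omega (\<sigma> y) i j) has_derivative frechet_derivative (\<lambda>y. omega (\<sigma> y) i j) (at x)) (at x)" (is ?A)
    and "pd k (\<lambda>y. omega (\<sigma> y) i j) x
      = 2 * b x * tau (\<sigma> x) k i j
        + 2 * a x * ((if i = k then eta (\<sigma> x) j else 0) - (if j = k then eta (\<sigma> x) i else 0))
        + (\<Sum>l\<in>UNIV. w k i l x * omega (\<sigma> x) l j + w k j l x * omega (\<sigma> x) i l)" (is ?B)
proof -
  have ds: "(\<sigma> has_derivative frechet_derivative \<sigma> (at x)) (at x)"
    by (rule Csmooth_on_has_derivative[OF smooth_spinor x])
  note d = has_derivative_inner[OF bounded_linear.has_derivative[OF bl_gam[of i]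
        bounded_linear.has_derivative[OF bl_gam[of j] ds]]
      bounded_linear.has_derivative[OF bl_J ds], folded omega_def]
  show ?A unfolding frechet_derivative_works[symmetric] using d by (rule differentiableI)
  show ?B
    using pd_eqI[OF d, of k] omega_transport[of "\<lambda>j l. w k j l x" "pd k \<sigma> x", OF w_skew[OF x] killing[OF x], of i j]
    by (simp add: add.commute)
qed

lemma omega_vanishes:
  assumes dim: "CARD('n) \<ge> 4" and x: "x \<in> \<Omega>" and ab: "a x \<noteq> 0" "b x \<noteq> 0"
  shows "omega (\<sigma> x) i j = 0"
proof -
  define s where "s = \<sigma> x"
  \<comment> \<open>The covariant Hessian of \<open>b\<close>, symmetric because the connection has
    no torsion.\<close>
  define h where "h k i = pd k (pd i b) x - (\<Sum>l\<in>UNIV. w k i l x * pd l b x)" for k i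
  have da: "(a has_derivative frechet_derivative a (at x)) (at x)"
    and db: "(b has_derivative frechet_derivative b (at x)) (at x)"
    using Csmooth_on_has_derivative[OF _ x] smooth_a smooth_b by blast+
  show ?thesis
  proof (rule decomposable_form_vanishes[where \<omega> = "omega (\<sigma> x)" and a = "a x" and b = "b x"
        and \<alpha> = "\<chi> i. pd i a x" and \<beta> = "\<chi> i. pd i b x" and \<eta> = "\<chi> i. eta (\<sigma> x) i"
        and f = "inner (\<sigma> x) (\<sigma> x)" and h = h and \<tau> = "tau (\<sigma> x)"])
    show "CARD('n) \<ge> 4" by (rule dim)
    show "a x \<noteq> 0" "b x \<noteq> 0" by (rule ab)+
    show "inner (\<sigma> x) (\<sigma> x) \<noteq> 0" using nonvanishing[OF x] by simp
    show "omega (\<sigma> x) i j = - omega (\<sigma> x) j i" for i j by (rule omega_antisym)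
    show "h i j = h j i" for i j
      using pd_commutator[OF smooth_b x, of i j] by (simp add: h_def left_diff_distrib sum_subtractf)
    show "tau (\<sigma> x) i j k = tau (\<sigma> x) j k i" for i j k using tau_cyclic[of "\<sigma> x" j k i] by simp
    show "4 * a x * b x * omega (\<sigma> x) i j
        = (\<chi> i. pd i b x) $ i * (\<chi> i. eta (\<sigma> x) i) $ j - (\<chi> i. pd i b x) $ j * (\<chi> i. eta (\<sigma> x) i) $ i" for i j
      using omega_decomposition[OF x] by simp
    fix k i j
    define om where "om = frechet_derivative (\<lambda>y. omega (\<sigma> y) i j) (at x)"
    define et where "et j = frechet_derivative (\<lambda>y. eta (\<sigma> y) j) (at x)" for j
    have 1: "((\<lambda>y. (4 * (a y * b y)) * omega (\<sigma> y) i j) has_derivative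
       (\<lambda>v. 4 * (a x * b x) * om v
         + 4 * (a x * frechet_derivative b (at x) v + frechet_derivative a (at x) v * b x) * omega (\<sigma> x) i j)) (at x)"
      unfolding om_def
      by (intro has_derivative_mult has_derivative_mult_right da db has_derivative_omega(1)[OF x])
    have 2: "((\<lambda>y. pd i b y * eta (\<sigma> y) j - pd j b y * eta (\<sigma> y) i) has_derivative
       (\<lambda>v. (pd i b x * et j v + frechet_derivative (pd i b) (at x) v * eta (\<sigma> x) j)
         - (pd j b x * et i v + frechet_derivative (pd j b) (at x) v * eta (\<sigma> x) i))) (at x)"
      unfolding et_def
      by (intro has_derivative_mult has_derivative_diff pd_has_derivative[OF smooth_b x] has_derivative_eta(1)[OF x])
    \<comment> \<open>The decomposition holds throughout \<Omega>, so both sides are the same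
      function near \<open>x\<close> and may be differentiated alike.\<close>
    have 3: "((\<lambda>y. (4 * (a y * b y)) * omega (\<sigma> y) i j) has_derivative
       (\<lambda>v. (pd i b x * et j v + frechet_derivative (pd i b) (at x) v * eta (\<sigma> x) j)
         - (pd j b x * et i v + frechet_derivative (pd j b) (at x) v * eta (\<sigma> x) i))) (at x)"
      by (rule has_derivative_transform_within_open[OF 2 open_domain x])
         (use omega_decomposition in \<open>simp add: mult.assoc\<close>)
    define W where "W i j = (\<Sum>l\<in>UNIV. w k i l x * omega s l j + w k j l x * omega s i l)" for i j
    define V where "V i = (\<Sum>l\<in>UNIV. w k i l x * eta s l)" for i
    define U where "U i = (\<Sum>l\<in>UNIV. w k i l x * pd l b x)" for i
    have main: "4 * (a x * b x) * (2 * b x * tau s k i j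
          + 2 * a x * ((if i = k then eta s j else 0) - (if j = k then eta s i else 0)) + W i j)
        + 4 * (a x * pd k b x + pd k a x * b x) * omega s i j
      = (pd i b x * ((if k = j then - 2 * b x * inner s s else 0) + 2 * a x * omega s j k + V j)
            + pd k (pd i b) x * eta s j)
        - (pd j b x * ((if k = i then - 2 * b x * inner s s else 0) + 2 * a x * omega s i k + V i)
            + pd k (pd j b) x * eta s i)"
      using fun_cong[OF has_derivative_unique[OF 1 3], of "E k x"]
      unfolding om_def et_def has_derivative_omega(2)[OF x] has_derivative_eta(2)[OF x]
        s_def[symmetric] W_def[symmetric] V_def[symmetric] .
    \<comment> \<open>Using the decomposition once more inside the connection terms leaves exactly
      the terms that turn plain derivatives of db and \<eta> into covariant ones, so that
      \<open>main\<close> becomes tensorial.\<close>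
    have WUV: "4 * (a x * b x) * W i j = U i * eta s j - U j * eta s i + pd i b x * V j - pd j b x * V i"
    proof -
      have "4 * (a x * b x) * W i j = (\<Sum>l\<in>UNIV. w k i l x * (4 * a x * b x * omega s l j)
          + w k j l x * (4 * a x * b x * omega s i l))"
        by (simp add: W_def sum_distrib_left algebra_simps)
      also have "\<dots> = U i * eta s j - U j * eta s i + pd i b x * V j - pd j b x * V i"
        unfolding s_def omega_decomposition[OF x] U_def V_def
        by (simp only: sum_distrib_left sum_distrib_right sum.distrib[symmetric] sum_subtractf[symmetric])
           (intro sum.cong refl, simp add: algebra_simps)
      finally show ?thesis .
    qed
    have hU: "h k i = pd k (pd i b) x - U i" "h k j = pd k (pd j b) x - U j"
      by (simp_all add: h_def U_def)
    show "4 * (b x * (\<chi> i. pd i a x) $ k + a x * (\<chi> i. pd i b x) $ k) * omega (\<sigma> x) i j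
        + 8 * a x * (b x)^2 * tau (\<sigma> x) k i j
        + 8 * (a x)^2 * b x * ((if i = k then (\<chi> i. eta (\<sigma> x) i) $ j else 0) - (if j = k then (\<chi> i. eta (\<sigma> x) i) $ i else 0))
      = h k i * (\<chi> i. eta (\<sigma> x) i) $ j - h k j * (\<chi> i. eta (\<sigma> x) i) $ i
        + (\<chi> i. pd i b x) $ i * ((if k = j then - 2 * b x * inner (\<sigma> x) (\<sigma> x) else 0) + 2 * a x * omega (\<sigma> x) j k)
        - (\<chi> i. pd i b x) $ j * ((if k = i then - 2 * b x * inner (\<sigma> x) (\<sigma> x) else 0) + 2 * a x * omega (\<sigma> x) i k)"
      using main WUV unfolding s_def[symmetric] vec_lambda_beta hU by algebra
  qed
qed

lemma real_times_imaginary_zero: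
  assumes dim: "CARD('n) \<ge> 4" and x0: "x0 \<in> \<Omega>"
  shows "a x0 * b x0 = 0"
proof (rule ccontr)
  assume nz: "a x0 * b x0 \<noteq> 0"
  \<comment> \<open>An open set, because the vanishing of \<omega> and then of \<eta> has to be
    differentiated.\<close>
  define N where "N = {x \<in> \<Omega>. a x * b x \<noteq> 0}"
  have ab: "a x \<noteq> 0" "b x \<noteq> 0" and N\<Omega>: "x \<in> \<Omega>" if "x \<in> N" for x
    using that by (auto simp: N_def)
  have "continuous_on \<Omega> (\<lambda>x. a x * b x)"
    by (intro continuous_on_mult Csmooth_on_continuous smooth_a smooth_b)
  then have "open (\<Omega> \<inter> (\<lambda>x. a x * b x) -` (- {0}))"
    by (intro continuous_open_preimage open_domain) auto
  moreover have "\<Omega> \<inter> (\<lambda>x. a x * b x) -` (- {0}) = N" by (auto simp: N_def)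
  ultimately have open_N: "open N" by simp
  have x0: "x0 \<in> N" using nz x0 by (simp add: N_def)
  have zero_pd: "pd k f x = 0" if "x \<in> N" "\<And>y. y \<in> N \<Longrightarrow> f y = 0" for f :: "real^'n \<Rightarrow> real" and k x
  proof -
    have "((\<lambda>y. 0) has_derivative (\<lambda>v. 0)) (at x)" by simp
    then have "(f has_derivative (\<lambda>v. 0)) (at x)"
      by (rule has_derivative_transform_within_open[OF _ open_N that(1)]) (simp add: that(2))
    then show ?thesis by (rule pd_eqI)
  qed
  have om: "omega (\<sigma> y) i j = 0" if "y \<in> N" for y i j
    by (rule omega_vanishes[OF dim N\<Omega>[OF that] ab[OF that]])
  have et: "eta (\<sigma> y) j = 0" if y: "y \<in> N" for y j
  proof -
    have "\<exists>k. k \<noteq> j"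
    proof (rule ccontr)
      assume "\<nexists>k. k \<noteq> j"
      then have "(UNIV :: 'n set) = {j}" by auto
      then have "CARD('n) = 1" by (metis card_1_singleton_iff One_nat_def)
      then show False using dim by simp
    qed
    then obtain k where "k \<noteq> j" by blast
    \<comment> \<open>Repeating the index \<open>k\<close> kills \<tau> by \<open>tau_diag\<close>,
      and with \<open>k\<close> different from \<open>j\<close> only 2 a \<eta> in direction
      \<open>j\<close> is left.\<close>
    have "pd k (\<lambda>y. omega (\<sigma> y) k j) y = 0" by (rule zero_pd[OF y om])
    then show ?thesis
      unfolding has_derivative_omega(2)[OF N\<Omega>[OF y]]
      using \<open>k \<noteq> j\<close> ab[OF y] by (simp add: om[OF y] tau_diag)
  qed
  fix k :: 'n
  have "pd k (\<lambda>y. eta (\<sigma> y) k) x0 = 0" by (rule zero_pd[OF x0 et])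
  then show False
    unfolding has_derivative_eta(2)[OF N\<Omega>[OF x0]]
    using ab[OF x0] nonvanishing[OF N\<Omega>[OF x0]] by (simp add: om[OF x0] et[OF x0])
qed

lemma real_part_locally_constant:
  assumes dim: "CARD('n) \<ge> 4" and b0: "\<And>y. y \<in> \<Omega> \<Longrightarrow> b y = 0" and x: "x \<in> \<Omega>"
  shows "frechet_derivative a (at x) v = 0"
proof -
  define s where "s = \<sigma> x"
  define n where "n = real CARD('n)"
  \<comment> \<open>The factor -1/2 is the 1/4 of the spin connection times the -2 of
    \<open>ricci_contraction\<close>. The scalar part of the Killing side is moved here; its
    coefficient is (n - 2) + n, from the two orders of the generators.\<close>
  define r where "r k l = - (1/2) * (\<Sum>i\<in>UNIV. rho x i k i l) - (if k = l then (2 * n - 2) * (a x)^2 else 0)" for k l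
  have db: "pd i b x = 0" for i
  proof -
    have "((\<lambda>y. 0) has_derivative (\<lambda>v. 0)) (at x)" by simp
    then have "(b has_derivative (\<lambda>v. 0)) (at x)"
      by (rule has_derivative_transform_within_open[OF _ open_domain x]) (simp add: b0)
    then show ?thesis by (rule pd_eqI)
  qed
  have "(\<chi> i. pd i a x) = 0"
  proof (rule ricci_spinor_equation_imp_zero[OF dim, of s r "\<lambda>i j. (1/2) * curv x i j"])
    show "s \<noteq> 0" unfolding s_def by (rule nonvanishing[OF x])
    show "r k l = r l k" for k l
      using bianchi_pair_symmetry[of "rho x", OF rho_skew1[OF x] rho_skew2[OF x] rho_bianchi[OF x]]
      by (auto simp: r_def intro!: sum.cong)
    show "1 / 2 * curv x k l = - (1 / 2 * curv x l k)" for k l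
      by (simp add: curv_def sum_negf[symmetric] algebra_simps sum_subtractf)
    fix j
    have K: "kmul p 0 v = p *\<^sub>R v" for p v by (simp add: kmul_def)
    \<comment> \<open>With b = 0 both K and dK act by real scalars. The Clifford trace over
      \<open>i\<close> is computed from this side and again from the curvature side.\<close>
    have "(\<Sum>i\<in>UNIV. \<gamma> i (spin_conn (rho x i j) (curv x i j) s))
      = (\<Sum>i\<in>UNIV. \<gamma> i (pd i a x *\<^sub>R \<gamma> j s - pd j a x *\<^sub>R \<gamma> i s
          + (a x)^2 *\<^sub>R (\<gamma> j (\<gamma> i s) - \<gamma> i (\<gamma> j s))))"
      unfolding s_def spinor_curvature[OF x] db b0[OF x] K by (simp add: power2_eq_square)
    also have "\<dots> = cl (\<chi> i. pd i a x) (\<gamma> j s) + (n * pd j a x) *\<^sub>R s + ((2 * n - 2) * (a x)^2) *\<^sub>R \<gamma> j s"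
    proof -
      have "(\<Sum>i\<in>UNIV. \<gamma> i (\<gamma> j (\<gamma> i s))) = (n - 2) *\<^sub>R \<gamma> j s"
        using sum_gam_cl_gam[of "axis j 1" s] by (simp add: cl_axis n_def)
      moreover have "(\<Sum>i\<in>UNIV. \<gamma> i (pd i a x *\<^sub>R \<gamma> j s - pd j a x *\<^sub>R \<gamma> i s
          + (a x)^2 *\<^sub>R (\<gamma> j (\<gamma> i s) - \<gamma> i (\<gamma> j s))))
        = cl (\<chi> i. pd i a x) (\<gamma> j s) - pd j a x *\<^sub>R (\<Sum>i\<in>UNIV. \<gamma> i (\<gamma> i s))
          + (a x)^2 *\<^sub>R ((\<Sum>i\<in>UNIV. \<gamma> i (\<gamma> j (\<gamma> i s))) - (\<Sum>i\<in>UNIV. \<gamma> i (\<gamma> i (\<gamma> j s))))"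
        by (simp add: cl_def gam_lin sum.distrib sum_subtractf scaleR_sum_right scaleR_diff_right)
      ultimately show ?thesis
        unfolding sum_gam_gam n_def[symmetric]
        by (simp add: scaleR_diff_right[symmetric] scaleR_add_left[symmetric] mult.commute)
    qed
    finally have rhs: "(\<Sum>i\<in>UNIV. \<gamma> i (spin_conn (rho x i j) (curv x i j) s))
       = cl (\<chi> i. pd i a x) (\<gamma> j s) + (n * pd j a x) *\<^sub>R s + ((2 * n - 2) * (a x)^2) *\<^sub>R \<gamma> j s" .
    have "(\<Sum>i\<in>UNIV. \<gamma> i (spin_conn (rho x i j) (curv x i j) s))
       = (1/4) *\<^sub>R (\<Sum>i\<in>UNIV. \<Sum>k\<in>UNIV. \<Sum>l\<in>UNIV. rho x i j k l *\<^sub>R \<gamma> i (\<gamma> k (\<gamma> l s)))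
         + J (\<Sum>i\<in>UNIV. (1 / 2 * curv x i j) *\<^sub>R \<gamma> i s)"
      by (simp add: spin_conn_def gam_lin J_lin J_gam sum.distrib scaleR_sum_right)
    also have "\<dots> = - (1/2) *\<^sub>R (\<Sum>l\<in>UNIV. (\<Sum>i\<in>UNIV. rho x i j i l) *\<^sub>R \<gamma> l s)
         + J (\<Sum>i\<in>UNIV. (1 / 2 * curv x i j) *\<^sub>R \<gamma> i s)"
      unfolding ricci_contraction[of "rho x", OF rho_skew1[OF x] rho_skew2[OF x] rho_bianchi[OF x]] by simp
    finally have lhs: "(\<Sum>i\<in>UNIV. \<gamma> i (spin_conn (rho x i j) (curv x i j) s))
       = - (1/2) *\<^sub>R (\<Sum>l\<in>UNIV. (\<Sum>i\<in>UNIV. rho x i j i l) *\<^sub>R \<gamma> l s)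
         + J (\<Sum>i\<in>UNIV. (1 / 2 * curv x i j) *\<^sub>R \<gamma> i s)" .
    have rs: "(\<Sum>l\<in>UNIV. r j l *\<^sub>R \<gamma> l s)
      = - (1/2) *\<^sub>R (\<Sum>l\<in>UNIV. (\<Sum>i\<in>UNIV. rho x i j i l) *\<^sub>R \<gamma> l s) - ((2 * n - 2) * (a x)^2) *\<^sub>R \<gamma> j s"
    proof -
      have "(\<Sum>l\<in>UNIV. (if j = l then (2 * n - 2) * (a x)^2 else 0) *\<^sub>R \<gamma> l s) = ((2 * n - 2) * (a x)^2) *\<^sub>R \<gamma> j s"
        by (simp add: if_distrib[of "\<lambda>r. r *\<^sub>R _"] cong: if_cong)
      then show ?thesis
        by (simp add: r_def scaleR_diff_left sum_subtractf scaleR_sum_right sum_negf)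
    qed
    show "(\<Sum>l\<in>UNIV. r j l *\<^sub>R \<gamma> l s) + J (\<Sum>i\<in>UNIV. (1 / 2 * curv x i j) *\<^sub>R \<gamma> i s)
        = cl (\<chi> i. pd i a x) (\<gamma> j s) + (real CARD('n) * (\<chi> i. pd i a x) $ j) *\<^sub>R s"
      unfolding rs diff_add_eq trans[OF lhs[symmetric] rhs] add_diff_cancel_right' by (simp add: n_def)
  qed
  then have "pd i a x = 0" for i by (simp add: vec_eq_iff)
  moreover obtain c where "v = (\<Sum>l\<in>UNIV. c l *\<^sub>R E l x)" using frame_spans[OF x] .
  ultimately show ?thesis using frechet_frame_sum[OF smooth_a x] by simp
qed

end

section \<open>Charts and tangent vectors\<close>

lemma smooth_atlasD:
  assumes "smooth_atlas \<A>"
  shows "\<exists>c\<in>\<A>. p \<in> fst c"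
    and "c \<in> \<A> \<Longrightarrow> open (fst c)" and "c \<in> \<A> \<Longrightarrow> open (snd c ` fst c)"
    and "c \<in> \<A> \<Longrightarrow> homeomorphism (fst c) (snd c ` fst c) (snd c) (chart_inv c)"
    and "c \<in> \<A> \<Longrightarrow> c' \<in> \<A> \<Longrightarrow> Csmooth_on (transition c c') (snd c ` (fst c \<inter> fst c'))"
  using assms unfolding smooth_atlas_def by (simp, blast)+

lemma chart_inv_chart: "smooth_atlas \<A> \<Longrightarrow> c \<in> \<A> \<Longrightarrow> p \<in> fst c \<Longrightarrow> chart_inv c (snd c p) = p"
  using homeomorphism_apply1[OF smooth_atlasD(4)] by blast

lemma chart_chart_inv: "smooth_atlas \<A> \<Longrightarrow> c \<in> \<A> \<Longrightarrow> x \<in> snd c ` fst c \<Longrightarrow> snd c (chart_inv c x) = x"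
  using homeomorphism_apply2[OF smooth_atlasD(4)] by blast

lemma open_chart_image:
  assumes "smooth_atlas \<A>" "c \<in> \<A>" "open W"
  shows "open (snd c ` (fst c \<inter> W))"
proof -
  have "openin (top_of_set (snd c ` fst c)) (snd c ` (fst c \<inter> W))"
    using homeomorphism_imp_open_map[OF smooth_atlasD(4)[OF assms(1,2)]] assms(3)
    by (metis openin_open_Int)
  then show ?thesis using smooth_atlasD(3)[OF assms(1,2)] openin_open_trans by blast
qed

lemma continuous_on_chart: "smooth_atlas \<A> \<Longrightarrow> c \<in> \<A> \<Longrightarrow> continuous_on (fst c) (snd c)"
  using homeomorphism_cont1[OF smooth_atlasD(4)] by blast

lemma open_chart_preimage:
  assumes "smooth_atlas \<A>" "c \<in> \<A>" "open W" "open B"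
  shows "open {p \<in> fst c \<inter> W. snd c p \<in> B}"
proof -
  have "open ((fst c \<inter> W) \<inter> snd c -` B)"
    using continuous_on_subset[OF continuous_on_chart[OF assms(1,2)], of "fst c \<inter> W"]
      smooth_atlasD(2)[OF assms(1,2)] assms(3,4)
    by (intro continuous_open_preimage) auto
  moreover have "(fst c \<inter> W) \<inter> snd c -` B = {p \<in> fst c \<inter> W. snd c p \<in> B}" by auto
  ultimately show ?thesis by simp
qed

lemma smooth_fun_continuous:
  assumes at: "smooth_atlas \<A>" and W: "open W" and f: "smooth_fun \<A> W f"
  shows "continuous_on W f"
proof -
  have "continuous_on (\<Union>c\<in>\<A>. fst c \<inter> W) f"
  proof (rule continuous_on_open_UN)
    fix c assume c: "c \<in> \<A>"
    show "open (fst c \<inter> W)" using smooth_atlasD(2)[OF at c] W by auto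
    have "continuous_on (snd c ` (fst c \<inter> W)) (f \<circ> chart_inv c)"
      using f c unfolding smooth_fun_def by (blast intro: Csmooth_on_continuous)
    then have "continuous_on (fst c \<inter> W) ((f \<circ> chart_inv c) \<circ> snd c)"
      by (rule continuous_on_compose[OF continuous_on_subset[OF continuous_on_chart[OF at c]], rotated]) auto
    then show "continuous_on (fst c \<inter> W) f"
      by (rule continuous_on_eq) (simp add: chart_inv_chart[OF at c])
  qed
  moreover have "(\<Union>c\<in>\<A>. fst c \<inter> W) = W" using smooth_atlasD(1)[OF at] by blast
  ultimately show ?thesis by simp
qed

lemma transition_has_derivative:
  assumes "smooth_atlas \<A>" "c \<in> \<A>" "c' \<in> \<A>" "p \<in> fst c \<inter> fst c'"
  shows "(transition c c' has_derivative frechet_derivative (transition c c') (at (snd c p))) (at (snd c p))"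
  using Csmooth_on_has_derivative[OF smooth_atlasD(5)[OF assms(1-3)]] assms(4) by blast

lemma tangent_spaceD:
  "v \<in> tangent_space \<A> p \<Longrightarrow> c \<in> \<A> \<Longrightarrow> c' \<in> \<A> \<Longrightarrow> p \<in> fst c \<Longrightarrow> p \<in> fst c' \<Longrightarrow>
     v c' = frechet_derivative (transition c c') (at (snd c p)) (v c)"
  unfolding tangent_space_def by blast

lemma tangent_space_eqI:
  assumes "v \<in> tangent_space \<A> p" "u \<in> tangent_space \<A> p" "c \<in> \<A>" "p \<in> fst c" "v c = u c"
  shows "v = u"
proof
  fix c'
  show "v c' = u c'"
  proof (cases "c' \<in> \<A> \<and> p \<in> fst c'")
    case True
    then show ?thesis
      using tangent_spaceD[OF assms(1,3) _ assms(4), of c'] tangent_spaceD[OF assms(2,3) _ assms(4), of c'] assms(5)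
      by simp
  next
    case False
    then have "v c' = 0" "u c' = 0" using assms(1,2) unfolding tangent_space_def by blast+
    then show ?thesis by simp
  qed
qed

lemma tangent_space_closed:
  assumes at: "smooth_atlas \<A>"
  shows "tzero \<in> tangent_space \<A> p"
    and "u \<in> tangent_space \<A> p \<Longrightarrow> v \<in> tangent_space \<A> p \<Longrightarrow> tadd u v \<in> tangent_space \<A> p"
    and "u \<in> tangent_space \<A> p \<Longrightarrow> tscale r u \<in> tangent_space \<A> p"
proof -
  have lin: "linear (frechet_derivative (transition c c') (at (snd c p)))"
    if "c \<in> \<A>" "c' \<in> \<A>" "p \<in> fst c \<inter> fst c'" for c c'
    by (rule has_derivative_linear[OF transition_has_derivative[OF at that]])
  show "tzero \<in> tangent_space \<A> p"
    unfolding tangent_space_def tzero_def using linear_0[OF lin] by simp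
  show "tadd u v \<in> tangent_space \<A> p" if u: "u \<in> tangent_space \<A> p" and v: "v \<in> tangent_space \<A> p"
    unfolding tangent_space_def tadd_def
  proof (intro CollectI conjI ballI allI impI)
    fix c c' assume c: "c \<in> \<A>" "c' \<in> \<A>" "p \<in> fst c \<inter> fst c'"
    then show "u c' + v c' = frechet_derivative (transition c c') (at (snd c p)) (u c + v c)"
      using tangent_spaceD[OF u c(1,2)] tangent_spaceD[OF v c(1,2)] linear_add[OF lin[OF c]] by simp
  next
    fix c assume "c \<notin> \<A> \<or> p \<notin> fst c"
    then have "u c = 0" "v c = 0" using u v unfolding tangent_space_def by blast+
    then show "u c + v c = 0" by simp
  qed
  show "tscale r u \<in> tangent_space \<A> p" if u: "u \<in> tangent_space \<A> p"
    unfolding tangent_space_def tscale_def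
  proof (intro CollectI conjI ballI allI impI)
    fix c c' assume c: "c \<in> \<A>" "c' \<in> \<A>" "p \<in> fst c \<inter> fst c'"
    then show "r *\<^sub>R u c' = frechet_derivative (transition c c') (at (snd c p)) (r *\<^sub>R u c)"
      using tangent_spaceD[OF u c(1,2)] linear_scale[OF lin[OF c]] by simp
  next
    fix c assume "c \<notin> \<A> \<or> p \<notin> fst c"
    then have "u c = 0" using u unfolding tangent_space_def by blast
    then show "r *\<^sub>R u c = 0" by simp
  qed
qed

text \<open>Frees \<open>dir_deriv\<close> from its arbitrarily chosen chart. The derivative is a
  hypothesis, so the function need be understood only near the point.\<close>

lemma dir_deriv_chart:
  assumes at: "smooth_atlas \<A>" and c: "c \<in> \<A>" "p \<in> fst c" and v: "v \<in> tangent_space \<A> p"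
    and D: "((f \<circ> chart_inv c) has_derivative D) (at (snd c p))"
  shows "dir_deriv \<A> f p v = D (v c)"
proof -
  define c' where "c' = (SOME c. c \<in> \<A> \<and> p \<in> fst c)"
  have "\<exists>c. c \<in> \<A> \<and> p \<in> fst c" using c by blast
  then have c': "c' \<in> \<A>" "p \<in> fst c'" unfolding c'_def by (metis (mono_tags, lifting) someI_ex)+
  define T where "T = frechet_derivative (transition c' c) (at (snd c' p))"
  have T: "(transition c' c has_derivative T) (at (snd c' p))"
    unfolding T_def by (rule transition_has_derivative[OF at c'(1) c(1)]) (use c c' in auto)
  have tp: "transition c' c (snd c' p) = snd c p"
    by (simp add: transition_def chart_inv_chart[OF at c'])
  have "(f \<circ> chart_inv c \<circ> transition c' c has_derivative D \<circ> T) (at (snd c' p))"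
    by (rule diff_chain_at[OF T]) (simp add: tp D)
  then have "(f \<circ> chart_inv c' has_derivative D \<circ> T) (at (snd c' p))"
  proof (rule has_derivative_transform_within_open)
    show "open (snd c' ` (fst c' \<inter> fst c))" by (rule open_chart_image[OF at c'(1) smooth_atlasD(2)[OF at c(1)]])
    show "snd c' p \<in> snd c' ` (fst c' \<inter> fst c)" using c c' by blast
    show "(f \<circ> chart_inv c \<circ> transition c' c) x = (f \<circ> chart_inv c') x" if "x \<in> snd c' ` (fst c' \<inter> fst c)" for x
      using that chart_inv_chart[OF at c'(1)] chart_inv_chart[OF at c(1)] by (auto simp: transition_def)
  qed
  then have "frechet_derivative (f \<circ> chart_inv c') (at (snd c' p)) = D \<circ> T"
    by (rule frechet_derivative_at[symmetric])
  moreover have "v c = T (v c')" unfolding T_def by (rule tangent_spaceD[OF v c'(1) c(1) c'(2) c(2)])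
  ultimately show ?thesis unfolding dir_deriv_def c'_def[symmetric] Let_def by simp
qed

lemma smooth_vfield_subset:
  assumes "smooth_vfield \<A> W X" "V \<subseteq> W"
  shows "smooth_vfield \<A> V X"
  unfolding smooth_vfield_def
proof (intro conjI ballI)
  show "X p \<in> tangent_space \<A> p" if "p \<in> V" for p
    using assms that unfolding smooth_vfield_def by blast
  fix c assume "c \<in> \<A>"
  then have "Csmooth_on (\<lambda>x. X (chart_inv c x) c) (snd c ` (fst c \<inter> W))"
    using assms(1) unfolding smooth_vfield_def by blast
  then show "Csmooth_on (\<lambda>x. X (chart_inv c x) c) (snd c ` (fst c \<inter> V))"
    by (rule Csmooth_on_subset) (use assms(2) in blast)
qed

lemma riemannian_metric_linear:
  assumes "riemannian_metric \<A> g"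
    and "u \<in> tangent_space \<A> p" "v \<in> tangent_space \<A> p" "x \<in> tangent_space \<A> p"
  shows "g p (tadd u v) x = g p u x + g p v x" "g p (tscale r u) x = r * g p u x" "g p u x = g p x u"
proof -
  have "\<forall>p. \<forall>u\<in>tangent_space \<A> p. \<forall>v\<in>tangent_space \<A> p. \<forall>w\<in>tangent_space \<A> p. \<forall>r.
        g p (tadd u v) w = g p u w + g p v w \<and> g p (tscale r u) w = r * g p u w \<and> g p u w = g p w u"
    using assms(1) unfolding riemannian_metric_def by (rule conjunct1)
  with assms(2-4) show "g p (tadd u v) x = g p u x + g p v x" "g p (tscale r u) x = r * g p u x" "g p u x = g p x u"
    by simp_all
qed

text \<open>The metric is linear on tangent vectors only, so tangency of the partial sums is carried
  along in the induction.\<close>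

lemma metric_sum_left:
  fixes e :: "'n::finite \<Rightarrow> ('m::topological_space, 'n) tvec"
  assumes at: "smooth_atlas \<A>" and g: "riemannian_metric \<A> g"
    and e: "\<And>l. e l \<in> tangent_space \<A> p" and u: "u \<in> tangent_space \<A> p"
  shows "(\<lambda>c. \<Sum>l\<in>I. t l *\<^sub>R e l c) \<in> tangent_space \<A> p
    \<and> g p (\<lambda>c. \<Sum>l\<in>I. t l *\<^sub>R e l c) u = (\<Sum>l\<in>I. t l * g p (e l) u)"
proof -
  have "finite I" by simp
  then show ?thesis
  proof (induction I)
    case empty
    have "g p tzero u = 0"
      using riemannian_metric_linear(2)[OF g tangent_space_closed(1)[OF at] tangent_space_closed(1)[OF at] u, of 0] by (simp add: tscale_def tzero_def)
    then show ?case using tangent_space_closed(1)[OF at] by (simp add: tzero_def)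
  next
    case (insert x F)
    have eq: "(\<lambda>c. \<Sum>l\<in>insert x F. t l *\<^sub>R e l c) = tadd (tscale (t x) (e x)) (\<lambda>c. \<Sum>l\<in>F. t l *\<^sub>R e l c)"
      using insert.hyps by (simp add: tadd_def tscale_def)
    have "tscale (t x) (e x) \<in> tangent_space \<A> p" by (rule tangent_space_closed(3)[OF at e])
    then show ?case
      unfolding eq using insert riemannian_metric_linear(1,2)[OF g _ _ u] e tangent_space_closed(2)[OF at] by simp
  qed
qed

text \<open>The positive determinant gives coefficients in one chart; as a tangent vector is
  determined by one component, they hold for the whole vector, and orthonormality identifies
  them.\<close>

lemma orthonormal_expansion:
  fixes e :: "'n::finite \<Rightarrow> ('m::topological_space, 'n) tvec"
  assumes at: "smooth_atlas \<A>" and g: "riemannian_metric \<A> g"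
    and fr: "oriented_orthonormal_frame \<A> g p e" and c: "c \<in> \<A>" "p \<in> fst c"
    and v: "v \<in> tangent_space \<A> p"
  shows "v c = (\<Sum>l\<in>UNIV. g p v (e l) *\<^sub>R e l c)"
proof -
  have e: "e l \<in> tangent_space \<A> p" for l using fr unfolding oriented_orthonormal_frame_def by blast
  define M :: "real^'n^'n" where "M = (\<chi> i j. e j c $ i)"
  have "det M > 0" using fr c unfolding oriented_orthonormal_frame_def M_def by blast
  then have "invertible M" by (simp add: invertible_det_nz)
  then obtain N where "M ** N = mat 1" unfolding invertible_def by blast
  then have "M *v (N *v v c) = v c" by (simp add: matrix_vector_mul_assoc)
  moreover have "M *v y = (\<Sum>l\<in>UNIV. y $ l *\<^sub>R e l c)" for y
    by (simp add: M_def matrix_vector_mult_def vec_eq_iff sum_component mult.commute)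
  ultimately obtain t where t: "v c = (\<Sum>l\<in>UNIV. t l *\<^sub>R e l c)" by metis
  have v_eq: "v = (\<lambda>c. \<Sum>l\<in>UNIV. t l *\<^sub>R e l c)"
    by (rule tangent_space_eqI[OF v _ c]) (use metric_sum_left[OF at g e v] t in auto)
  have "g p v (e m) = t m" for m
  proof -
    have "g p v (e m) = (\<Sum>l\<in>UNIV. t l * g p (e l) (e m))"
      using metric_sum_left[OF at g, where e = e and p = p and u = "e m" and I = UNIV and t = t, OF e e] unfolding v_eq[symmetric] by simp
    also have "\<dots> = (\<Sum>l\<in>UNIV. if l = m then t l else 0)"
      using fr unfolding oriented_orthonormal_frame_def by (intro sum.cong refl) auto
    finally show ?thesis by simp
  qed
  then show ?thesis using t by simp
qed

section \<open>The Clifford module structure on spinor representatives\<close>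

text \<open>The inner product on complex vectors is the real part of the Hermitian one, so
  skew-Hermitian matrices are skew for it.\<close>

lemma clifford_rep_module:
  fixes \<gamma> :: "'n::finite \<Rightarrow> complex^'s::finite^'s"
  assumes "clifford_rep \<gamma>"
  shows "clifford_module (\<lambda>i v. \<gamma> i *v v) (\<lambda>v. \<i> *s v)"
proof (rule clifford_module.intro)
  fix i j :: 'n and x y :: "complex^'s"
  have scaleR: "M *v (r *\<^sub>R v) = r *\<^sub>R (M *v v)" for M :: "complex^'s^'s" and r v
    by (simp add: vec_eq_iff matrix_vector_mult_def scaleR_sum_right)
  show "bounded_linear (\<lambda>v. \<gamma> i *v v)"
    unfolding linear_conv_bounded_linear[symmetric]
    by (rule linearI) (simp_all add: matrix_vector_right_distrib scaleR)
  show "bounded_linear (\<lambda>v. \<i> *s v :: complex^'s)"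
    unfolding linear_conv_bounded_linear[symmetric]
    by (rule linearI) (simp_all add: vec_eq_iff distrib_left)
  have herm: "cnj (\<gamma> i $ k $ l) = - (\<gamma> i $ l $ k)" for k l
    using assms unfolding clifford_rep_def by blast
  have cm: "inner (m * z) w = inner z (cnj m * w)" for m z w :: complex
    by (simp add: inner_complex_def algebra_simps)
  show "inner (\<gamma> i *v x) y = - inner x (\<gamma> i *v y)"
  proof -
    have "inner (\<gamma> i *v x) y = (\<Sum>k\<in>UNIV. \<Sum>l\<in>UNIV. inner (x $ l) (cnj (\<gamma> i $ k $ l) * y $ k))"
      by (simp add: inner_vec_def matrix_vector_mult_def inner_sum_left cm)
    also have "\<dots> = - (\<Sum>l\<in>UNIV. \<Sum>k\<in>UNIV. inner (x $ l) (\<gamma> i $ l $ k * y $ k))"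
      by (subst sum.swap) (simp add: herm sum_negf)
    finally show ?thesis by (simp add: inner_vec_def matrix_vector_mult_def inner_sum_right)
  qed
  show "\<gamma> i *v (\<gamma> j *v x) + \<gamma> j *v (\<gamma> i *v x) = (if i = j then - 2 *\<^sub>R x else 0)"
  proof -
    have "\<gamma> i ** \<gamma> j + \<gamma> j ** \<gamma> i = (if i = j then - mat 2 else 0)"
      using assms unfolding clifford_rep_def by blast
    moreover have "(- mat 2) *v x = - 2 *\<^sub>R x"
      by (simp add: vec_eq_iff matrix_vector_mult_def mat_def if_distrib[of "\<lambda>u. u * _"] scaleR_conv_of_real cong: if_cong)
         (simp add: sum_negf)
    ultimately show ?thesis
      by (simp add: matrix_vector_mul_assoc matrix_vector_mult_add_rdistrib[symmetric])
  qed
  show "inner (\<i> *s x) y = - inner x (\<i> *s y)"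
    by (simp add: inner_vec_def sum_negf[symmetric] inner_complex_def)
  show "\<i> *s (\<i> *s x) = - x" by (simp add: vec_eq_iff)
  show "\<i> *s (\<gamma> i *v x) = \<gamma> i *v (\<i> *s x)"
    by (simp add: vec_eq_iff matrix_vector_mult_def sum_distrib_left mult_ac)
qed

lemma one_in_spinc_group: "mat 1 \<in> spinc_group \<gamma>"
  unfolding spinc_group_def using spin_group.one[of \<gamma>]
  by (intro CollectI exI[of _ 1] exI[of _ "mat 1"]) (simp add: matrix_mul_lid)

context
  fixes \<gamma> :: "'n::finite \<Rightarrow> complex^'s::finite^'s"
  assumes rep: "clifford_rep \<gamma>"
begin

interpretation clifford_module "\<lambda>i v. \<gamma> i *v v" "\<lambda>v. \<i> *s v"
  by (rule clifford_rep_module[OF rep])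

lemma cliff_cl: "cliff \<gamma> x *v v = clifford_module.cl (\<lambda>i v. \<gamma> i *v v) x v"
proof -
  have "(\<Sum>i\<in>I. x $ i *\<^sub>R \<gamma> i) *v v = (\<Sum>i\<in>I. x $ i *\<^sub>R (\<gamma> i *v v))" for I
  proof -
    have "finite I" by simp
    then show ?thesis
    proof (induction I)
      case (insert k F)
      have "(x $ k *\<^sub>R \<gamma> k) *v v = x $ k *\<^sub>R (\<gamma> k *v v)"
        by (simp add: vec_eq_iff matrix_vector_mult_def scaleR_sum_right)
      then show ?case using insert by (simp add: matrix_vector_mult_add_rdistrib)
    qed simp
  qed
  then show ?thesis unfolding cliff_def cl_def .
qed

lemma norm_cliff: "norm (cliff \<gamma> x *v v) = norm x * norm v"
proof -
  have "inner (cliff \<gamma> x *v v) (cliff \<gamma> x *v v) = inner x x * inner v v"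
    unfolding cliff_cl cl_skew cl_square by simp
  then show ?thesis by (simp add: norm_eq_sqrt_inner real_sqrt_mult)
qed

lemma norm_spin_group: "u \<in> spin_group \<gamma> \<Longrightarrow> norm (u *v v) = norm v"
proof (induction arbitrary: v rule: spin_group.induct)
  case (step u x y)
  have "(u ** cliff \<gamma> x ** cliff \<gamma> y) *v v = u *v (cliff \<gamma> x *v (cliff \<gamma> y *v v))"
    by (simp only: matrix_vector_mul_assoc matrix_mul_assoc)
  then show ?case using step by (simp add: norm_cliff)
qed simp

lemma norm_spinc_group:
  assumes "g \<in> spinc_group \<gamma>"
  shows "norm (g *v v) = norm v"
proof -
  obtain z u where g: "g = mat z ** u" "cmod z = 1" "u \<in> spin_group \<gamma>"
    using assms unfolding spinc_group_def by blast
  have "(mat z ** u) *v v = z *s (u *v v)"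
    by (simp add: matrix_vector_mul_assoc[symmetric])
       (simp add: vec_eq_iff matrix_vector_mult_def mat_def if_distrib[of "\<lambda>u. u * _"] cong: if_cong)
  moreover have "norm (z *s w) = cmod z * norm w" for w :: "complex^'s"
    by (simp add: norm_vec_def norm_mult L2_set_right_distrib)
  ultimately show ?thesis using g norm_spin_group by simp
qed

text \<open>Unit vectors and phases act isometrically, and an injective linear map of a
  finite-dimensional space is bijective.\<close>

lemma spinc_group_ex1:
  assumes "g \<in> spinc_group \<gamma>"
  shows "\<exists>!\<tau>. g *v \<tau> = \<sigma>"
proof -
  have lin: "linear (\<lambda>v. g *v v)"
    by (rule linearI) (simp_all add: matrix_vector_right_distrib vec_eq_iff matrix_vector_mult_def
        scaleR_sum_right distrib_left sum.distrib)
  have "inj (\<lambda>v. g *v v)"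
    unfolding linear_injective_0[OF lin] using norm_spinc_group[OF assms] by (metis norm_eq_zero)
  then show ?thesis
    using linear_injective_imp_surjective[OF lin] by (metis inj_def surjD)
qed

end

section \<open>From the manifold to a local frame\<close>

lemma principal_bundleD:
  assumes "principal_bundle \<A> G mul e B"
  shows "\<forall>u. ract B u e = u"
    and "\<forall>u. \<forall>a\<in>G. proj B (ract B u a) = proj B u"
    and "\<forall>u u'. proj B u = proj B u' \<longrightarrow> (\<exists>!a. a \<in> G \<and> u' = ract B u a)"
    and "(\<Union>(U, s)\<in>bsections B. U) = UNIV"
    and "\<forall>(U, s)\<in>bsections B. open U \<and> (\<forall>p\<in>U. proj B (s p) = p)"
    and "\<forall>(U, s)\<in>bsections B. \<forall>(V, t)\<in>bsections B.
        smooth_fun \<A> (U \<inter> V) (\<lambda>p. fibre_diff G B (s p) (t p))"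
proof -
  note d = assms[unfolded principal_bundle_def]
  from d show "\<forall>u. ract B u e = u" by (elim conjE)
  from d show "\<forall>u. \<forall>a\<in>G. proj B (ract B u a) = proj B u" by (elim conjE)
  from d show "\<forall>u u'. proj B u = proj B u' \<longrightarrow> (\<exists>!a. a \<in> G \<and> u' = ract B u a)" by (elim conjE)
  from d show "(\<Union>(U, s)\<in>bsections B. U) = UNIV" by (elim conjE)
  from d show "\<forall>(U, s)\<in>bsections B. open U \<and> (\<forall>p\<in>U. proj B (s p) = p)" by (elim conjE)
  from d show "\<forall>(U, s)\<in>bsections B. \<forall>(V, t)\<in>bsections B.
        smooth_fun \<A> (U \<inter> V) (\<lambda>p. fibre_diff G B (s p) (t p))" by (elim conjE)
qed

lemma spinc_structureD:
  assumes "spinc_structure S"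
  shows "principal_bundle (atlas S) (spinc_group (gam S)) (**) (mat 1) (spinc_bundle S)"
    and "\<forall>u. oriented_orthonormal_frame (atlas S) (metric S) (proj (spinc_bundle S) u) (fst (covering S u)) \<and>
          proj (circle_bundle S) (snd (covering S u)) = proj (spinc_bundle S) u"
    and "\<forall>(U, s)\<in>bsections (spinc_bundle S).
        (\<forall>j. smooth_vfield (atlas S) U (\<lambda>p. fst (covering S (s p)) j)) \<and>
        local_section (atlas S) circle_group (circle_bundle S) U (\<lambda>p. snd (covering S (s p)))"
proof -
  note d = assms[unfolded spinc_structure_def]
  from d show "principal_bundle (atlas S) (spinc_group (gam S)) (**) (mat 1) (spinc_bundle S)" by (elim conjE)
  from d show "\<forall>u. oriented_orthonormal_frame (atlas S) (metric S) (proj (spinc_bundle S) u) (fst (covering S u)) \<and>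
          proj (circle_bundle S) (snd (covering S u)) = proj (spinc_bundle S) u" by (elim conjE)
  from d show "\<forall>(U, s)\<in>bsections (spinc_bundle S).
        (\<forall>j. smooth_vfield (atlas S) U (\<lambda>p. fst (covering S (s p)) j)) \<and>
        local_section (atlas S) circle_group (circle_bundle S) U (\<lambda>p. snd (covering S (s p)))" by (elim conjE)
qed

section \<open>The Killing equation read in a chart\<close>

locale killing_spinor_setting =
  fixes S :: "('m::{t2_space,second_countable_topology}, 'n::finite, 's::finite, 'p, 'q) spinc_data"
    and a b :: "'m \<Rightarrow> real" and \<psi> :: "'m \<Rightarrow> ('p, 's) spinor"
  assumes manifold: "spinc_manifold S"
    and smooth_real: "smooth_fun (atlas S) UNIV a" and smooth_imag: "smooth_fun (atlas S) UNIV b"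
    and killing_spinor: "generalized_killing_spinor S (\<lambda>p. of_real (a p) + \<i> * of_real (b p)) \<psi>"
begin

lemma oriented: "oriented_atlas (atlas S)"
  and riem: "riemannian_metric (atlas S) (metric S)"
  and lc: "levi_civita (atlas S) (metric S) (lc_conn S)"
  and rep: "clifford_rep (gam S)"
  and spinc_struct: "spinc_structure S"
  using manifold unfolding spinc_manifold_def by simp_all

lemma atlas_smooth: "smooth_atlas (atlas S)"
  using oriented unfolding oriented_atlas_def by blast

lemma principal: "principal_bundle (atlas S) (spinc_group (gam S)) (**) (mat 1) (spinc_bundle S)"
  by (rule spinc_structureD(1)[OF spinc_struct])

lemma ract_one: "ract (spinc_bundle S) u (mat 1) = u"
  using principal_bundleD(1)[OF principal] by blast

lemma proj_ract: "g \<in> spinc_group (gam S) \<Longrightarrow> proj (spinc_bundle S) (ract (spinc_bundle S) u g) = proj (spinc_bundle S) u"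
  using principal_bundleD(2)[OF principal] by blast

lemma fibre_transitive:
  assumes "proj (spinc_bundle S) u = proj (spinc_bundle S) u'"
  shows "\<exists>!g. g \<in> spinc_group (gam S) \<and> u' = ract (spinc_bundle S) u g"
  using principal_bundleD(3)[OF principal] assms by blast

lemma section_covers:
  obtains U s where "(U, s) \<in> bsections (spinc_bundle S)" "p \<in> U"
proof -
  have "p \<in> (\<Union>(U, s)\<in>bsections (spinc_bundle S). U)"
    by (simp only: principal_bundleD(4)[OF principal] UNIV_I)
  then show ?thesis using that by auto
qed

lemma section_open:
  assumes "(U, s) \<in> bsections (spinc_bundle S)"
  shows "open U" and "p \<in> U \<Longrightarrow> proj (spinc_bundle S) (s p) = p"
  using bspec[OF principal_bundleD(5)[OF principal] assms] by simp_all

lemma bsection_local_section: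
  assumes "(U, s) \<in> bsections (spinc_bundle S)"
  shows "local_section (atlas S) (spinc_group (gam S)) (spinc_bundle S) U s"
  unfolding local_section_def
proof (intro conjI ballI)
  show "open U" by (rule section_open(1)[OF assms])
  show "proj (spinc_bundle S) (s p) = p" if "p \<in> U" for p by (rule section_open(2)[OF assms that])
  fix x assume x: "x \<in> bsections (spinc_bundle S)"
  then show "case x of (V, t) \<Rightarrow> smooth_fun (atlas S) (U \<inter> V)
      (\<lambda>p. fibre_diff (spinc_group (gam S)) (spinc_bundle S) (t p) (s p))"
    using bspec[OF principal_bundleD(6)[OF principal] x] assms by (auto simp: Int_commute)
qed

lemma orthonormal: "oriented_orthonormal_frame (atlas S) (metric S) (proj (spinc_bundle S) u) (fst (covering S u))"
  using spinc_structureD(2)[OF spinc_struct] by blast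

lemma frame_smooth:
  assumes "(U, s) \<in> bsections (spinc_bundle S)"
  shows "smooth_vfield (atlas S) U (\<lambda>p. fst (covering S (s p)) j)"
  using bspec[OF spinc_structureD(3)[OF spinc_struct] assms] by simp

text \<open>The action on fibres is free and transitive, so the group element is unique; its
  invertibility then fixes the vector. This makes \<open>spinor_rep\<close> meaningful.\<close>

lemma spinor_class_ex1:
  assumes "proj (spinc_bundle S) u = proj (spinc_bundle S) u0"
  shows "\<exists>!\<tau>. (u, \<tau>) \<in> spinor_class S u0 \<sigma>0"
proof -
  obtain g where g: "g \<in> spinc_group (gam S)" "u = ract (spinc_bundle S) u0 g"
    and uniq: "\<And>h. h \<in> spinc_group (gam S) \<Longrightarrow> u = ract (spinc_bundle S) u0 h \<Longrightarrow> h = g"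
    using fibre_transitive[of u0 u] assms by metis
  have "(u, \<tau>) \<in> spinor_class S u0 \<sigma>0 \<longleftrightarrow> g *v \<tau> = \<sigma>0" for \<tau>
    unfolding spinor_class_def using g uniq by blast
  then show ?thesis using spinc_group_ex1[OF rep g(1), of \<sigma>0] by simp
qed

lemma psi_fibre: "\<exists>u0 \<sigma>0. \<psi> p = spinor_class S u0 \<sigma>0 \<and> proj (spinc_bundle S) u0 = p"
  using killing_spinor unfolding generalized_killing_spinor_def spinor_field_def spinor_fibre_def by blast

lemma spinor_rep_iff:
  assumes "proj (spinc_bundle S) u = p"
  shows "(u, \<tau>) \<in> \<psi> p \<longleftrightarrow> \<tau> = spinor_rep u (\<psi> p)"
proof -
  have "\<exists>!\<tau>. (u, \<tau>) \<in> \<psi> p" using psi_fibre[of p] spinor_class_ex1 assms by metis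
  then show ?thesis unfolding spinor_rep_def by (metis theI')
qed

lemma psi_zero_iff:
  assumes u: "proj (spinc_bundle S) u = p"
  shows "\<psi> p = spinor_zero S p \<longleftrightarrow> spinor_rep u (\<psi> p) = 0"
proof
  assume "\<psi> p = spinor_zero S p"
  then have "(u, 0) \<in> \<psi> p" using u by (simp add: spinor_zero_def)
  then show "spinor_rep u (\<psi> p) = 0" using spinor_rep_iff[OF u] by simp
next
  assume 0: "spinor_rep u (\<psi> p) = 0"
  obtain u0 \<sigma>0 where p: "\<psi> p = spinor_class S u0 \<sigma>0" "proj (spinc_bundle S) u0 = p" using psi_fibre by blast
  have "(u, 0) \<in> spinor_class S u0 \<sigma>0" using spinor_rep_iff[OF u, of 0] 0 p by simp
  then have s0: "\<sigma>0 = 0" unfolding spinor_class_def by (auto simp: matrix_vector_mult_0_right)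
  have "(v, \<tau>) \<in> spinor_class S u0 0 \<longleftrightarrow> \<tau> = 0 \<and> proj (spinc_bundle S) v = p" for v \<tau>
  proof
    assume "(v, \<tau>) \<in> spinor_class S u0 0"
    then obtain g where g: "v = ract (spinc_bundle S) u0 g" "g \<in> spinc_group (gam S)" "g *v \<tau> = 0"
      unfolding spinor_class_def by blast
    then show "\<tau> = 0 \<and> proj (spinc_bundle S) v = p"
      using norm_spinc_group[OF rep g(2), of \<tau>] proj_ract p by simp
  next
    assume *: "\<tau> = 0 \<and> proj (spinc_bundle S) v = p"
    then obtain g where "g \<in> spinc_group (gam S)" "v = ract (spinc_bundle S) u0 g"
      using fibre_transitive[of u0 v] p by metis
    then show "(v, \<tau>) \<in> spinor_class S u0 0" unfolding spinor_class_def using * by auto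
  qed
  then show "\<psi> p = spinor_zero S p" unfolding p s0 spinor_zero_def by auto
qed

text \<open>Equality of classes becomes equality of vectors by looking at the representative over
  \<open>s p\<close>, obtained with the unit of the group.\<close>

lemma killing_local:
  assumes Us: "(U, s) \<in> bsections (spinc_bundle S)" and p: "p \<in> U" and v: "v \<in> tangent_space (atlas S) p"
  shows "local_spinc_deriv S s \<psi> p v = (of_real (a p) + \<i> * of_real (b p)) *s
     (cliff (gam S) (\<chi> j. metric S p v (fst (covering S (s p)) j)) *v spinor_rep (s p) (\<psi> p))"
proof -
  have pr: "proj (spinc_bundle S) (s p) = p" by (rule section_open(2)[OF Us p])
  have "has_spinc_deriv S \<psi> p v (spinor_scale (of_real (a p) + \<i> * of_real (b p)) (clifford_mult S v (\<psi> p)))"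
    using killing_spinor v unfolding generalized_killing_spinor_def by blast
  then have "spinor_scale (of_real (a p) + \<i> * of_real (b p)) (clifford_mult S v (\<psi> p))
      = spinor_class S (s p) (local_spinc_deriv S s \<psi> p v)"
    unfolding has_spinc_deriv_def using bsection_local_section[OF Us] p by blast
  moreover have "(s p, local_spinc_deriv S s \<psi> p v) \<in> spinor_class S (s p) (local_spinc_deriv S s \<psi> p v)"
    unfolding spinor_class_def
    by (intro CollectI exI[of _ "mat 1"] exI[of _ "local_spinc_deriv S s \<psi> p v"])
       (simp add: ract_one one_in_spinc_group)
  ultimately have "(s p, local_spinc_deriv S s \<psi> p v)
      \<in> spinor_scale (of_real (a p) + \<i> * of_real (b p)) (clifford_mult S v (\<psi> p))"
    by (simp only:)
  moreover have "\<exists>\<tau>. (s p, \<tau>) \<in> \<psi> p \<and>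
      L = k *s (cliff (gam S) (\<chi> j. metric S p v (fst (covering S (s p)) j)) *v \<tau>)"
    if "(s p, L) \<in> spinor_scale k (clifford_mult S v (\<psi> p))" for L k
    using that unfolding spinor_scale_def clifford_mult_def by (auto simp: pr)
  ultimately obtain \<tau> where "(s p, \<tau>) \<in> \<psi> p"
    and "local_spinc_deriv S s \<psi> p v = (of_real (a p) + \<i> * of_real (b p)) *s
     (cliff (gam S) (\<chi> j. metric S p v (fst (covering S (s p)) j)) *v \<tau>)"
    by blast
  then show ?thesis using spinor_rep_iff[OF pr] by simp
qed

definition chart_dom :: "('m, 'n) chart \<Rightarrow> 'm set \<Rightarrow> (real^'n) set" where
  "chart_dom c U = snd c ` (fst c \<inter> U)"

definition frame :: "('m \<Rightarrow> 'p) \<Rightarrow> 'n \<Rightarrow> 'm \<Rightarrow> ('m, 'n) tvec" where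
  "frame s j p = fst (covering S (s p)) j"

definition conn_coeff :: "('m \<Rightarrow> 'p) \<Rightarrow> 'n \<Rightarrow> 'n \<Rightarrow> 'n \<Rightarrow> 'm \<Rightarrow> real" where
  "conn_coeff s i j l p = metric S p (lc_conn S p (frame s i p) (frame s j)) (frame s l p)"

definition aux_conn :: "('m \<Rightarrow> 'p) \<Rightarrow> 'n \<Rightarrow> 'm \<Rightarrow> real" where
  "aux_conn s k p = conn_form S (snd (covering S (s p)))
     (section_push (atlas S) (circle_bundle S) (\<lambda>q. snd (covering S (s q))) p (frame s k p))"

context
  fixes c U s
  assumes c: "c \<in> atlas S" and Us: "(U, s) \<in> bsections (spinc_bundle S)"
begin

lemma U_open: "open U" by (rule section_open(1)[OF Us])

lemma in_chart_domD:
  assumes "x \<in> chart_dom c U"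
  shows "chart_inv c x \<in> fst c" "chart_inv c x \<in> U" "snd c (chart_inv c x) = x"
  using assms chart_inv_chart[OF atlas_smooth c] unfolding chart_dom_def by auto

lemma frame_orthonormal: "p \<in> U \<Longrightarrow> oriented_orthonormal_frame (atlas S) (metric S) p (\<lambda>j. frame s j p)"
  using orthonormal[of "s p"] section_open(2)[OF Us] by (simp add: frame_def)

lemma frame_tangent: "p \<in> U \<Longrightarrow> frame s j p \<in> tangent_space (atlas S) p"
  using frame_orthonormal unfolding oriented_orthonormal_frame_def by blast

lemma frame_metric: "p \<in> U \<Longrightarrow> metric S p (frame s j p) (frame s k p) = (if j = k then 1 else 0)"
  using frame_orthonormal unfolding oriented_orthonormal_frame_def by blast

lemma frame_vfield: "smooth_vfield (atlas S) U (frame s j)"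
  using frame_smooth[OF Us] by (simp add: frame_def[abs_def])

lemma affine: "affine_connection (atlas S) (lc_conn S)"
  and metric_conn: "metric_connection (atlas S) (metric S) (lc_conn S)"
  and torsion_fr: "torsion_free (atlas S) (lc_conn S)"
  using lc unfolding levi_civita_def by simp_all

lemma lc_vfield: "smooth_vfield (atlas S) U (\<lambda>p. lc_conn S p (frame s i p) (frame s j))"
  using affine frame_vfield[of i] frame_vfield[of j] U_open unfolding affine_connection_def by presburger

lemma lc_tangent: "p \<in> U \<Longrightarrow> lc_conn S p (frame s i p) (frame s j) \<in> tangent_space (atlas S) p"
  using lc_vfield unfolding smooth_vfield_def by blast

lemma conn_coeff_smooth: "smooth_fun (atlas S) U (conn_coeff s i j l)"
proof -
  have "\<forall>W X Y. open W \<and> smooth_vfield (atlas S) W X \<and> smooth_vfield (atlas S) W Y \<longrightarrow>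
        smooth_fun (atlas S) W (\<lambda>p. metric S p (X p) (Y p))"
    using riem[unfolded riemannian_metric_def] by (elim conjE)
  from this[rule_format, OF conjI[OF U_open conjI[OF lc_vfield frame_vfield]]]
  show ?thesis unfolding conn_coeff_def[abs_def] .
qed

lemma lc_expansion:
  assumes p: "p \<in> fst c" "p \<in> U"
  shows "lc_conn S p (frame s i p) (frame s j) c = (\<Sum>l\<in>UNIV. conn_coeff s i j l p *\<^sub>R frame s l p c)"
  unfolding conn_coeff_def
  by (rule orthonormal_expansion[OF atlas_smooth riem frame_orthonormal[OF p(2)] c p(1) lc_tangent[OF p(2)]])

text \<open>Products of frame vectors are constant on \<open>U\<close>, so metric compatibility
  leaves two coefficients with sum zero.\<close>

lemma conn_coeff_skew:
  assumes p: "p \<in> U"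
  shows "conn_coeff s i k l p = - conn_coeff s i l k p"
proof -
  have "dir_deriv (atlas S) (\<lambda>q. metric S q (frame s k q) (frame s l q)) p (frame s i p)
      = metric S p (lc_conn S p (frame s i p) (frame s k)) (frame s l p)
        + metric S p (frame s k p) (lc_conn S p (frame s i p) (frame s l))"
    using metric_conn[unfolded metric_connection_def, rule_format,
        OF conjI[OF U_open conjI[OF frame_vfield frame_vfield]] p frame_tangent[OF p]] .
  moreover have "dir_deriv (atlas S) (\<lambda>q. metric S q (frame s k q) (frame s l q)) p (frame s i p) = 0"
  proof -
    obtain c' where c': "c' \<in> atlas S" "p \<in> fst c'" using smooth_atlasD(1)[OF atlas_smooth] by blast
    have "((\<lambda>x. if k = l then 1 else 0) has_derivative (\<lambda>v. 0 :: real)) (at (snd c' p))" by simp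
    then have "((\<lambda>q. metric S q (frame s k q) (frame s l q)) \<circ> chart_inv c' has_derivative (\<lambda>v. 0)) (at (snd c' p))"
    proof (rule has_derivative_transform_within_open)
      show "open (snd c' ` (fst c' \<inter> U))" by (rule open_chart_image[OF atlas_smooth c'(1) U_open])
      show "snd c' p \<in> snd c' ` (fst c' \<inter> U)" using c' p by blast
      show "(if k = l then 1 else 0) = ((\<lambda>q. metric S q (frame s k q) (frame s l q)) \<circ> chart_inv c') x"
        if "x \<in> snd c' ` (fst c' \<inter> U)" for x
        using that frame_metric chart_inv_chart[OF atlas_smooth c'(1)] by auto
    qed
    from dir_deriv_chart[OF atlas_smooth c' frame_tangent[OF p] this] show ?thesis .
  qed
  moreover have "metric S p (frame s k p) (lc_conn S p (frame s i p) (frame s l))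
      = metric S p (lc_conn S p (frame s i p) (frame s l)) (frame s k p)"
    by (rule riemannian_metric_linear(3)[OF riem frame_tangent[OF p] frame_tangent[OF p] lc_tangent[OF p]])
  ultimately show ?thesis unfolding conn_coeff_def by simp
qed

lemma open_chart_dom: "open (chart_dom c U)"
  unfolding chart_dom_def by (rule open_chart_image[OF atlas_smooth c U_open])

lemma frame_chart_smooth: "Csmooth_on (\<lambda>x. frame s j (chart_inv c x) c) (chart_dom c U)"
  using frame_vfield c unfolding smooth_vfield_def chart_dom_def by blast

text \<open>Vanishing torsion is phrased through test functions; the coordinate functions of the
  chart recover the bracket of the frame component by component.\<close>

lemma frame_torsion:
  assumes x: "x \<in> chart_dom c U"
  shows "frechet_derivative (\<lambda>x. frame s j (chart_inv c x) c) (at x) (frame s i (chart_inv c x) c)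
      - frechet_derivative (\<lambda>x. frame s i (chart_inv c x) c) (at x) (frame s j (chart_inv c x) c)
    = (\<Sum>l\<in>UNIV. (conn_coeff s i j l (chart_inv c x) - conn_coeff s j i l (chart_inv c x)) *\<^sub>R frame s l (chart_inv c x) c)"
proof -
  define p where "p = chart_inv c x"
  have p: "p \<in> fst c" "p \<in> U" "snd c p = x" using in_chart_domD[OF x] by (simp_all add: p_def)
  \<comment> \<open>The test functions are smooth only inside the chart domain.\<close>
  define W where "W = U \<inter> fst c"
  have W: "open W" using U_open smooth_atlasD(2)[OF atlas_smooth c] by (auto simp: W_def)
  have vf: "smooth_vfield (atlas S) W (frame s j)" for j
    by (rule smooth_vfield_subset[OF frame_vfield]) (simp add: W_def)
  have comp: "frechet_derivative (\<lambda>x. frame s j (chart_inv c x) c) (at x) (frame s i p c) $ m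
      - frechet_derivative (\<lambda>x. frame s i (chart_inv c x) c) (at x) (frame s j p c) $ m
    = lc_conn S p (frame s i p) (frame s j) c $ m - lc_conn S p (frame s j p) (frame s i) c $ m" for m
  proof -
    define f where "f q = snd c q $ m" for q
    have sf: "smooth_fun (atlas S) W f"
      unfolding smooth_fun_def
    proof
      fix c' assume c': "c' \<in> atlas S"
      have "Csmooth_on (\<lambda>x. transition c' c x $ m) (snd c' ` (fst c' \<inter> fst c))"
        by (rule Csmooth_on_bounded_linear[OF bounded_linear_vec_nth smooth_atlasD(5)[OF atlas_smooth c' c]])
      moreover have "f \<circ> chart_inv c' = (\<lambda>x. transition c' c x $ m)" by (simp add: fun_eq_iff f_def transition_def)
      ultimately show "Csmooth_on (f \<circ> chart_inv c') (snd c' ` (fst c' \<inter> W))"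
        by (auto simp: W_def intro: Csmooth_on_subset)
    qed
    have df: "dir_deriv (atlas S) f q v = v c $ m" if q: "q \<in> fst c" and v: "v \<in> tangent_space (atlas S) q" for q v
    proof -
      have "((\<lambda>y. y $ m) has_derivative (\<lambda>v. v $ m)) (at (snd c q))"
        by (rule bounded_linear.has_derivative[OF bounded_linear_vec_nth has_derivative_ident])
      then have "(f \<circ> chart_inv c has_derivative (\<lambda>v. v $ m)) (at (snd c q))"
      proof (rule has_derivative_transform_within_open)
        show "open (snd c ` fst c)" by (rule smooth_atlasD(3)[OF atlas_smooth c])
        show "snd c q \<in> snd c ` fst c" using q by blast
        show "y $ m = (f \<circ> chart_inv c) y" if "y \<in> snd c ` fst c" for y
          using chart_chart_inv[OF atlas_smooth c that] by (simp add: f_def)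
      qed
      from dir_deriv_chart[OF atlas_smooth c q v this] show ?thesis .
    qed
    have ddf: "dir_deriv (atlas S) (\<lambda>q. dir_deriv (atlas S) f q (frame s j q)) p (frame s i p)
      = frechet_derivative (\<lambda>x. frame s j (chart_inv c x) c) (at x) (frame s i p c) $ m" for i j
    proof -
      have "((\<lambda>x. frame s j (chart_inv c x) c $ m) has_derivative
         (\<lambda>v. frechet_derivative (\<lambda>x. frame s j (chart_inv c x) c) (at x) v $ m)) (at x)"
        by (rule bounded_linear.has_derivative[OF bounded_linear_vec_nth
              Csmooth_on_has_derivative[OF frame_chart_smooth x]])
      then have "((\<lambda>q. dir_deriv (atlas S) f q (frame s j q)) \<circ> chart_inv c has_derivative
         (\<lambda>v. frechet_derivative (\<lambda>x. frame s j (chart_inv c x) c) (at x) v $ m)) (at (snd c p))"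
        unfolding p(3)
        by (rule has_derivative_transform_within_open[OF _ open_chart_dom x])
           (simp add: df in_chart_domD frame_tangent)
      from dir_deriv_chart[OF atlas_smooth c p(1) frame_tangent[OF p(2)] this] show ?thesis .
    qed
    have "dir_deriv (atlas S) f p (lc_conn S p (frame s i p) (frame s j))
        - dir_deriv (atlas S) f p (lc_conn S p (frame s j p) (frame s i))
      = dir_deriv (atlas S) (\<lambda>q. dir_deriv (atlas S) f q (frame s j q)) p (frame s i p)
        - dir_deriv (atlas S) (\<lambda>q. dir_deriv (atlas S) f q (frame s i q)) p (frame s j p)"
      using torsion_fr[unfolded torsion_free_def, rule_format,
          OF conjI[OF W conjI[OF vf conjI[OF vf sf]]]] p(1,2) unfolding W_def by simp
    then show ?thesis unfolding ddf df[OF p(1) lc_tangent[OF p(2)]] by simp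
  qed
  have "frechet_derivative (\<lambda>x. frame s j (chart_inv c x) c) (at x) (frame s i p c)
      - frechet_derivative (\<lambda>x. frame s i (chart_inv c x) c) (at x) (frame s j p c)
    = lc_conn S p (frame s i p) (frame s j) c - lc_conn S p (frame s j p) (frame s i) c"
    using comp by (simp add: vec_eq_iff)
  also have "\<dots> = (\<Sum>l\<in>UNIV. (conn_coeff s i j l p - conn_coeff s j i l p) *\<^sub>R frame s l p c)"
    unfolding lc_expansion[OF p(1,2)] by (simp add: sum_subtractf scaleR_diff_left)
  finally show ?thesis unfolding p_def .
qed

lemma spinor_chart_smooth: "Csmooth_on (\<lambda>x. spinor_rep (s (chart_inv c x)) (\<psi> (chart_inv c x))) (chart_dom c U)"
proof -
  have "smooth_fun (atlas S) U (\<lambda>p. spinor_rep (s p) (\<psi> p))"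
    using killing_spinor Us unfolding generalized_killing_spinor_def spinor_field_def by fast
  then show ?thesis using c unfolding smooth_fun_def chart_dom_def by (simp add: o_def)
qed

lemma real_function_chart_smooth: "smooth_fun (atlas S) UNIV f \<Longrightarrow> Csmooth_on (\<lambda>x. f (chart_inv c x)) (chart_dom c U)"
  using c unfolding smooth_fun_def chart_dom_def o_def by (blast intro: Csmooth_on_subset)

text \<open>Stated for every open part of the chart because constancy of \<open>a\<close> is proved
  on a ball where \<open>a\<close> is nonzero.\<close>

lemma local_killing_spinor_chart:
  assumes \<Omega>: "open \<Omega>" "\<Omega> \<subseteq> chart_dom c U"
  shows "local_killing_spinor (\<lambda>i v. gam S i *v v) (\<lambda>v. \<i> *s v) \<Omega>
     (\<lambda>j x. frame s j (chart_inv c x) c) (\<lambda>i j l x. conn_coeff s i j l (chart_inv c x))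
     (\<lambda>k x. aux_conn s k (chart_inv c x)) (\<lambda>x. spinor_rep (s (chart_inv c x)) (\<psi> (chart_inv c x)))
     (\<lambda>x. a (chart_inv c x)) (\<lambda>x. b (chart_inv c x))"
proof (rule local_killing_spinor.intro[OF clifford_rep_module[OF rep] local_killing_spinor_axioms.intro])
  interpret clifford_module "\<lambda>i v. gam S i *v v" "\<lambda>v. \<i> *s v" by (rule clifford_rep_module[OF rep])
  show "open \<Omega>" by (rule \<Omega>(1))
  show "Csmooth_on (\<lambda>x. frame s j (chart_inv c x) c) \<Omega>" for j
    by (rule Csmooth_on_subset[OF frame_chart_smooth \<Omega>(2)])
  show "Csmooth_on (\<lambda>x. conn_coeff s i k l (chart_inv c x)) \<Omega>" for i k l
  proof (rule Csmooth_on_subset[OF _ \<Omega>(2)])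
    show "Csmooth_on (\<lambda>x. conn_coeff s i k l (chart_inv c x)) (chart_dom c U)"
      using conn_coeff_smooth c unfolding smooth_fun_def chart_dom_def o_def by blast
  qed
  show "Csmooth_on (\<lambda>x. spinor_rep (s (chart_inv c x)) (\<psi> (chart_inv c x))) \<Omega>"
    by (rule Csmooth_on_subset[OF spinor_chart_smooth \<Omega>(2)])
  show "Csmooth_on (\<lambda>x. a (chart_inv c x)) \<Omega>" "Csmooth_on (\<lambda>x. b (chart_inv c x)) \<Omega>"
    by (rule Csmooth_on_subset[OF real_function_chart_smooth \<Omega>(2)], fact smooth_real smooth_imag)+
  fix x assume "x \<in> \<Omega>"
  then have x: "x \<in> chart_dom c U" using \<Omega>(2) by blast
  define p where "p = chart_inv c x"
  have p: "p \<in> fst c" "p \<in> U" "snd c p = x" using in_chart_domD[OF x] by (simp_all add: p_def)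
  show "det (\<chi> i j. frame s j (chart_inv c x) c $ i) \<noteq> 0"
    using frame_orthonormal[OF p(2)] c p(1) unfolding oriented_orthonormal_frame_def p_def by fastforce
  show "conn_coeff s i k l (chart_inv c x) = - conn_coeff s i l k (chart_inv c x)" for i k l
    using conn_coeff_skew[OF p(2)] unfolding p_def .
  show "frechet_derivative (\<lambda>x. frame s j (chart_inv c x) c) (at x) (frame s i (chart_inv c x) c)
      - frechet_derivative (\<lambda>x. frame s i (chart_inv c x) c) (at x) (frame s j (chart_inv c x) c)
    = (\<Sum>l\<in>UNIV. (conn_coeff s i j l (chart_inv c x) - conn_coeff s j i l (chart_inv c x)) *\<^sub>R frame s l (chart_inv c x) c)" for i j
    by (rule frame_torsion[OF x])
  fix k
  define \<sigma> where "\<sigma> q = spinor_rep (s q) (\<psi> q)" for q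
  have "((\<lambda>x. \<sigma> (chart_inv c x)) has_derivative frechet_derivative (\<lambda>x. \<sigma> (chart_inv c x)) (at x)) (at x)"
    unfolding \<sigma>_def by (rule Csmooth_on_has_derivative[OF spinor_chart_smooth x])
  then have "(\<sigma> \<circ> chart_inv c has_derivative frechet_derivative (\<lambda>x. \<sigma> (chart_inv c x)) (at x)) (at (snd c p))"
    unfolding p(3) o_def .
  from dir_deriv_chart[OF atlas_smooth c p(1) frame_tangent[OF p(2)] this]
  have dd: "dir_deriv (atlas S) \<sigma> p (frame s k p) = frechet_derivative (\<lambda>x. \<sigma> (chart_inv c x)) (at x) (frame s k p c)" .
  have ax: "(\<chi> j. metric S p (frame s k p) (frame s j p)) = axis k 1"
    unfolding frame_metric[OF p(2)] by (simp add: vec_eq_iff axis_def)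
  have "local_spinc_deriv S s \<psi> p (frame s k p)
     = dir_deriv (atlas S) \<sigma> p (frame s k p) + spin_conn (\<lambda>j l. conn_coeff s k j l p) (aux_conn s k p) (\<sigma> p)"
  proof -
    have "gam S j *v (cliff (gam S) (\<chi> l. metric S p (lc_conn S p (frame s k p) (frame s j)) (frame s l p)) *v \<sigma> p)
       = (\<Sum>l\<in>UNIV. conn_coeff s k j l p *\<^sub>R (gam S j *v (gam S l *v \<sigma> p)))" for j
      unfolding cliff_cl[OF rep] cl_def conn_coeff_def by (simp add: gam_lin)
    moreover have "(\<i> / 2 * of_real r) *s v = (r / 2) *\<^sub>R (\<i> *s v)" for r and v :: "complex^'s"
      by (simp add: vec_eq_iff complex_eq_iff)
    moreover have "(\<lambda>q. fst (covering S (s q)) j) = frame s j" for j by (simp add: frame_def fun_eq_iff)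
    ultimately show ?thesis
      unfolding local_spinc_deriv_def Let_def spin_conn_def aux_conn_def \<sigma>_def[symmetric] \<sigma>_def[abs_def, symmetric]
      by (simp add: frame_def[symmetric])
  qed
  moreover have "local_spinc_deriv S s \<psi> p (frame s k p) = kmul (a p) (b p) (gam S k *v \<sigma> p)"
  proof -
    have "local_spinc_deriv S s \<psi> p (frame s k p) = (of_real (a p) + \<i> * of_real (b p)) *s (gam S k *v \<sigma> p)"
      unfolding killing_local[OF Us p(2) frame_tangent[OF p(2)]] frame_def[symmetric] ax cliff_cl[OF rep] cl_axis \<sigma>_def ..
    then show ?thesis
      by (simp add: kmul_def vec_eq_iff complex_eq_iff algebra_simps)
  qed
  ultimately show "frechet_derivative (\<lambda>x. spinor_rep (s (chart_inv c x)) (\<psi> (chart_inv c x))) (at x) (frame s k (chart_inv c x) c)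
      = kmul (a (chart_inv c x)) (b (chart_inv c x)) (gam S k *v spinor_rep (s (chart_inv c x)) (\<psi> (chart_inv c x)))
        - spin_conn (\<lambda>j l. conn_coeff s k j l (chart_inv c x)) (aux_conn s k (chart_inv c x))
            (spinor_rep (s (chart_inv c x)) (\<psi> (chart_inv c x)))"
    using dd unfolding p_def \<sigma>_def by (simp add: algebra_simps)
qed

end
end

section \<open>Global conclusions\<close>

lemma connected_clopen:
  fixes V :: "'a::topological_space set"
  assumes "connected (UNIV :: 'a set)" "open V" "open (- V)" "V \<noteq> {}"
  shows "V = UNIV"
  using connectedD[OF assms(1), of V "- V"] assms(2-4) by auto

context killing_spinor_setting begin

lemma chart_and_section:
  obtains c U s where "c \<in> atlas S" "(U, s) \<in> bsections (spinc_bundle S)" "p \<in> fst c" "p \<in> U"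
  using smooth_atlasD(1)[OF atlas_smooth, of p] section_covers[of p] by metis

lemma chart_ball_neighbourhood:
  assumes "c \<in> atlas S" "(U, s) \<in> bsections (spinc_bundle S)" "p \<in> fst c" "p \<in> U" "r > 0"
  shows "open {q \<in> fst c \<inter> U. snd c q \<in> ball (snd c p) r}" "p \<in> {q \<in> fst c \<inter> U. snd c q \<in> ball (snd c p) r}"
  using open_chart_preimage[OF atlas_smooth assms(1) section_open(1)[OF assms(2)], of "ball (snd c p) r"] assms(3-5) by auto

text \<open>The zero set is open by \<open>zero_set_open\<close>, closed by continuity of the
  representatives, and not everything.\<close>

lemma spinor_nonvanishing:
  assumes conn: "connected (UNIV :: 'm set)"
  shows "\<psi> p \<noteq> spinor_zero S p"
proof -
  define V where "V = {p. \<psi> p = spinor_zero S p}"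
  have V: "q \<in> V \<longleftrightarrow> spinor_rep (s q) (\<psi> q) = 0" if "(U, s) \<in> bsections (spinc_bundle S)" "q \<in> U" for q U s
    unfolding V_def using psi_zero_iff[OF section_open(2)[OF that]] by simp
  have "open V"
    unfolding open_subopen[of V]
  proof
    fix q assume q: "q \<in> V"
    obtain c U s where c: "c \<in> atlas S" "(U, s) \<in> bsections (spinc_bundle S)" "q \<in> fst c" "q \<in> U"
      by (rule chart_and_section)
    interpret local_killing_spinor "\<lambda>i v. gam S i *v v" "\<lambda>v. \<i> *s v" "chart_dom c U"
      "\<lambda>j x. frame s j (chart_inv c x) c" "\<lambda>i j l x. conn_coeff s i j l (chart_inv c x)"
      "\<lambda>k x. aux_conn s k (chart_inv c x)" "\<lambda>x. spinor_rep (s (chart_inv c x)) (\<psi> (chart_inv c x))"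
      "\<lambda>x. a (chart_inv c x)" "\<lambda>x. b (chart_inv c x)"
      by (rule local_killing_spinor_chart[OF c(1,2) open_chart_dom[OF c(1,2)] order_refl])
    have inv: "chart_inv c (snd c y) = y" if "y \<in> fst c" for y by (rule chart_inv_chart[OF atlas_smooth c(1) that])
    have "snd c q \<in> chart_dom c U" using c unfolding chart_dom_def by blast
    then obtain r where r: "r > 0" "\<And>y. y \<in> ball (snd c q) r \<Longrightarrow> spinor_rep (s (chart_inv c y)) (\<psi> (chart_inv c y)) = 0"
      using zero_set_open[of "snd c q"] q V[OF c(2,4)] by (auto simp: inv[OF c(3)])
    define N where "N = {y \<in> fst c \<inter> U. snd c y \<in> ball (snd c q) r}"
    have "open N" "q \<in> N" using chart_ball_neighbourhood[OF c r(1)] unfolding N_def by blast+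
    moreover have "N \<subseteq> V"
    proof
      fix y assume y: "y \<in> N"
      then have "y \<in> fst c" "y \<in> U" "snd c y \<in> ball (snd c q) r" by (auto simp: N_def)
      then show "y \<in> V" using r(2)[of "snd c y"] V[OF c(2)] inv by simp
    qed
    ultimately show "\<exists>T. open T \<and> q \<in> T \<and> T \<subseteq> V" by blast
  qed
  moreover have "open (- V)"
    unfolding open_subopen[of "- V"]
  proof
    fix q assume q: "q \<in> - V"
    obtain c U s where c: "c \<in> atlas S" "(U, s) \<in> bsections (spinc_bundle S)" "q \<in> fst c" "q \<in> U"
      by (rule chart_and_section)
    define f where "f y = spinor_rep (s y) (\<psi> y)" for y
    have "smooth_fun (atlas S) U f"
      using killing_spinor c(2) unfolding generalized_killing_spinor_def spinor_field_def f_def[abs_def] by fast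
    then have "continuous_on U f" by (rule smooth_fun_continuous[OF atlas_smooth section_open(1)[OF c(2)]])
    then have "open (U \<inter> f -` (- {0}))"
      by (intro continuous_open_preimage section_open(1)[OF c(2)]) auto
    moreover have "q \<in> U \<inter> f -` (- {0})" using q c(4) V[OF c(2)] by (auto simp: f_def)
    moreover have "U \<inter> f -` (- {0}) \<subseteq> - V" using V[OF c(2)] by (auto simp: f_def)
    ultimately show "\<exists>T. open T \<and> q \<in> T \<and> T \<subseteq> - V" by blast
  qed
  moreover have "V \<noteq> UNIV"
    using killing_spinor unfolding generalized_killing_spinor_def V_def by blast
  ultimately have "V = {}" using connected_clopen[OF conn, of V] by blast
  then show ?thesis unfolding V_def by blast
qed

lemma nonvanishing_killing_spinor_chart:
  assumes conn: "connected (UNIV :: 'm set)"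
    and c: "c \<in> atlas S" "(U, s) \<in> bsections (spinc_bundle S)" and \<Omega>: "open \<Omega>" "\<Omega> \<subseteq> chart_dom c U"
  shows "nonvanishing_killing_spinor (\<lambda>i v. gam S i *v v) (\<lambda>v. \<i> *s v) \<Omega>
     (\<lambda>j x. frame s j (chart_inv c x) c) (\<lambda>i j l x. conn_coeff s i j l (chart_inv c x))
     (\<lambda>k x. aux_conn s k (chart_inv c x)) (\<lambda>x. spinor_rep (s (chart_inv c x)) (\<psi> (chart_inv c x)))
     (\<lambda>x. a (chart_inv c x)) (\<lambda>x. b (chart_inv c x))"
proof (rule nonvanishing_killing_spinor.intro[OF local_killing_spinor_chart[OF c \<Omega>] nonvanishing_killing_spinor_axioms.intro])
  fix x assume "x \<in> \<Omega>"
  then have "chart_inv c x \<in> U" using in_chart_domD(2)[OF c] \<Omega>(2) by blast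
  then show "spinor_rep (s (chart_inv c x)) (\<psi> (chart_inv c x)) \<noteq> 0"
    using psi_zero_iff[OF section_open(2)[OF c(2)]] spinor_nonvanishing[OF conn] by blast
qed

lemma product_zero:
  assumes conn: "connected (UNIV :: 'm set)" and dim: "CARD('n) \<ge> 4"
  shows "a p * b p = 0"
proof -
  obtain c U s where c: "c \<in> atlas S" "(U, s) \<in> bsections (spinc_bundle S)" "p \<in> fst c" "p \<in> U"
    by (rule chart_and_section)
  interpret nonvanishing_killing_spinor "\<lambda>i v. gam S i *v v" "\<lambda>v. \<i> *s v" "chart_dom c U"
      "\<lambda>j x. frame s j (chart_inv c x) c" "\<lambda>i j l x. conn_coeff s i j l (chart_inv c x)"
      "\<lambda>k x. aux_conn s k (chart_inv c x)" "\<lambda>x. spinor_rep (s (chart_inv c x)) (\<psi> (chart_inv c x))"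
      "\<lambda>x. a (chart_inv c x)" "\<lambda>x. b (chart_inv c x)"
    by (rule nonvanishing_killing_spinor_chart[OF conn c(1,2) open_chart_dom[OF c(1,2)] order_refl])
  have "snd c p \<in> chart_dom c U" using c unfolding chart_dom_def by blast
  from real_times_imaginary_zero[OF dim this] show ?thesis by (simp add: chart_inv_chart[OF atlas_smooth c(1,3)])
qed

lemma real_part_constant:
  assumes conn: "connected (UNIV :: 'm set)" and dim: "CARD('n) \<ge> 4" and p0: "a p0 \<noteq> 0"
  shows "a p = a p0"
proof -
  have a_cont: "continuous_on UNIV a" by (rule smooth_fun_continuous[OF atlas_smooth open_UNIV smooth_real])
  define V where "V = {p. a p = a p0}"
  have "- V = a -` (- {a p0})" by (auto simp: V_def)
  moreover have "open (a -` (- {a p0}))" by (rule open_vimage) (use a_cont in auto)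
  ultimately have "open (- V)" by simp
  moreover have "open V"
    unfolding open_subopen[of V]
  proof
    fix q assume q: "q \<in> V"
    obtain c U s where c: "c \<in> atlas S" "(U, s) \<in> bsections (spinc_bundle S)" "q \<in> fst c" "q \<in> U"
      by (rule chart_and_section)
    have inv: "chart_inv c (snd c y) = y" if "y \<in> fst c" for y by (rule chart_inv_chart[OF atlas_smooth c(1) that])
    define f where "f x = a (chart_inv c x)" for x
    have f: "continuous_on (chart_dom c U) f"
      unfolding f_def by (rule Csmooth_on_continuous[OF real_function_chart_smooth[OF c(1,2) smooth_real]])
    \<comment> \<open>Here \<open>a p0 \<noteq> 0\<close> enters: near \<open>q\<close> the function
      \<open>a\<close> stays nonzero, so \<open>product_zero\<close> makes \<open>b\<close> vanish
      on a whole ball.\<close>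
    have "open (chart_dom c U \<inter> f -` (- {0}))"
      by (intro continuous_open_preimage f open_chart_dom[OF c(1,2)]) auto
    moreover have "snd c q \<in> chart_dom c U \<inter> f -` (- {0})"
      using c q p0 unfolding chart_dom_def by (auto simp: f_def inv V_def)
    ultimately obtain r where r: "r > 0" "ball (snd c q) r \<subseteq> chart_dom c U \<inter> f -` (- {0})"
      using open_contains_ball by blast
    define B where "B = ball (snd c q) r"
    have B: "open B" "B \<subseteq> chart_dom c U" using r by (auto simp: B_def)
    interpret nonvanishing_killing_spinor "\<lambda>i v. gam S i *v v" "\<lambda>v. \<i> *s v" B
      "\<lambda>j x. frame s j (chart_inv c x) c" "\<lambda>i j l x. conn_coeff s i j l (chart_inv c x)"
      "\<lambda>k x. aux_conn s k (chart_inv c x)" "\<lambda>x. spinor_rep (s (chart_inv c x)) (\<psi> (chart_inv c x))"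
      "\<lambda>x. a (chart_inv c x)" "\<lambda>x. b (chart_inv c x)"
      by (rule nonvanishing_killing_spinor_chart[OF conn c(1,2) B])
    have b0: "b (chart_inv c x) = 0" if "x \<in> B" for x
      using product_zero[OF conn dim, of "chart_inv c x"] r(2) that by (auto simp: B_def f_def)
    have "(f has_derivative (\<lambda>v. 0)) (at x within B)" if "x \<in> B" for x
    proof -
      have "frechet_derivative f (at x) = (\<lambda>v. 0)"
        using real_part_locally_constant[OF dim b0 that] unfolding f_def[abs_def] by blast
      then show ?thesis
        using Csmooth_on_has_derivative[OF smooth_a that] unfolding f_def[abs_def] by (metis has_derivative_at_withinI)
    qed
    \<comment> \<open>A ball is convex, so a vanishing derivative forces a constant value.\<close>
    then obtain k where k: "\<And>x. x \<in> B \<Longrightarrow> f x = k"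
      using has_derivative_zero_constant[of B f] by (auto simp: B_def)
    define N where "N = {y \<in> fst c \<inter> U. snd c y \<in> B}"
    have N: "open N" "q \<in> N" using chart_ball_neighbourhood[OF c r(1)] unfolding N_def B_def by blast+
    have "a y = k" if "y \<in> N" for y using that k[of "snd c y"] by (auto simp: N_def f_def inv)
    then have "N \<subseteq> V" using q N(2) by (auto simp: V_def)
    then show "\<exists>T. open T \<and> q \<in> T \<and> T \<subseteq> V" using N by blast
  qed
  moreover have "V \<noteq> {}" by (auto simp: V_def)
  ultimately have "V = UNIV" using connected_clopen[OF conn] by blast
  then show ?thesis by (auto simp: V_def)
qed

end

theorem theorem1p1:
  fixes S :: "('m::{t2_space,second_countable_topology}, 'n::finite, 's::finite, 'p, 'q) spinc_data"
    and a b :: "'m \<Rightarrow> real"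
    and \<psi> :: "'m \<Rightarrow> ('p, 's) spinor"
  assumes "spinc_manifold S"
    and "connected (UNIV :: 'm set)"
    and "CARD('n) \<ge> 4"
    and "smooth_fun (atlas S) UNIV a"
    and "smooth_fun (atlas S) UNIV b"
    and "generalized_killing_spinor S (\<lambda>p. of_real (a p) + \<i> * of_real (b p)) \<psi>"
  shows "((\<forall>p. b p = 0) \<and> real_generalized_killing_spinor S a \<psi> \<and>
            (\<exists>c. (\<forall>p. a p = c) \<and> real_killing_spinor S c \<psi>)) \<or>
         ((\<forall>p. a p = 0) \<and> imaginary_generalized_killing_spinor S b \<psi>)"
proof -
  interpret killing_spinor_setting S a b \<psi>
    using assms by unfold_locales
  show ?thesis
  proof (cases "\<forall>p. a p = 0")
    case True
    then show ?thesis using assms(6) by (simp add: imaginary_generalized_killing_spinor_def)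
  next
    case False
    then obtain p0 where p0: "a p0 \<noteq> 0" by blast
    have ac: "a = (\<lambda>_. a p0)" using real_part_constant[OF assms(2,3) p0] by blast
    \<comment> \<open>Constancy carries the nonzero value of \<open>a\<close> to every point, so the
      vanishing product forces \<open>b\<close> to vanish everywhere.\<close>
    have b0: "b p = 0" for p
      using product_zero[OF assms(2,3), of p] real_part_constant[OF assms(2,3) p0, of p] p0 by simp
    have "real_generalized_killing_spinor S a \<psi>"
      using assms(6) b0 by (simp add: real_generalized_killing_spinor_def)
    moreover from this have "real_killing_spinor S (a p0) \<psi>"
      unfolding real_killing_spinor_def using ac by metis
    ultimately show ?thesis using b0 real_part_constant[OF assms(2,3) p0] by blast
  qed
qed

end
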